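(* Let $A\in\mathbb{R}^{n\times m}$, $1\le r<\min\{n,m\}$, $\bar n=\max\{n,m\}$, and let $\Delta A\in\mathbb{R}^{n\times m}$ have i.i.d. $N(0,\sigma^2)$ entries; set $\widetilde A=A+\Delta A$. Assume $21\sigma\sqrt{\bar n}<\sigma_r(A)-\sigma_{r+1}(A)$. Then with probability at least $1-\frac{c}{n^2}$, \[\min_{Q\in\mathbb{O}_r}\|\widetilde U_1-U_1Q\|_{2,\infty}\le c_1\|U_1\|_{2,\infty}\frac{\sigma^2\bar n}{(\sigma_r(A)-\sigma_{r+1}(A))^2}+c_2\,\sigma\frac{R(r,n)}{\sigma_r(A)-\sigma_{r+1}(A)},\] where $R(r,n)=\sqrt r+\sqrt{\log n}$ if $A$ has rank $r$, and $R(r,n)=r+\sqrt{r\log n}$ otherwise, and $c,c_1,c_2$ are absolute constants independent of $A$ and $\Delta A$.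
   Context: $\sigma_i(\cdot)$ denotes the $i$-th largest singular value. $U_1\in\mathbb{R}^{n\times r}$ and $\widetilde U_1\in\mathbb{R}^{n\times r}$ are matrices whose orthonormal columns are the leading $r$ left singular vectors of $A$ and $\widetilde A$, respectively. $\mathbb{O}_r$ is the set of $r\times r$ orthogonal matrices. $\|M\|_{2,\infty}$ is the maximum Euclidean norm of a row of $M$. *)

theory Defs
  imports "HOL-Probability.Probability" "Jordan_Normal_Form.Jordan_Normal_Form"
    "Jordan_Normal_Form.DL_Rank"
begin

definition sing_vals :: "real mat \<Rightarrow> real list" where
  "sing_vals A = map sqrt (take (min (dim_row A) (dim_col A))
      (rev (sorted_list_of_multiset (proots (char_poly (A * transpose_mat A))))))"

(* sigma_i(A), the i-th largest singular value, 1-indexed (meaningful for 1 \<le> i \<le> min n m) *)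
definition sing_val :: "real mat \<Rightarrow> nat \<Rightarrow> real" where
  "sing_val A i = sing_vals A ! (i - 1)"

definition orthonormal_cols :: "nat \<Rightarrow> nat \<Rightarrow> real mat \<Rightarrow> bool" where
  "orthonormal_cols k r U \<longleftrightarrow> U \<in> carrier_mat k r \<and> transpose_mat U * U = 1\<^sub>m r"

definition orth_group :: "nat \<Rightarrow> real mat set" where
  "orth_group r = {Q. orthonormal_cols r r Q}"

definition leading_left_sing_vecs :: "real mat \<Rightarrow> nat \<Rightarrow> real mat \<Rightarrow> bool" where
  "leading_left_sing_vecs A r U1 \<longleftrightarrow>
     orthonormal_cols (dim_row A) r U1 \<and>
     (\<exists>V1. orthonormal_cols (dim_col A) r V1 \<and>
        A * V1 = U1 * mat r r (\<lambda>(i,j). if i = j then sing_val A (i + 1) else 0) \<and>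
        transpose_mat A * U1 = V1 * mat r r (\<lambda>(i,j). if i = j then sing_val A (i + 1) else 0))"

definition norm_2inf :: "real mat \<Rightarrow> real" where
  "norm_2inf M = Max (insert 0 {sqrt (\<Sum>j<dim_col M. (M $$ (i,j))\<^sup>2) | i. i < dim_row M})"

definition gauss_noise :: "nat \<Rightarrow> nat \<Rightarrow> real \<Rightarrow> (nat \<times> nat \<Rightarrow> real) measure" where
  "gauss_noise n m \<sigma> = PiM ({0..<n} \<times> {0..<m}) (\<lambda>_. density lborel (normal_density 0 \<sigma>))"

definition noise_mat :: "nat \<Rightarrow> nat \<Rightarrow> (nat \<times> nat \<Rightarrow> real) \<Rightarrow> real mat" where
  "noise_mat n m f = mat n m f"

end

theory Submission
  imports Defs
begin

text \<open>
  Let \<open>\<gamma> = \<sigma>\<^sub>r(A) - \<sigma>\<^sub>r\<^sub>+\<^sub>1(A)\<close>, \<open>P = U U\<^sup>T\<close>, and write \<open>W\<close> for the singular vectors of the perturbed matrix. With \<open>Q\<close> taken from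
  the polar factor of \<open>U\<^sup>T W\<close>, row \<open>i\<close> of \<open>W - U Q\<close> is at most \<open>|row i of U| s\<^sup>2 + |W\<^sup>T (1 - P) e\<^sub>i|\<close>, where
  \<open>s\<close> is the sine of the largest principal angle, of order \<open>\<sigma> \<surd>N / \<gamma>\<close> by Wedin's argument once the operator norm of
  the noise is at most \<open>6 \<sigma> \<surd>N\<close>. On that event \<open>W\<^sup>T w\<close> for \<open>w = (1 - P) e\<^sub>i\<close> is controlled by \<open>U\<^sup>T W W\<^sup>T w\<close>, a
  Lipschitz function of the noise with constant of order \<open>1 / \<gamma>\<close>. This function is also odd under an isometry preserving the
  Gaussian law: conjugating the noise by the reflections \<open>1 - 2 U U\<^sup>T\<close> and \<open>1 - 2 V V\<^sup>T\<close> fixes \<open>A\<close> and \<open>w\<close> but changes the sign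
  of \<open>U\<^sup>T\<close>. An odd Lipschitz map concentrates around \<open>0\<close>, although it is defined only on the symmetric event: a
  two-function Gaussian inequality, obtained from Prekopa-Leindler, bounds its exponential moments without any mean.
  A union bound over the \<open>n\<close> rows gives the theorem. The bound with \<open>\<surd>r + \<surd>(log n)\<close> thus holds for every rank, and it is dominated by the
  one with \<open>r + \<surd>(r log n)\<close> because \<open>r \<ge> 1\<close>.
\<close>

subsection \<open>Gaussian two-function inequality\<close>

text \<open>Two points shape the argument. Singular vectors are fixed only up to a rotation, so the
  noise is tested through the projector \<open>W W^T\<close>, which the gap makes unique; no
  measurability of singular vectors is ever established. Each scalar function is replaced by its
  McShane extension, an explicit Borel function, which is then antisymmetrised, and exceptional sets
  are described by a Borel majorant \<open>\<Phi>\<close>. Secondly, \<surd>r and \<surd>(log n)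
  must add rather than multiply, which rules out a union bound over coordinates. The scalar bounds
  for all directions are therefore averaged over an independent Gaussian vector, which yields an
  exponential moment of the whole norm at the price \<open>sqrt 2 ^ r\<close>. Averaging over a
  Gaussian prior also replaces a net on the sphere in the operator norm bound. The factor 21 makes 6
  \<sigma> \<surd>N at most 2 \<gamma> / 7: two noisy matrices then keep a gap of 3 \<gamma> / 7, a
  clean and a noisy one 5 \<gamma> / 7, and the sine is at most 4 / 5.\<close>

lemma nn_integral_eq_superlevel:
  fixes p :: "'a \<Rightarrow> real"
  assumes "sigma_finite_measure M" and [measurable]: "p \<in> borel_measurable M" and "\<And>x. 0 \<le> p x"
  shows "(\<integral>\<^sup>+s\<in>{0<..<1}. emeasure M {x\<in>space M. s < p x} \<partial>lborel) = (\<integral>\<^sup>+x. ennreal (min 1 (p x)) \<partial>M)"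
proof -
  interpret sigma_finite_measure M by fact
  interpret pair_sigma_finite M lborel by standard
  have "(\<integral>\<^sup>+s\<in>{0<..<1}. emeasure M {x\<in>space M. s < p x} \<partial>lborel) =
     (\<integral>\<^sup>+s. (\<integral>\<^sup>+x. indicator {0<..<1} s * (if s < p x then 1 else 0) \<partial>M) \<partial>lborel)"
  proof (intro nn_integral_cong)
    fix s :: real
    have "emeasure M {x\<in>space M. s < p x} = (\<integral>\<^sup>+x. (if s < p x then 1 else 0) \<partial>M)"
    proof -
      have "(\<integral>\<^sup>+x. (if s < p x then 1 else 0) \<partial>M) = (\<integral>\<^sup>+x. indicator {x\<in>space M. s < p x} x \<partial>M)"
        by (intro nn_integral_cong) (auto split: split_indicator)
      then show ?thesis by simp
    qed
    then show "emeasure M {x\<in>space M. s < p x} * indicator {0<..<1} s =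
        (\<integral>\<^sup>+x. indicator {0<..<1} s * (if s < p x then 1 else 0) \<partial>M)"
      by (subst nn_integral_cmult) (simp_all add: mult.commute)
  qed
  also have "\<dots> = (\<integral>\<^sup>+x. (\<integral>\<^sup>+s. indicator {0<..<1} s * (if s < p x then 1 else 0) \<partial>lborel) \<partial>M)"
    by (rule Fubini') measurable
  also have "\<dots> = (\<integral>\<^sup>+x. ennreal (min 1 (p x)) \<partial>M)"
  proof (intro nn_integral_cong)
    fix x
    have "(\<integral>\<^sup>+s. indicator {0<..<1} s * (if s < p x then 1 else 0) \<partial>lborel) = (\<integral>\<^sup>+s. indicator {0<..<min 1 (p x)} s \<partial>lborel)"
      by (intro nn_integral_cong) (auto split: split_indicator)
    also have "\<dots> = min 1 (p x)" using assms(3)[of x] by simp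
    finally show "(\<integral>\<^sup>+s. indicator {0<..<1} s * (if s < p x then 1 else 0) \<partial>lborel) = min 1 (p x)" .
  qed
  finally show ?thesis .
qed

text \<open>One-dimensional Brunn-Minkowski for a target that is symmetric and star-shaped about 0,
  hence up to endpoints an interval of radius \<open>Sup H\<close>. All sums x + y then lie in
  \<open>[-2\<rho>, 2\<rho>]\<close>, so the intervals spanned by \<open>A\<close> and by
  \<open>B\<close> have total length at most \<open>4\<rho>\<close>; no inner approximation of the
  sets is involved.\<close>

lemma emeasure_interval_sum_le:
  fixes A B H :: "real set"
  assumes "A \<noteq> {}" "B \<noteq> {}" and [measurable]: "H \<in> sets borel"
    and H: "\<And>x y. x \<in> H \<Longrightarrow> \<bar>y\<bar> \<le> \<bar>x\<bar> \<Longrightarrow> y \<in> H"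
    and AB: "\<And>x y. x \<in> A \<Longrightarrow> y \<in> B \<Longrightarrow> (x + y) / 2 \<in> H"
  shows "emeasure lborel A + emeasure lborel B \<le> 2 * emeasure lborel H"
proof (cases "\<exists>z. z \<notin> H")
  case False
  then have "H = UNIV" by auto
  then show ?thesis by (simp add: ennreal_mult_top)
next
  case True
  then obtain z where z: "z \<notin> H" by auto
  have bnd: "x \<le> \<bar>z\<bar>" if "x \<in> H" for x using H[OF that, of z] z by force
  have bdd: "bdd_above H" using bnd by (auto simp: bdd_above_def)
  obtain a b where ab: "a \<in> A" "b \<in> B" using assms by auto
  have Hne: "(a+b)/2 \<in> H" using AB ab by auto
  define \<rho> where "\<rho> = Sup H"
  have up: "x \<le> \<rho>" if "x \<in> H" for x using cSup_upper[OF that bdd] by (simp add: \<rho>_def)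
  have lo: "-\<rho> \<le> x" if "x \<in> H" for x using up[OF H[OF that, of "-x"]] by simp
  have \<rho>0: "0 \<le> \<rho>" using up[OF Hne] lo[OF Hne] by simp
  have sub: "{-\<rho><..<\<rho>} \<subseteq> H"
  proof
    fix x assume "x \<in> {-\<rho><..<\<rho>}"
    then have "\<bar>x\<bar> < Sup H" by (auto simp: \<rho>_def)
    then obtain y where "y \<in> H" "\<bar>x\<bar> < y" using less_cSup_iff[OF _ bdd] Hne by blast
    then show "x \<in> H" using H[of y x] by auto
  qed
  have eH: "ennreal (2 * \<rho>) \<le> emeasure lborel H"
    using emeasure_mono[OF sub, of lborel] \<rho>0 by simp
  have u: "x + y \<le> 2 * \<rho>" "-(2 * \<rho>) \<le> x + y" if "x \<in> A" "y \<in> B" for x y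
    using up[OF AB[OF that]] lo[OF AB[OF that]] by auto
  have bA: "bdd_above A" "bdd_below A"
    using u[OF _ ab(2)] by (force intro!: bdd_aboveI[of _ "2*\<rho> - b"] bdd_belowI[of _ "-2*\<rho> - b"])+
  have bB: "bdd_above B" "bdd_below B"
    using u[OF ab(1)] by (force intro!: bdd_aboveI[of _ "2*\<rho> - a"] bdd_belowI[of _ "-2*\<rho> - a"])+
  have "A \<subseteq> {Inf A..Sup A}" "B \<subseteq> {Inf B..Sup B}"
    using bA bB by (auto intro: cSup_upper cInf_lower)
  then have eA: "emeasure lborel A \<le> ennreal (Sup A - Inf A)" "emeasure lborel B \<le> ennreal (Sup B - Inf B)"
    using emeasure_mono[of A "{Inf A..Sup A}" lborel] emeasure_mono[of B "{Inf B..Sup B}" lborel]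
      cInf_le_cSup[OF _ bA] cInf_le_cSup[OF _ bB] assms by auto
  \<comment> \<open>Suprema are taken one variable at a time, over \<open>A\<close> with y fixed and
    then over \<open>B\<close>; the infima below are treated in the same way.\<close>
  have "y \<le> 2 * \<rho> - Sup A" if "y \<in> B" for y
  proof -
    have "Sup A \<le> 2 * \<rho> - y" by (rule cSup_least) (use assms u(1)[OF _ that] in force)+
    then show ?thesis by simp
  qed
  then have s1: "Sup B \<le> 2 * \<rho> - Sup A" by (intro cSup_least) (use assms in auto)
  have "-(2 * \<rho>) - Inf A \<le> y" if "y \<in> B" for y
  proof -
    have "-(2 * \<rho>) - y \<le> Inf A" by (rule cInf_greatest) (use assms u(2)[OF _ that] in force)+
    then show ?thesis by simp
  qed
  then have s2: "-(2 * \<rho>) - Inf A \<le> Inf B" by (intro cInf_greatest) (use assms in auto)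
  have "emeasure lborel A + emeasure lborel B \<le> ennreal (Sup A - Inf A) + ennreal (Sup B - Inf B)"
    using eA by (rule add_mono)
  also have "\<dots> = ennreal ((Sup A - Inf A) + (Sup B - Inf B))"
    using cInf_le_cSup[OF _ bA] cInf_le_cSup[OF _ bB] assms by (subst ennreal_plus) auto
  also have "\<dots> \<le> ennreal (2 * (2 * \<rho>))" using s1 s2 by (intro ennreal_leI) auto
  also have "\<dots> = 2 * ennreal (2 * \<rho>)" using \<rho>0 by (subst ennreal_mult) auto
  also have "\<dots> \<le> 2 * emeasure lborel H" using eH by (intro mult_left_mono) auto
  finally show ?thesis .
qed

text \<open>When \<open>p\<close> and \<open>q\<close> both have supremum 1, their superlevel sets
  are nonempty at every level s in (0,1), and midpoints of the two sets lie where \<open>h\<close>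
  exceeds s because s^2 < p q. Brunn-Minkowski therefore applies level by level, and integrating
  over s gives a bound on the sum of the integrals, stronger than one on their geometric
  mean.\<close>

lemma prekopa_leindler_normalized:
  fixes p q h :: "real \<Rightarrow> real"
  assumes [measurable]: "p \<in> borel_measurable borel" "q \<in> borel_measurable borel" "h \<in> borel_measurable borel"
    and p: "\<And>x. 0 \<le> p x" "\<And>x. p x \<le> 1" "\<And>s. s < 1 \<Longrightarrow> \<exists>x. s < p x"
    and q: "\<And>x. 0 \<le> q x" "\<And>x. q x \<le> 1" "\<And>s. s < 1 \<Longrightarrow> \<exists>x. s < q x"
    and h: "\<And>x. 0 \<le> h x" "\<And>x y. \<bar>y\<bar> \<le> \<bar>x\<bar> \<Longrightarrow> h x \<le> h y"
    and pq: "\<And>x y. p x * q y \<le> (h ((x + y) / 2))\<^sup>2"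
  shows "(\<integral>\<^sup>+x. p x \<partial>lborel) + (\<integral>\<^sup>+x. q x \<partial>lborel) \<le> 2 * (\<integral>\<^sup>+x. h x \<partial>lborel)"
proof -
  have sf: "sigma_finite_measure (lborel :: real measure)" by standard
  note lc = nn_integral_eq_superlevel[OF sf]
  have 1: "(\<integral>\<^sup>+x. p x \<partial>lborel) = (\<integral>\<^sup>+s\<in>{0<..<1}. emeasure lborel {x. s < p x} \<partial>lborel)"
    using lc[of p] p by (simp add: min_absorb2)
  have 2: "(\<integral>\<^sup>+x. q x \<partial>lborel) = (\<integral>\<^sup>+s\<in>{0<..<1}. emeasure lborel {x. s < q x} \<partial>lborel)"
    using lc[of q] q by (simp add: min_absorb2)
  have meas[measurable]: "(\<lambda>s. emeasure lborel {x. s < f x}) \<in> borel_measurable borel"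
    if [measurable]: "f \<in> borel_measurable borel" for f :: "real \<Rightarrow> real"
  proof -
    have "(\<lambda>s. emeasure lborel (Pair s -` {sx \<in> space (borel \<Otimes>\<^sub>M lborel). fst sx < f (snd sx)})) \<in> borel_measurable borel"
      by (rule sigma_finite_measure.measurable_emeasure_Pair[OF sf]) measurable
    then show ?thesis by (simp add: vimage_def space_pair_measure)
  qed
  have "(\<integral>\<^sup>+x. p x \<partial>lborel) + (\<integral>\<^sup>+x. q x \<partial>lborel) =
     (\<integral>\<^sup>+s\<in>{0<..<1}. (emeasure lborel {x. s < p x} + emeasure lborel {x. s < q x}) \<partial>lborel)"
    unfolding 1 2 by (subst nn_integral_add[symmetric]) (auto simp: distrib_right intro!: nn_integral_cong)
  also have "\<dots> \<le> (\<integral>\<^sup>+s\<in>{0<..<1}. 2 * emeasure lborel {x. s < h x} \<partial>lborel)"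
  proof (intro nn_integral_mono)
    fix s :: real
    show "(emeasure lborel {x. s < p x} + emeasure lborel {x. s < q x}) * indicator {0<..<1} s
      \<le> 2 * emeasure lborel {x. s < h x} * indicator {0<..<1} s"
    proof (cases "s \<in> {0<..<1}")
      case True
      have "emeasure lborel {x. s < p x} + emeasure lborel {x. s < q x} \<le> 2 * emeasure lborel {x. s < h x}"
      proof (rule emeasure_interval_sum_le)
        fix x y assume "x \<in> {x. s < p x}" "y \<in> {x. s < q x}"
        then have "s * s < p x * q y" using True by (intro mult_strict_mono) auto
        also note pq
        finally have "s\<^sup>2 < (h ((x + y) / 2))\<^sup>2" by (simp add: power2_eq_square)
        then show "(x + y) / 2 \<in> {x. s < h x}" using h(1) by (auto intro: power2_less_imp_less)
      qed (use p(3)[of s] q(3)[of s] True h(2) in \<open>auto intro: less_le_trans\<close>)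
      then show ?thesis using True by simp
    qed simp
  qed
  also have "\<dots> = 2 * (\<integral>\<^sup>+s\<in>{0<..<1}. emeasure lborel {x. s < h x} \<partial>lborel)"
    by (subst nn_integral_cmult[symmetric]) (auto simp: mult.assoc)
  \<comment> \<open>Since \<open>h\<close> is not normalised, levels below 1 only see
    \<open>min 1 (h x)\<close>; this is a lower bound, which is the direction wanted.\<close>
  also have "\<dots> = 2 * (\<integral>\<^sup>+x. ennreal (min 1 (h x)) \<partial>lborel)"
    using lc[of h] h by simp
  also have "\<dots> \<le> 2 * (\<integral>\<^sup>+x. h x \<partial>lborel)"
    by (intro mult_left_mono nn_integral_mono ennreal_leI) auto
  finally show ?thesis .
qed

text \<open>The parallelogram identity shows that the allowed cost is exactly the factor turning
  \<open>\<phi> x * \<phi> y\<close> into the square of \<open>\<phi>\<close> at the midpoint. Hence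
  u \<phi> and v \<phi> satisfy the Prekopa-Leindler hypothesis with \<open>\<phi>\<close> itself as
  target, and \<open>\<phi>\<close> is symmetric and decreasing in absolute value.\<close>

lemma gaussian_two_function_1:
  fixes u v :: "real \<Rightarrow> ennreal" and \<sigma> :: real
  assumes \<sigma>: "0 < \<sigma>" and [measurable]: "u \<in> borel_measurable borel" "v \<in> borel_measurable borel"
    and uv: "\<And>x y. u x * v y \<le> ennreal (exp ((x - y)\<^sup>2 / (4 * \<sigma>\<^sup>2)))"
  shows "(\<integral>\<^sup>+x. u x \<partial>density lborel (normal_density 0 \<sigma>)) * (\<integral>\<^sup>+x. v x \<partial>density lborel (normal_density 0 \<sigma>)) \<le> 1"
proof -
  define \<phi> where "\<phi> = normal_density 0 \<sigma>"
  have [measurable]: "\<phi> \<in> borel_measurable borel" by (simp add: \<phi>_def)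
  have \<phi>pos: "0 < \<phi> x" for x using normal_density_pos[OF \<sigma>] by (simp add: \<phi>_def)
  have \<phi>mid: "exp ((x - y)\<^sup>2 / (4 * \<sigma>\<^sup>2)) * \<phi> x * \<phi> y = (\<phi> ((x + y) / 2))\<^sup>2" for x y
  proof -
    have e: "(x - y)\<^sup>2 / (4 * \<sigma>\<^sup>2) + (- x\<^sup>2 / (2 * \<sigma>\<^sup>2)) + (- y\<^sup>2 / (2 * \<sigma>\<^sup>2))
        = 2 * (- ((x + y) / 2)\<^sup>2 / (2 * \<sigma>\<^sup>2))"
      using \<sigma> by (simp add: power2_eq_square field_simps)
    have "exp ((x - y)\<^sup>2 / (4 * \<sigma>\<^sup>2)) * exp (- x\<^sup>2 / (2 * \<sigma>\<^sup>2)) * exp (- y\<^sup>2 / (2 * \<sigma>\<^sup>2))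
        = (exp (- ((x + y) / 2)\<^sup>2 / (2 * \<sigma>\<^sup>2)))\<^sup>2"
      unfolding exp_add[symmetric] e exp_double by simp
    then show ?thesis unfolding \<phi>_def normal_density_def
      by (simp add: power2_eq_square field_simps)
  qed
  have \<phi>anti: "\<phi> x \<le> \<phi> y" if "\<bar>y\<bar> \<le> \<bar>x\<bar>" for x y
    using that \<sigma> unfolding \<phi>_def normal_density_def
    by (intro mult_left_mono) (auto simp: abs_le_square_iff divide_right_mono)
  have dens: "(\<integral>\<^sup>+x. f x \<partial>density lborel \<phi>) = (\<integral>\<^sup>+x. f x * \<phi> x \<partial>lborel)"
    if [measurable]: "f \<in> borel_measurable borel" for f :: "real \<Rightarrow> ennreal"
    by (subst nn_integral_density) (auto simp: mult.commute)
  show ?thesis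
  proof (cases "(\<forall>x. u x = 0) \<or> (\<forall>x. v x = 0)")
    case True
    then show ?thesis by auto
  next
    case False
    then obtain x0 y0 where xy0: "u x0 \<noteq> 0" "v y0 \<noteq> 0" by auto
    \<comment> \<open>Fixing one nonzero value of each function turns the product hypothesis into a
      pointwise bound on the other one. The same device, applied to \<open>p\<close> and
      \<open>q\<close> below, bounds their suprema.\<close>
    have fin: "u x < \<top>" "v x < \<top>" for x
      using uv[of x y0] uv[of x0 x] xy0
      by (auto simp: ennreal_mult_eq_top_iff top_unique less_top[symmetric])
    define p q where "p x = enn2real (u x) * \<phi> x" and "q x = enn2real (v x) * \<phi> x" for x
    have [measurable]: "p \<in> borel_measurable borel" "q \<in> borel_measurable borel"
      by (simp_all add: p_def[abs_def] q_def[abs_def])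
    have up: "ennreal (p x) = u x * \<phi> x" "ennreal (q x) = v x * \<phi> x" for x
      using fin[of x] \<phi>pos[of x] by (simp_all add: p_def q_def ennreal_mult less_top)
    have p0: "0 \<le> p x" "0 \<le> q x" for x using \<phi>pos[of x] by (simp_all add: p_def q_def)
    have pq: "p x * q y \<le> (\<phi> ((x + y) / 2))\<^sup>2" for x y
    proof -
      have "enn2real (u x) * enn2real (v y) = enn2real (u x * v y)" by (simp add: enn2real_mult)
      also have "\<dots> \<le> exp ((x - y)\<^sup>2 / (4 * \<sigma>\<^sup>2))"
        using uv[of x y] by (intro enn2real_leI) auto
      finally have "(enn2real (u x) * enn2real (v y)) * (\<phi> x * \<phi> y) \<le> exp ((x - y)\<^sup>2 / (4 * \<sigma>\<^sup>2)) * (\<phi> x * \<phi> y)"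
        using \<phi>pos[of x] \<phi>pos[of y] by (intro mult_right_mono) auto
      then show ?thesis using \<phi>mid[of x y] by (simp add: p_def q_def ac_simps)
    qed
    have pq0: "p x * q y \<le> (\<phi> 0)\<^sup>2" for x y
      using pq[of x y] \<phi>anti[of 0 "(x+y)/2"] \<phi>pos[of "(x+y)/2"] power_mono[of "\<phi> ((x+y)/2)" "\<phi> 0" 2] by linarith
    have px0: "0 < p x0" "0 < q y0" using xy0 fin \<phi>pos by (auto simp: p_def q_def enn2real_positive_iff less_top zero_less_iff_neq_zero intro!: mult_pos_pos)
    have bdd: "bdd_above (range p)" "bdd_above (range q)"
    proof -
      show "bdd_above (range p)" using pq0[of _ y0] px0
        by (intro bdd_aboveI[of _ "(\<phi> 0)\<^sup>2 / q y0"]) (auto simp: field_simps)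
      show "bdd_above (range q)" using pq0[of x0] px0
        by (intro bdd_aboveI[of _ "(\<phi> 0)\<^sup>2 / p x0"]) (auto simp: field_simps)
    qed
    define \<alpha> \<beta> where "\<alpha> = Sup (range p)" and "\<beta> = Sup (range q)"
    have le: "p x \<le> \<alpha>" "q x \<le> \<beta>" for x using bdd by (auto simp: \<alpha>_def \<beta>_def intro: cSup_upper)
    have \<alpha>: "0 < \<alpha>" "0 < \<beta>" using le[of x0] le[of y0] px0 by auto
    \<comment> \<open>Dividing \<open>p\<close> and \<open>q\<close> by their suprema forces the
      target to be divided by the geometric mean of these. The resulting bound 2 / \<gamma> on the
      sum becomes 1 / (\<alpha> \<beta>) for the product by AM-GM, and the normalising factors
      cancel.\<close>
    define \<gamma> where "\<gamma> = sqrt (\<alpha> * \<beta>)"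
    have \<gamma>: "0 < \<gamma>" "\<gamma>\<^sup>2 = \<alpha> * \<beta>" using \<alpha> by (auto simp: \<gamma>_def)
    define P Q where "P = (\<integral>x. p x / \<alpha> \<partial>lborel)" and "Q = (\<integral>x. q x / \<beta> \<partial>lborel)"
    have sum_le: "(\<integral>\<^sup>+x. p x / \<alpha> \<partial>lborel) + (\<integral>\<^sup>+x. q x / \<beta> \<partial>lborel) \<le> 2 * (\<integral>\<^sup>+x. \<phi> x / \<gamma> \<partial>lborel)"
    proof (rule prekopa_leindler_normalized)
      show "p x / \<alpha> * (q y / \<beta>) \<le> (\<phi> ((x + y) / 2) / \<gamma>)\<^sup>2" for x y
        using pq[of x y] \<alpha> by (simp add: power_divide \<gamma>(2) divide_right_mono)
      show "\<exists>x. s < p x / \<alpha>" if "s < 1" for s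
        using less_cSup_iff[OF _ bdd(1), of "s * \<alpha>"] that \<alpha> by (auto simp: \<alpha>_def[symmetric] field_simps)
      show "\<exists>x. s < q x / \<beta>" if "s < 1" for s
        using less_cSup_iff[OF _ bdd(2), of "s * \<beta>"] that \<alpha> by (auto simp: \<beta>_def[symmetric] field_simps)
      show "\<phi> x / \<gamma> \<le> \<phi> y / \<gamma>" if "\<bar>y\<bar> \<le> \<bar>x\<bar>" for x y
        using \<phi>anti[OF that] \<gamma> by (simp add: divide_right_mono)
    qed (use p0 \<alpha> \<gamma> \<phi>pos le in \<open>auto simp: less_imp_le\<close>)
    have "(\<integral>\<^sup>+x. \<phi> x / \<gamma> \<partial>lborel) = ennreal (1 / \<gamma>)"
    proof -
      have "integral\<^sup>N lborel (\<lambda>x. ennreal (\<phi> x)) = 1"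
        using \<sigma> by (simp add: \<phi>_def nn_integral_eq_integral)
      moreover have "ennreal (\<phi> x / \<gamma>) = ennreal (1/\<gamma>) * ennreal (\<phi> x)" for x
        using \<gamma> \<phi>pos[of x] by (subst ennreal_mult[symmetric]) auto
      ultimately show ?thesis by (simp add: nn_integral_cmult)
    qed
    with sum_le have sum_le: "(\<integral>\<^sup>+x. p x / \<alpha> \<partial>lborel) + (\<integral>\<^sup>+x. q x / \<beta> \<partial>lborel) \<le> ennreal (2 / \<gamma>)"
      using \<gamma> by (simp add: ennreal_mult[symmetric] flip: ennreal_numeral)
    define a b where "a = (\<integral>\<^sup>+x. p x / \<alpha> \<partial>lborel)" and "b = (\<integral>\<^sup>+x. q x / \<beta> \<partial>lborel)"
    have abfin: "a < \<top>" "b < \<top>" using sum_le unfolding a_def[symmetric] b_def[symmetric]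
      by (auto simp: less_top[symmetric] top_unique)
    obtain ar br where ar: "a = ennreal ar" "b = ennreal br" "0 \<le> ar" "0 \<le> br"
      using abfin by (cases a; cases b) auto
    have "ar + br \<le> 2 / \<gamma>" using sum_le \<gamma> ar unfolding a_def[symmetric] b_def[symmetric]
      by (simp flip: ennreal_plus)
    then have "(ar + br)\<^sup>2 \<le> (2 / \<gamma>)\<^sup>2" using ar by (intro power_mono) auto
    moreover have "4 * (ar * br) \<le> (ar + br)\<^sup>2" using sum_squares_bound[of ar br] by (simp add: power2_sum)
    ultimately have "4 * (ar * br) \<le> 4 / (\<alpha> * \<beta>)" using \<gamma> by (simp add: power_divide)
    then have ab: "ar * br * (\<alpha> * \<beta>) \<le> 1" using \<alpha> by (simp add: pos_le_divide_eq)
    have "(\<integral>\<^sup>+x. u x * \<phi> x \<partial>lborel) = \<alpha> * a" "(\<integral>\<^sup>+x. v x * \<phi> x \<partial>lborel) = \<beta> * b"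
      unfolding a_def b_def using \<alpha> p0
      by (simp_all add: nn_integral_cmult[symmetric] ennreal_mult[symmetric] up(1)[symmetric] up(2)[symmetric])
    then have "(\<integral>\<^sup>+x. u x * \<phi> x \<partial>lborel) * (\<integral>\<^sup>+x. v x * \<phi> x \<partial>lborel) = ennreal (ar * br * (\<alpha> * \<beta>))"
      using ar \<alpha> by (simp add: ennreal_mult[symmetric] ac_simps)
    also have "\<dots> \<le> 1" using ab by simp
    finally show ?thesis by (simp add: dens flip: \<phi>_def)
  qed
qed

abbreviation gauss :: "real \<Rightarrow> real measure" where
  "gauss \<sigma> \<equiv> density lborel (\<lambda>x. ennreal (normal_density 0 \<sigma> x))"

lemma product_sigma_finite_gauss:
  assumes "0 < \<sigma>" shows "product_sigma_finite (\<lambda>_. gauss \<sigma>)"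
  unfolding product_sigma_finite_def
  using prob_space_imp_sigma_finite[OF prob_space_normal_density[OF assms]] by auto

text \<open>The inequality tensorises because the cost is a sum over coordinates: integrating out
  all coordinates but one leaves two functions of that coordinate which satisfy the one-dimensional
  hypothesis.\<close>

lemma gaussian_two_function:
  fixes u v :: "('i \<Rightarrow> real) \<Rightarrow> ennreal" and \<sigma> :: real
  assumes \<sigma>: "0 < \<sigma>" and "finite I"
    and "u \<in> borel_measurable (PiM I (\<lambda>_. gauss \<sigma>))" "v \<in> borel_measurable (PiM I (\<lambda>_. gauss \<sigma>))"
    and "\<And>x y. x \<in> extensional I \<Longrightarrow> y \<in> extensional I \<Longrightarrow>
       u x * v y \<le> ennreal (exp ((\<Sum>i\<in>I. (x i - y i)\<^sup>2) / (4 * \<sigma>\<^sup>2)))"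
  shows "(\<integral>\<^sup>+x. u x \<partial>PiM I (\<lambda>_. gauss \<sigma>)) * (\<integral>\<^sup>+x. v x \<partial>PiM I (\<lambda>_. gauss \<sigma>)) \<le> 1"
  using assms(2-)
proof (induction I arbitrary: u v rule: finite_induct)
  case empty
  interpret product_sigma_finite "\<lambda>_. gauss \<sigma>"
    using \<sigma> by (rule product_sigma_finite_gauss)
  show ?case using empty(3)[of "\<lambda>_. undefined" "\<lambda>_. undefined"] by (simp add: nn_integral_empty)
next
  case (insert i I)
  interpret product_sigma_finite "\<lambda>_. gauss \<sigma>"
    using \<sigma> by (rule product_sigma_finite_gauss)
  let ?G = "PiM I (\<lambda>_. gauss \<sigma>)"
  note [measurable] = insert(4,5)
  have sf: "sigma_finite_measure ?G" using insert(1) by (rule sigma_finite)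
  define U V where "U t = (\<integral>\<^sup>+x. u (x(i := t)) \<partial>?G)" and "V t = (\<integral>\<^sup>+x. v (x(i := t)) \<partial>?G)" for t
  have mp: "(\<lambda>(t, x). x(i := t)) \<in> (gauss \<sigma>) \<Otimes>\<^sub>M ?G \<rightarrow>\<^sub>M PiM (insert i I) (\<lambda>_. gauss \<sigma>)"
    by measurable
  have mU: "U \<in> borel_measurable (gauss \<sigma>)" "V \<in> borel_measurable (gauss \<sigma>)"
    unfolding U_def[abs_def] V_def[abs_def]
    using sigma_finite_measure.borel_measurable_nn_integral[OF sf, of "\<lambda>t x. u (x(i := t))" "gauss \<sigma>"]
      sigma_finite_measure.borel_measurable_nn_integral[OF sf, of "\<lambda>t x. v (x(i := t))" "gauss \<sigma>"]
      measurable_compose[OF mp insert(4)] measurable_compose[OF mp insert(5)]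
    by (auto simp: case_prod_beta')
  have UV: "U s * V t \<le> ennreal (exp ((s - t)\<^sup>2 / (4 * \<sigma>\<^sup>2)))" for s t
  proof -
    \<comment> \<open>The share of the cost belonging to coordinate \<open>i\<close>, moved to the
      left so that the sections at \<open>s\<close> and \<open>t\<close> satisfy the hypothesis of
      the induction.\<close>
    let ?c = "ennreal (exp (- (s - t)\<^sup>2 / (4 * \<sigma>\<^sup>2)))"
    have mm[measurable]: "(\<lambda>x. u (x(i := s))) \<in> borel_measurable ?G" "(\<lambda>x. v (x(i := t))) \<in> borel_measurable ?G"
      by measurable
    have "(\<integral>\<^sup>+x. ?c * u (x(i := s)) \<partial>?G) * V t \<le> 1" unfolding V_def
    proof (rule insert(3))
      fix x y :: "'i \<Rightarrow> real" assume x: "x \<in> extensional I" "y \<in> extensional I"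
      have "(\<Sum>j\<in>insert i I. ((x(i := s)) j - (y(i := t)) j)\<^sup>2) = (s - t)\<^sup>2 + (\<Sum>j\<in>I. (x j - y j)\<^sup>2)"
        using insert(1,2) by (simp, intro sum.cong) auto
      moreover have "x(i := s) \<in> extensional (insert i I)" "y(i := t) \<in> extensional (insert i I)"
        using x by (auto simp: extensional_def)
      ultimately have "u (x(i := s)) * v (y(i := t)) \<le> ennreal (exp (((s - t)\<^sup>2 + (\<Sum>j\<in>I. (x j - y j)\<^sup>2)) / (4 * \<sigma>\<^sup>2)))"
        using insert(6)[of "x(i := s)" "y(i := t)"] by metis
      then have "?c * (u (x(i := s)) * v (y(i := t))) \<le> ?c * ennreal (exp (((s - t)\<^sup>2 + (\<Sum>j\<in>I. (x j - y j)\<^sup>2)) / (4 * \<sigma>\<^sup>2)))"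
        by (intro mult_left_mono) auto
      also have "\<dots> = ennreal (exp ((\<Sum>j\<in>I. (x j - y j)\<^sup>2) / (4 * \<sigma>\<^sup>2)))"
        by (simp add: ennreal_mult[symmetric] exp_add[symmetric] add_divide_distrib diff_divide_distrib)
      finally show "?c * u (x(i := s)) * v (y(i := t)) \<le> ennreal (exp ((\<Sum>j\<in>I. (x j - y j)\<^sup>2) / (4 * \<sigma>\<^sup>2)))"
        by (simp add: mult.assoc)
    qed measurable
    then have "ennreal (exp ((s - t)\<^sup>2 / (4 * \<sigma>\<^sup>2))) * (?c * U s * V t) \<le> ennreal (exp ((s - t)\<^sup>2 / (4 * \<sigma>\<^sup>2))) * 1"
      unfolding U_def by (intro mult_left_mono) (simp_all add: nn_integral_cmult)
    moreover have "ennreal (exp ((s - t)\<^sup>2 / (4 * \<sigma>\<^sup>2))) * ?c = 1"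
      by (simp add: ennreal_mult[symmetric] exp_add[symmetric])
    ultimately show ?thesis by (simp add: mult.assoc[symmetric])
  qed
  have "(\<integral>\<^sup>+t. U t \<partial>gauss \<sigma>) * (\<integral>\<^sup>+t. V t \<partial>gauss \<sigma>) \<le> 1"
    using gaussian_two_function_1[OF \<sigma> _ _ UV] mU by simp
  then show ?case
    using insert(1,2) by (simp add: product_nn_integral_insert_rev U_def V_def)
qed

section \<open>Exponential moments of Lipschitz functions, and invariance of product
  measures\<close>

lemma sets_PiM_lborel : "sets (PiM I (\<lambda>_. lborel)) = sets (PiM I (\<lambda>_. borel :: real measure))"
  and sets_PiM_gauss : "sets (PiM I (\<lambda>_. gauss \<sigma>)) = sets (PiM I (\<lambda>_. borel :: real measure))"
  by (auto intro!: sets_PiM_cong)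

lemma space_PiM_gauss: "space (PiM I (\<lambda>_. gauss \<sigma>)) = extensional I"
  by (simp add: space_PiM PiE_def)

lemma prob_space_PiM_gauss: "0 < \<sigma> \<Longrightarrow> prob_space (PiM I (\<lambda>_. gauss \<sigma>))"
  by (intro prob_space_PiM prob_space_normal_density)

lemma product_sigma_finite_lborel: "product_sigma_finite (\<lambda>_. lborel :: real measure)"
  by standard

lemma L2_set_square_sum: "(L2_set f I)\<^sup>2 = (\<Sum>i\<in>I. (f i)\<^sup>2)"
  by (simp add: L2_set_def sum_nonneg)

text \<open>The two-function inequality is applied to exp F and exp (- F - \<sigma>^2 L^2). With d
  the distance of x and y, its hypothesis amounts to L d at most \<sigma>^2 L^2 + d^2 / (4
  \<sigma>^2), which is the nonnegativity of (2 \<sigma>^2 L - d)^2. A mean of F never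
  appears.\<close>

lemma lipschitz_gauss_exp:
  fixes F :: "('i \<Rightarrow> real) \<Rightarrow> real"
  assumes \<sigma>: "0 < \<sigma>" and fin: "finite I" and [measurable]: "F \<in> borel_measurable (PiM I (\<lambda>_. borel))"
    and lip: "\<And>x y. x \<in> extensional I \<Longrightarrow> y \<in> extensional I \<Longrightarrow> F x - F y \<le> L * L2_set (\<lambda>i. x i - y i) I"
  shows "(\<integral>\<^sup>+x. exp (F x) \<partial>PiM I (\<lambda>_. gauss \<sigma>)) * (\<integral>\<^sup>+x. exp (- F x) \<partial>PiM I (\<lambda>_. gauss \<sigma>)) \<le> exp (\<sigma>\<^sup>2 * L\<^sup>2)"
proof -
  let ?G = "PiM I (\<lambda>_. gauss \<sigma>)" and ?c = "\<sigma>\<^sup>2 * L\<^sup>2"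
  have "(\<integral>\<^sup>+x. exp (F x) \<partial>?G) * (\<integral>\<^sup>+x. exp (- F x - ?c) \<partial>?G) \<le> 1"
  proof (rule gaussian_two_function[OF \<sigma> fin])
    fix x y :: "'i \<Rightarrow> real" assume xy: "x \<in> extensional I" "y \<in> extensional I"
    define d where "d = L2_set (\<lambda>i. x i - y i) I"
    have "0 \<le> (2 * \<sigma>\<^sup>2 * L - d)\<^sup>2" by simp
    then have "L * d * (4 * \<sigma>\<^sup>2) \<le> ?c * (4 * \<sigma>\<^sup>2) + d\<^sup>2"
      by (simp add: power2_eq_square algebra_simps)
    then have "L * d \<le> ?c + d\<^sup>2 / (4 * \<sigma>\<^sup>2)" using \<sigma> by (simp add: field_simps)
    then have "F x + (- F y - ?c) \<le> d\<^sup>2 / (4 * \<sigma>\<^sup>2)" using lip[OF xy] by (simp add: d_def)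
    then show "ennreal (exp (F x)) * ennreal (exp (- F y - ?c)) \<le> ennreal (exp ((\<Sum>i\<in>I. (x i - y i)\<^sup>2) / (4 * \<sigma>\<^sup>2)))"
      by (simp add: ennreal_mult[symmetric] exp_add[symmetric] d_def L2_set_square_sum)
  qed measurable
  then have le: "ennreal (exp ?c) * ((\<integral>\<^sup>+x. exp (F x) \<partial>?G) * (\<integral>\<^sup>+x. exp (- F x - ?c) \<partial>?G)) \<le> ennreal (exp ?c) * 1"
    by (intro mult_left_mono) (simp_all only: zero_le)
  have "ennreal (exp ?c) * (\<integral>\<^sup>+x. exp (- F x - ?c) \<partial>?G) = (\<integral>\<^sup>+x. exp (- F x) \<partial>?G)"
    by (subst nn_integral_cmult[symmetric]) (auto simp: ennreal_mult[symmetric] exp_add[symmetric])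
  then have "(\<integral>\<^sup>+x. exp (F x) \<partial>?G) * (\<integral>\<^sup>+x. exp (- F x) \<partial>?G) =
      ennreal (exp ?c) * ((\<integral>\<^sup>+x. exp (F x) \<partial>?G) * (\<integral>\<^sup>+x. exp (- F x - ?c) \<partial>?G))"
    by (simp only: mult.left_commute[of "ennreal (exp ?c)"])
  also note le
  finally show ?thesis by (simp only: mult_1_right)
qed

text \<open>Oddness enters only as equality of the moments of exp F and exp (- F), so the preceding
  product bound is a bound on a square. An infinite moment is excluded first, because its square
  would exceed the finite right side.\<close>

lemma odd_lipschitz_gauss_exp:
  fixes F :: "('i \<Rightarrow> real) \<Rightarrow> real"
  assumes \<sigma>: "0 < \<sigma>" and fin: "finite I" and F: "F \<in> borel_measurable (PiM I (\<lambda>_. borel))"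
    and lip: "\<And>x y. x \<in> extensional I \<Longrightarrow> y \<in> extensional I \<Longrightarrow> F x - F y \<le> L * L2_set (\<lambda>i. x i - y i) I"
    and odd: "(\<integral>\<^sup>+x. exp (- F x) \<partial>PiM I (\<lambda>_. gauss \<sigma>)) = (\<integral>\<^sup>+x. exp (F x) \<partial>PiM I (\<lambda>_. gauss \<sigma>))"
  shows "(\<integral>\<^sup>+x. exp (F x) \<partial>PiM I (\<lambda>_. gauss \<sigma>)) \<le> exp (\<sigma>\<^sup>2 * L\<^sup>2 / 2)"
proof -
  define a where "a = (\<integral>\<^sup>+x. exp (F x) \<partial>PiM I (\<lambda>_. gauss \<sigma>))"
  have aa: "a * a \<le> exp (\<sigma>\<^sup>2 * L\<^sup>2)"
  proof -
    have "(\<integral>\<^sup>+x. exp (F x) \<partial>PiM I (\<lambda>_. gauss \<sigma>)) * (\<integral>\<^sup>+x. exp (- F x) \<partial>PiM I (\<lambda>_. gauss \<sigma>)) \<le> exp (\<sigma>\<^sup>2 * L\<^sup>2)"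
      by (rule lipschitz_gauss_exp[OF \<sigma> fin F]) (rule lip)
    then show ?thesis by (simp only: odd a_def)
  qed
  have "a \<noteq> \<top>"
  proof
    assume "a = \<top>"
    then show False using aa by (simp add: top_unique)
  qed
  then have a: "a = ennreal (enn2real a)" by (simp add: less_top)
  have e: "exp (\<sigma>\<^sup>2 * L\<^sup>2) = (exp (\<sigma>\<^sup>2 * L\<^sup>2 / 2))\<^sup>2"
    using exp_double[of "\<sigma>\<^sup>2 * L\<^sup>2 / 2"] by simp
  have "enn2real (a * a) \<le> exp (\<sigma>\<^sup>2 * L\<^sup>2)" using aa by (intro enn2real_leI) simp_all
  then have "(enn2real a)\<^sup>2 \<le> (exp (\<sigma>\<^sup>2 * L\<^sup>2 / 2))\<^sup>2"
    unfolding e by (simp add: enn2real_mult power2_eq_square)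
  then have "enn2real a \<le> exp (\<sigma>\<^sup>2 * L\<^sup>2 / 2)" by (rule power2_le_imp_le) simp
  then have "ennreal (enn2real a) \<le> exp (\<sigma>\<^sup>2 * L\<^sup>2 / 2)" by (rule ennreal_leI)
  then show ?thesis unfolding a[symmetric] by (simp only: a_def)
qed

lemma measurable_fun_upd_pair:
  "(\<lambda>(t, x). x(i := t)) \<in> borel \<Otimes>\<^sub>M PiM I (\<lambda>_. borel) \<rightarrow>\<^sub>M PiM (insert i I) (\<lambda>_. borel :: real measure)"
  by measurable

lemma measurable_fun_upd_arg:
  assumes "f \<in> PiM (insert i I) (\<lambda>_. borel :: real measure) \<rightarrow>\<^sub>M N"
  shows "(\<lambda>(t, x). f (x(i := t))) \<in> borel \<Otimes>\<^sub>M PiM I (\<lambda>_. borel) \<rightarrow>\<^sub>M N"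
    and "(\<lambda>x. f (x(i := t))) \<in> PiM I (\<lambda>_. borel) \<rightarrow>\<^sub>M N"
proof -
  show 1: "(\<lambda>(t, x). f (x(i := t))) \<in> borel \<Otimes>\<^sub>M PiM I (\<lambda>_. borel) \<rightarrow>\<^sub>M N"
    using measurable_compose[OF measurable_fun_upd_pair assms] by (simp add: case_prod_beta')
  show "(\<lambda>x. f (x(i := t))) \<in> PiM I (\<lambda>_. borel) \<rightarrow>\<^sub>M N"
    using measurable_compose[OF measurable_Pair1' 1, of t] by simp
qed

lemma borel_measurable_nn_integral_PiM_lborel:
  fixes g :: "real \<Rightarrow> ('i \<Rightarrow> real) \<Rightarrow> ennreal"
  assumes "finite I" "(\<lambda>(t, x). g t x) \<in> borel_measurable (borel \<Otimes>\<^sub>M PiM I (\<lambda>_. borel))"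
  shows "(\<lambda>t. \<integral>\<^sup>+x. g t x \<partial>PiM I (\<lambda>_. lborel)) \<in> borel_measurable borel"
proof (rule sigma_finite_measure.borel_measurable_nn_integral)
  show "sigma_finite_measure (PiM I (\<lambda>_. lborel :: real measure))"
    using product_sigma_finite.sigma_finite[OF product_sigma_finite_lborel assms(1)] .
  have "sets (borel \<Otimes>\<^sub>M PiM I (\<lambda>_. lborel :: real measure)) = sets (borel \<Otimes>\<^sub>M PiM I (\<lambda>_. borel :: real measure))"
    by (intro sets_pair_measure_cong sets_PiM_lborel refl)
  then show "(\<lambda>(t, x). g t x) \<in> borel_measurable (borel \<Otimes>\<^sub>M PiM I (\<lambda>_. lborel))"
    using assms(2) measurable_cong_sets by blast
qed

lemma measurable_PiM_lborel [simp]: "measurable (PiM I (\<lambda>_. lborel :: real measure)) N = measurable (PiM I (\<lambda>_. borel)) N"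
  and measurable_PiM_gauss [simp]: "measurable (PiM I (\<lambda>_. gauss \<sigma>)) N = measurable (PiM I (\<lambda>_. borel)) N"
  by (rule measurable_cong_sets, simp_all only: sets_PiM_lborel sets_PiM_gauss)+

lemma nn_integral_PiM_insert_gauss:
  assumes "0 < \<sigma>" "finite I" "i \<notin> I" "f \<in> borel_measurable (PiM (insert i I) (\<lambda>_. borel))"
  shows "(\<integral>\<^sup>+x. f x \<partial>PiM (insert i I) (\<lambda>_. gauss \<sigma>)) = (\<integral>\<^sup>+t. (\<integral>\<^sup>+x. f (x(i := t)) \<partial>PiM I (\<lambda>_. gauss \<sigma>)) \<partial>gauss \<sigma>)"
  using product_sigma_finite.product_nn_integral_insert_rev[OF product_sigma_finite_gauss[OF assms(1)] assms(2,3)]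
    assms(4) by simp

lemma nn_integral_PiM_insert_lborel:
  fixes f :: "('i \<Rightarrow> real) \<Rightarrow> ennreal"
  assumes "finite I" "i \<notin> I" "f \<in> borel_measurable (PiM (insert i I) (\<lambda>_. borel))"
  shows "(\<integral>\<^sup>+x. f x \<partial>PiM (insert i I) (\<lambda>_. lborel)) = (\<integral>\<^sup>+t. (\<integral>\<^sup>+x. f (x(i := t)) \<partial>PiM I (\<lambda>_. lborel)) \<partial>lborel)"
  using product_sigma_finite.product_nn_integral_insert_rev[OF product_sigma_finite_lborel assms(1,2)]
    assms(3) by simp

lemma borel_measurable_prod_density [measurable]:
  "(\<lambda>x. ennreal (\<Prod>i\<in>I. normal_density 0 \<sigma> (x i))) \<in> borel_measurable (PiM I (\<lambda>_. borel))"
  by measurable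

text \<open>Passing to a density splits every invariance of the Gaussian law into an invariance of
  Lebesgue measure and a computation with the density.\<close>

lemma nn_integral_PiM_gauss:
  fixes f :: "('i \<Rightarrow> real) \<Rightarrow> ennreal"
  assumes \<sigma>: "0 < \<sigma>" and "finite I" "f \<in> borel_measurable (PiM I (\<lambda>_. borel))"
  shows "(\<integral>\<^sup>+x. f x \<partial>PiM I (\<lambda>_. gauss \<sigma>)) =
    (\<integral>\<^sup>+x. f x * ennreal (\<Prod>i\<in>I. normal_density 0 \<sigma> (x i)) \<partial>PiM I (\<lambda>_. lborel))"
  using assms(2,3)
proof (induction I arbitrary: f rule: finite_induct)
  case empty
  show ?case by (simp add: PiM_empty nn_integral_count_space_finite)
next
  case (insert i I)
  let ?w = "\<lambda>J x. ennreal (\<Prod>i\<in>J. normal_density 0 \<sigma> (x i))"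
  have fw: "(\<lambda>x. f x * ?w (insert i I) x) \<in> borel_measurable (PiM (insert i I) (\<lambda>_. borel))"
    using insert.prems borel_measurable_prod_density by (rule borel_measurable_times_ennreal)
  note m = measurable_fun_upd_arg[OF insert.prems]
  have wi: "?w (insert i I) (x(i := t)) = normal_density 0 \<sigma> t * ?w I x" for x t
  proof -
    have "(\<Prod>j\<in>I. normal_density 0 \<sigma> ((x(i := t)) j)) = (\<Prod>j\<in>I. normal_density 0 \<sigma> (x j))"
      using insert(2) by (intro prod.cong) auto
    then show ?thesis using insert(1,2) by (simp add: ennreal_mult prod_nonneg del: fun_upd_apply)
       (simp add: ennreal_mult prod_nonneg)
  qed
  have "(\<integral>\<^sup>+x. f x \<partial>PiM (insert i I) (\<lambda>_. gauss \<sigma>)) = (\<integral>\<^sup>+t. (\<integral>\<^sup>+x. f (x(i := t)) \<partial>PiM I (\<lambda>_. gauss \<sigma>)) \<partial>gauss \<sigma>)"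
    by (rule nn_integral_PiM_insert_gauss[OF \<sigma> insert(1,2) insert.prems])
  also have "\<dots> = (\<integral>\<^sup>+t. (\<integral>\<^sup>+x. f (x(i := t)) * ?w I x \<partial>PiM I (\<lambda>_. lborel)) \<partial>gauss \<sigma>)"
    by (intro nn_integral_cong insert.IH m)
  also have "\<dots> = (\<integral>\<^sup>+t. normal_density 0 \<sigma> t * (\<integral>\<^sup>+x. f (x(i := t)) * ?w I x \<partial>PiM I (\<lambda>_. lborel)) \<partial>lborel)"
  proof (rule nn_integral_density)
    have "(\<lambda>(t, x). f (x(i := t)) * ?w I x) \<in> borel_measurable (borel \<Otimes>\<^sub>M PiM I (\<lambda>_. borel))"
      using borel_measurable_times_ennreal[OF m(1) measurable_compose[OF measurable_snd borel_measurable_prod_density[where \<sigma> = \<sigma>]]]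
      by (simp add: case_prod_beta' del: fun_upd_apply)
    then show "(\<lambda>t. \<integral>\<^sup>+x. f (x(i := t)) * ?w I x \<partial>PiM I (\<lambda>_. lborel)) \<in> borel_measurable lborel"
      using borel_measurable_nn_integral_PiM_lborel[OF insert(1)] by simp
  qed simp
  also have "\<dots> = (\<integral>\<^sup>+t. (\<integral>\<^sup>+x. f (x(i := t)) * ?w (insert i I) (x(i := t)) \<partial>PiM I (\<lambda>_. lborel)) \<partial>lborel)"
  proof (intro nn_integral_cong)
    fix t :: real
    have "(\<lambda>x. f (x(i := t)) * ?w I x) \<in> borel_measurable (PiM I (\<lambda>_. lborel))"
      using borel_measurable_times_ennreal[OF m(2) borel_measurable_prod_density] by (simp del: fun_upd_apply)
    from nn_integral_cmult[OF this, of "normal_density 0 \<sigma> t"]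
    show "normal_density 0 \<sigma> t * (\<integral>\<^sup>+x. f (x(i := t)) * ?w I x \<partial>PiM I (\<lambda>_. lborel)) =
      (\<integral>\<^sup>+x. f (x(i := t)) * ?w (insert i I) (x(i := t)) \<partial>PiM I (\<lambda>_. lborel))"
      unfolding wi by (simp add: mult.left_commute)
  qed
  also have "\<dots> = (\<integral>\<^sup>+x. f x * ?w (insert i I) x \<partial>PiM (insert i I) (\<lambda>_. lborel))"
    by (rule nn_integral_PiM_insert_lborel[OF insert(1,2) fw, symmetric])
  finally show ?case .
qed

lemma measurable_translate:
  "(\<lambda>x. \<lambda>i\<in>I. x i + a i) \<in> PiM I (\<lambda>_. borel) \<rightarrow>\<^sub>M PiM I (\<lambda>_. borel :: real measure)"
  by measurable

lemma nn_integral_PiM_lborel_translate: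
  fixes f :: "('i \<Rightarrow> real) \<Rightarrow> ennreal"
  assumes "finite I" "f \<in> borel_measurable (PiM I (\<lambda>_. borel))"
  shows "(\<integral>\<^sup>+x. f (\<lambda>i\<in>I. x i + a i) \<partial>PiM I (\<lambda>_. lborel)) = (\<integral>\<^sup>+x. f x \<partial>PiM I (\<lambda>_. lborel))"
  using assms
proof (induction I arbitrary: f rule: finite_induct)
  case empty
  show ?case by (simp add: PiM_empty nn_integral_count_space_finite restrict_def)
next
  case (insert i I)
  note m = measurable_fun_upd_arg[OF insert.prems]
  have upd: "(\<lambda>j\<in>insert i I. (x(i := t)) j + a j) = (\<lambda>j\<in>I. x j + a j)(i := t + a i)" for x t
    using insert(2) by auto
  have "(\<integral>\<^sup>+x. f (\<lambda>i\<in>insert i I. x i + a i) \<partial>PiM (insert i I) (\<lambda>_. lborel)) =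
     (\<integral>\<^sup>+t. (\<integral>\<^sup>+x. f ((\<lambda>j\<in>I. x j + a j)(i := t + a i)) \<partial>PiM I (\<lambda>_. lborel)) \<partial>lborel)"
    using nn_integral_PiM_insert_lborel[OF insert(1,2) measurable_compose[OF measurable_translate[where a = a] insert.prems]]
    unfolding upd .
  also have "\<dots> = (\<integral>\<^sup>+t. (\<integral>\<^sup>+x. f (x(i := t + a i)) \<partial>PiM I (\<lambda>_. lborel)) \<partial>lborel)"
    by (simp only: insert.IH[OF m(2)])
  also have "\<dots> = (\<integral>\<^sup>+t. (\<integral>\<^sup>+x. f (x(i := t)) \<partial>PiM I (\<lambda>_. lborel)) \<partial>lborel)"
    using nn_integral_real_affine[OF borel_measurable_nn_integral_PiM_lborel[OF insert(1) m(1)], of 1 "a i"]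
    by (simp add: add.commute del: fun_upd_apply)
  also have "\<dots> = (\<integral>\<^sup>+x. f x \<partial>PiM (insert i I) (\<lambda>_. lborel))"
    by (rule nn_integral_PiM_insert_lborel[OF insert(1,2) insert.prems, symmetric])
  finally show ?case .
qed

text \<open>For a unit vector \<open>w\<close> this is the Householder reflection in the hyperplane
  orthogonal to \<open>w\<close>. Restricting to \<open>I\<close> keeps the values in the
  extensional functions, which form the space of \<open>PiM I\<close>.\<close>

definition reflect :: "'i set \<Rightarrow> ('i \<Rightarrow> real) \<Rightarrow> ('i \<Rightarrow> real) \<Rightarrow> 'i \<Rightarrow> real" where
  "reflect I w x = (\<lambda>i\<in>I. x i - 2 * (\<Sum>j\<in>I. w j * x j) * w i)"

lemma measurable_reflect: "reflect I w \<in> PiM I (\<lambda>_. borel) \<rightarrow>\<^sub>M PiM I (\<lambda>_. borel :: real measure)"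
  unfolding reflect_def[abs_def] by measurable

text \<open>Choose a pivot \<open>p\<close> with \<open>w p \<noteq> 0\<close> and replace that
  coordinate by t, the inner product of x with \<open>w\<close>. In the new coordinates the
  reflection is t to -t followed by a translation of the remaining coordinates depending on t. Both
  preserve Lebesgue measure, and the constant Jacobian is the same before and after.\<close>

lemma nn_integral_PiM_lborel_reflect:
  fixes f :: "('i \<Rightarrow> real) \<Rightarrow> ennreal"
  assumes fin: "finite I" and w: "(\<Sum>i\<in>I. (w i)\<^sup>2) = 1" and f: "f \<in> borel_measurable (PiM I (\<lambda>_. borel))"
  shows "(\<integral>\<^sup>+x. f (reflect I w x) \<partial>PiM I (\<lambda>_. lborel)) = (\<integral>\<^sup>+x. f x \<partial>PiM I (\<lambda>_. lborel))"
proof -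
  have "\<exists>p\<in>I. w p \<noteq> 0"
  proof (rule ccontr)
    assume "\<not> (\<exists>p\<in>I. w p \<noteq> 0)"
    then have "(\<Sum>i\<in>I. (w i)\<^sup>2) = 0" by (intro sum.neutral) simp
    then show False using w by simp
  qed
  then obtain p where p: "p \<in> I" "w p \<noteq> 0" by blast
  define K where "K = I - {p}"
  have K: "finite K" "p \<notin> K" "I = insert p K" using p fin by (auto simp: K_def)
  define c where "c x = (\<Sum>j\<in>K. w j * x j)" for x
  \<comment> \<open>\<open>u t x\<close> is the value of \<open>f\<close> at the point with
    coordinates \<open>x\<close> on \<open>K\<close> and inner product t with \<open>w\<close>;
    solving for the pivot coordinate divides by \<open>w p\<close>.\<close>
  define u where "u t x = f (x(p := (t - c x) / w p))" for t x
  let ?L = "PiM K (\<lambda>_. lborel :: real measure)"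
  have cm[measurable]: "c \<in> borel_measurable (PiM K (\<lambda>_. borel))" unfolding c_def[abs_def] by measurable
  have um: "(\<lambda>(t, x). u t x) \<in> borel_measurable (borel \<Otimes>\<^sub>M PiM K (\<lambda>_. borel))"
  proof -
    have "(\<lambda>(t, x). ((t - c x) / w p, x)) \<in> borel \<Otimes>\<^sub>M PiM K (\<lambda>_. borel) \<rightarrow>\<^sub>M borel \<Otimes>\<^sub>M PiM K (\<lambda>_. borel :: real measure)"
      by measurable
    from measurable_compose[OF this measurable_fun_upd_arg(1)[of f p K]] f K(3)
    show ?thesis by (simp add: u_def case_prod_beta')
  qed
  have um1: "(\<lambda>t. u t x) \<in> borel_measurable borel" if "x \<in> extensional K" for x
    using measurable_compose[OF measurable_Pair2' um, of x] that by (simp add: space_PiM PiE_def)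
  have um2: "u t \<in> borel_measurable (PiM K (\<lambda>_. borel))" for t
    using measurable_compose[OF measurable_Pair1' um, of t] by simp
  have sfK: "sigma_finite_measure ?L"
    using product_sigma_finite.sigma_finite[OF product_sigma_finite_lborel K(1)] .
  have sfP: "pair_sigma_finite ?L (lborel :: real measure)"
    using sfK by (auto simp: pair_sigma_finite_def intro: sigma_finite_lborel)
  have sc: "sets (?L \<Otimes>\<^sub>M (lborel :: real measure)) = sets (PiM K (\<lambda>_. borel :: real measure) \<Otimes>\<^sub>M (borel :: real measure))"
    by (intro sets_pair_measure_cong sets_PiM_lborel sets_lborel)
  have swap: "(\<integral>\<^sup>+t. (\<integral>\<^sup>+x. g t x \<partial>?L) \<partial>lborel) = (\<integral>\<^sup>+x. (\<integral>\<^sup>+t. g t x \<partial>lborel) \<partial>?L)"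
    if "(\<lambda>(t, x). g t x) \<in> borel_measurable (borel \<Otimes>\<^sub>M PiM K (\<lambda>_. borel))"
    for g :: "real \<Rightarrow> ('i \<Rightarrow> real) \<Rightarrow> ennreal"
  proof -
    have "(\<lambda>(x, t). g t x) \<in> borel_measurable (PiM K (\<lambda>_. borel) \<Otimes>\<^sub>M borel)"
      using measurable_compose[OF measurable_pair_swap' that] by (simp add: case_prod_beta')
    then have "(\<lambda>(x, t). g t x) \<in> borel_measurable (?L \<Otimes>\<^sub>M lborel)" by (simp only: measurable_cong_sets[OF sc refl])
    then show ?thesis by (rule pair_sigma_finite.Fubini'[OF sfP])
  qed
  \<comment> \<open>Stated for an arbitrary pair \<open>h\<close>, \<open>g\<close>, since it is
    used twice: to enter the coordinates (t, x) for the reflected function and to leave them for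
    \<open>f\<close>. The substitution is affine in the pivot coordinate.\<close>
  have slice: "(\<integral>\<^sup>+x. h x \<partial>PiM I (\<lambda>_. lborel)) = ennreal (1 / \<bar>w p\<bar>) * (\<integral>\<^sup>+t. (\<integral>\<^sup>+x. g t x \<partial>?L) \<partial>lborel)"
    if hm: "h \<in> borel_measurable (PiM I (\<lambda>_. borel))"
      and gm: "(\<lambda>(t, x). g t x) \<in> borel_measurable (borel \<Otimes>\<^sub>M PiM K (\<lambda>_. borel))"
      and hg: "\<And>x s. x \<in> extensional K \<Longrightarrow> h (x(p := s)) = g (w p * s + c x) x"
    for h and g :: "real \<Rightarrow> ('i \<Rightarrow> real) \<Rightarrow> ennreal"
  proof -
    have hm': "h \<in> borel_measurable (PiM (insert p K) (\<lambda>_. borel))" using hm K(3) by simp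
    have "(\<integral>\<^sup>+x. h x \<partial>PiM I (\<lambda>_. lborel)) = (\<integral>\<^sup>+s. (\<integral>\<^sup>+x. h (x(p := s)) \<partial>?L) \<partial>lborel)"
      using nn_integral_PiM_insert_lborel[OF K(1,2) hm'] K(3) by simp
    also have "\<dots> = (\<integral>\<^sup>+x. (\<integral>\<^sup>+s. h (x(p := s)) \<partial>lborel) \<partial>?L)"
      by (rule swap[OF measurable_fun_upd_arg(1)[OF hm']])
    also have "\<dots> = (\<integral>\<^sup>+x. ennreal (1 / \<bar>w p\<bar>) * (\<integral>\<^sup>+t. g t x \<partial>lborel) \<partial>?L)"
    proof (intro nn_integral_cong)
      fix x assume "x \<in> space ?L"
      then have x: "x \<in> extensional K" by (simp add: space_PiM PiE_def)
      have g1: "(\<lambda>t. g t x) \<in> borel_measurable borel"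
        using measurable_compose[OF measurable_Pair2' gm, of x] x by (simp add: space_PiM PiE_def)
      have "ennreal (1 / \<bar>w p\<bar>) * (\<integral>\<^sup>+t. g t x \<partial>lborel) =
          ennreal (1 / \<bar>w p\<bar>) * (ennreal \<bar>w p\<bar> * (\<integral>\<^sup>+s. g (c x + w p * s) x \<partial>lborel))"
        using nn_integral_real_affine[OF g1 p(2), of "c x"] by simp
      also have "\<dots> = (\<integral>\<^sup>+s. g (c x + w p * s) x \<partial>lborel)"
        using p(2) by (simp add: mult.assoc[symmetric] ennreal_mult[symmetric])
      finally show "(\<integral>\<^sup>+s. h (x(p := s)) \<partial>lborel) = ennreal (1 / \<bar>w p\<bar>) * (\<integral>\<^sup>+t. g t x \<partial>lborel)"
        by (simp add: hg[OF x] add.commute)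
    qed
    also have "\<dots> = ennreal (1 / \<bar>w p\<bar>) * (\<integral>\<^sup>+x. (\<integral>\<^sup>+t. g t x \<partial>lborel) \<partial>?L)"
    proof (rule nn_integral_cmult)
      have "(\<lambda>(x, t). g t x) \<in> borel_measurable (PiM K (\<lambda>_. borel) \<Otimes>\<^sub>M borel)"
        using measurable_compose[OF measurable_pair_swap' gm] by (simp add: case_prod_beta')
      then have "(\<lambda>(x, t). g t x) \<in> borel_measurable (?L \<Otimes>\<^sub>M lborel)" by (simp only: measurable_cong_sets[OF sc refl])
      from lborel.borel_measurable_nn_integral[OF this]
      show "(\<lambda>x. \<integral>\<^sup>+t. g t x \<partial>lborel) \<in> borel_measurable ?L" by simp
    qed
    also have "(\<integral>\<^sup>+x. (\<integral>\<^sup>+t. g t x \<partial>lborel) \<partial>?L) = (\<integral>\<^sup>+t. (\<integral>\<^sup>+x. g t x \<partial>?L) \<partial>lborel)"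
      by (rule swap[OF gm, symmetric])
    finally show ?thesis .
  qed
  let ?s = "\<lambda>t x. \<lambda>j\<in>K. x j + (- 2 * t * w j)"
  have fm: "(\<lambda>x. f (reflect I w x)) \<in> borel_measurable (PiM I (\<lambda>_. borel))"
    by (rule measurable_compose[OF measurable_reflect f])
  have gm: "(\<lambda>(t, x). u (- t) (?s t x)) \<in> borel_measurable (borel \<Otimes>\<^sub>M PiM K (\<lambda>_. borel))"
  proof -
    have "(\<lambda>(t, x). (- t, ?s t x)) \<in> borel \<Otimes>\<^sub>M PiM K (\<lambda>_. borel) \<rightarrow>\<^sub>M borel \<Otimes>\<^sub>M PiM K (\<lambda>_. borel :: real measure)"
      by measurable
    from measurable_compose[OF this um] show ?thesis by (simp add: case_prod_beta')
  qed
  \<comment> \<open>This is where the unit length of \<open>w\<close> is spent: it makes the pivot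
    coordinate move by exactly -2 t \<open>w p\<close> when t changes sign and the other coordinates
    are translated.\<close>
  have cw: "c w = 1 - (w p)\<^sup>2" using w K by (simp add: c_def power2_eq_square)
  have "(\<integral>\<^sup>+x. f (reflect I w x) \<partial>PiM I (\<lambda>_. lborel)) =
      ennreal (1 / \<bar>w p\<bar>) * (\<integral>\<^sup>+t. (\<integral>\<^sup>+x. u (- t) (?s t x) \<partial>?L) \<partial>lborel)"
  proof (rule slice[OF fm gm])
    fix x :: "'i \<Rightarrow> real" and s :: real assume x: "x \<in> extensional K"
    define t where "t = w p * s + c x"
    have cK: "(\<Sum>j\<in>K. w j * (x(p := s)) j) = c x" unfolding c_def using K(2) by (intro sum.cong) auto
    have dot: "(\<Sum>j\<in>I. w j * (x(p := s)) j) = t" using K cK by (simp add: t_def del: fun_upd_apply) simp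
    have cs: "c (?s t x) = c x - 2 * t * c w"
      by (simp add: c_def sum_subtractf[symmetric] sum_distrib_left algebra_simps)
    have "(- t - c (?s t x)) / w p = s - 2 * t * w p"
      unfolding cs cw using p(2) by (simp add: t_def field_simps power2_eq_square)
    then have "reflect I w (x(p := s)) = (?s t x)(p := (- t - c (?s t x)) / w p)"
      using K x unfolding reflect_def dot by (auto simp: extensional_def restrict_def fun_eq_iff)
    then show "f (reflect I w (x(p := s))) = u (- (w p * s + c x)) (?s (w p * s + c x) x)"
      by (simp add: u_def t_def[symmetric])
  qed
  also have "(\<integral>\<^sup>+t. (\<integral>\<^sup>+x. u (- t) (?s t x) \<partial>?L) \<partial>lborel) = (\<integral>\<^sup>+t. (\<integral>\<^sup>+x. u (- t) x \<partial>?L) \<partial>lborel)"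
    by (intro nn_integral_cong nn_integral_PiM_lborel_translate K um2)
  also have "\<dots> = (\<integral>\<^sup>+t. (\<integral>\<^sup>+x. u t x \<partial>?L) \<partial>lborel)"
    using nn_integral_real_affine[OF borel_measurable_nn_integral_PiM_lborel[OF K(1) um], of "-1" 0] by simp
  also have "ennreal (1 / \<bar>w p\<bar>) * (\<integral>\<^sup>+t. (\<integral>\<^sup>+x. u t x \<partial>?L) \<partial>lborel) = (\<integral>\<^sup>+x. f x \<partial>PiM I (\<lambda>_. lborel))"
    using p(2) by (intro slice[symmetric] f um) (simp add: u_def)
  finally show ?thesis .
qed

lemma prod_normal_density:
  "finite I \<Longrightarrow> (\<Prod>i\<in>I. normal_density 0 \<sigma> (x i)) =
    (1 / sqrt (2 * pi * \<sigma>\<^sup>2)) ^ card I * exp (- (\<Sum>i\<in>I. (x i)\<^sup>2) / (2 * \<sigma>\<^sup>2))"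
proof (induction I rule: finite_induct)
  case (insert i I)
  have "exp (- (\<Sum>i\<in>insert i I. (x i)\<^sup>2) / (2 * \<sigma>\<^sup>2)) = exp (- (x i)\<^sup>2 / (2 * \<sigma>\<^sup>2)) * exp (- (\<Sum>i\<in>I. (x i)\<^sup>2) / (2 * \<sigma>\<^sup>2))"
    using insert(1,2) by (simp add: exp_add[symmetric] diff_divide_distrib)
  then show ?case using insert by (simp only: prod.insert card_insert_disjoint power_Suc normal_density_def) (simp add: ac_simps)
qed simp

lemma sum_square_reflect:
  assumes "(\<Sum>i\<in>I. (w i)\<^sup>2) = 1"
  shows "(\<Sum>i\<in>I. (reflect I w x i)\<^sup>2) = (\<Sum>i\<in>I. (x i)\<^sup>2)"
proof -
  define t where "t = (\<Sum>j\<in>I. w j * x j)"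
  have "(\<Sum>i\<in>I. (reflect I w x i)\<^sup>2) = (\<Sum>i\<in>I. (x i)\<^sup>2 - 4 * t * (w i * x i) + 4 * t\<^sup>2 * (w i)\<^sup>2)"
    by (intro sum.cong) (auto simp: reflect_def t_def[symmetric] power2_eq_square algebra_simps)
  also have "\<dots> = (\<Sum>i\<in>I. (x i)\<^sup>2) - 4 * t * t + 4 * t\<^sup>2 * 1"
    unfolding sum.distrib sum_subtractf sum_distrib_left[symmetric] t_def[symmetric] assms ..
  finally show ?thesis by (simp add: power2_eq_square)
qed

lemma nn_integral_PiM_gauss_reflect:
  fixes f :: "('i \<Rightarrow> real) \<Rightarrow> ennreal"
  assumes \<sigma>: "0 < \<sigma>" and fin: "finite I" and w: "(\<Sum>i\<in>I. (w i)\<^sup>2) = 1" and f: "f \<in> borel_measurable (PiM I (\<lambda>_. borel))"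
  shows "(\<integral>\<^sup>+x. f (reflect I w x) \<partial>PiM I (\<lambda>_. gauss \<sigma>)) = (\<integral>\<^sup>+x. f x \<partial>PiM I (\<lambda>_. gauss \<sigma>))"
proof -
  have d: "(\<Prod>i\<in>I. normal_density 0 \<sigma> (reflect I w x i)) = (\<Prod>i\<in>I. normal_density 0 \<sigma> (x i))" for x
    by (simp add: prod_normal_density[OF fin] sum_square_reflect[OF w])
  have "(\<integral>\<^sup>+x. f (reflect I w x) * ennreal (\<Prod>i\<in>I. normal_density 0 \<sigma> (reflect I w x i)) \<partial>PiM I (\<lambda>_. lborel)) =
      (\<integral>\<^sup>+x. f x * ennreal (\<Prod>i\<in>I. normal_density 0 \<sigma> (x i)) \<partial>PiM I (\<lambda>_. lborel))"
    by (rule nn_integral_PiM_lborel_reflect[OF fin w borel_measurable_times_ennreal[OF f borel_measurable_prod_density]])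
  then show ?thesis unfolding d
    by (simp add: nn_integral_PiM_gauss[OF \<sigma> fin] f measurable_compose[OF measurable_reflect f])
qed

text \<open>For an orthonormal family this is the composition of the reflections along its members,
  that is, x minus twice its projection onto their span. The single formula makes the comparison
  with matrix products direct.\<close>

definition reflections :: "'i set \<Rightarrow> 'k set \<Rightarrow> ('k \<Rightarrow> 'i \<Rightarrow> real) \<Rightarrow> ('i \<Rightarrow> real) \<Rightarrow> 'i \<Rightarrow> real" where
  "reflections I K W x = (\<lambda>i\<in>I. x i - 2 * (\<Sum>k\<in>K. (\<Sum>j\<in>I. W k j * x j) * W k i))"

lemma measurable_reflections: "reflections I K W \<in> PiM I (\<lambda>_. borel) \<rightarrow>\<^sub>M PiM I (\<lambda>_. borel :: real measure)"
  unfolding reflections_def[abs_def] by measurable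

text \<open>Reflecting along vectors orthogonal to \<open>W k\<close> does not change the inner
  product with \<open>W k\<close>, so one more reflection just subtracts one more term. This drives
  the inductions over \<open>K\<close>.\<close>

lemma reflections_insert:
  assumes "finite K" "k \<notin> K" and orth: "\<And>l. l \<in> K \<Longrightarrow> (\<Sum>i\<in>I. W k i * W l i) = 0"
  shows "reflections I (insert k K) W x = reflect I (W k) (reflections I K W x)"
proof -
  have "(\<Sum>j\<in>I. W k j * reflections I K W x j) =
      (\<Sum>j\<in>I. W k j * x j - 2 * (\<Sum>l\<in>K. (\<Sum>j\<in>I. W l j * x j) * (W k j * W l j)))"
    by (intro sum.cong) (auto simp: reflections_def algebra_simps sum_distrib_left sum_distrib_right)
  also have "\<dots> = (\<Sum>j\<in>I. W k j * x j) - 2 * (\<Sum>l\<in>K. (\<Sum>j\<in>I. W l j * x j) * (\<Sum>j\<in>I. W k j * W l j))"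
    unfolding sum_subtractf sum_distrib_left[symmetric] by (subst sum.swap) (simp add: sum_distrib_left)
  also have "(\<Sum>l\<in>K. (\<Sum>j\<in>I. W l j * x j) * (\<Sum>j\<in>I. W k j * W l j)) = 0"
    using orth assms(2) by (intro sum.neutral) auto
  finally have d: "(\<Sum>j\<in>I. W k j * reflections I K W x j) = (\<Sum>j\<in>I. W k j * x j)" by simp
  show ?thesis unfolding reflect_def d using assms(1,2)
    by (auto simp: reflections_def restrict_def fun_eq_iff)
qed

lemma sum_square_reflections:
  assumes "finite K" and W: "\<And>k l. k \<in> K \<Longrightarrow> l \<in> K \<Longrightarrow> (\<Sum>i\<in>I. W k i * W l i) = (if k = l then 1 else 0)"
  shows "(\<Sum>i\<in>I. (reflections I K W x i)\<^sup>2) = (\<Sum>i\<in>I. (x i)\<^sup>2)"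
  using assms
proof (induction K rule: finite_induct)
  case empty
  then show ?case by (simp add: reflections_def)
next
  case (insert k K)
  have w1: "(\<Sum>i\<in>I. (W k i)\<^sup>2) = 1" using insert.prems[of k k] by (simp add: power2_eq_square)
  have "reflections I (insert k K) W x = reflect I (W k) (reflections I K W x)"
    by (rule reflections_insert[OF insert(1,2)]) (use insert.prems insert(2) in \<open>auto split: if_splits\<close>)
  moreover have "(\<Sum>i\<in>I. (reflections I K W x i)\<^sup>2) = (\<Sum>i\<in>I. (x i)\<^sup>2)"
    using insert.prems by (intro insert.IH) auto
  ultimately show ?case using sum_square_reflect[OF w1] by simp
qed

lemma L2_set_reflections:
  assumes "finite K" and W: "\<And>k l. k \<in> K \<Longrightarrow> l \<in> K \<Longrightarrow> (\<Sum>i\<in>I. W k i * W l i) = (if k = l then 1 else 0)"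
  shows "L2_set (\<lambda>i. reflections I K W x i - reflections I K W y i) I = L2_set (\<lambda>i. x i - y i) I"
proof -
  have "reflections I K W x i - reflections I K W y i = reflections I K W (\<lambda>i. x i - y i) i" if "i \<in> I" for i
    using that by (simp add: reflections_def right_diff_distrib left_diff_distrib sum_subtractf)
  then have "L2_set (\<lambda>i. reflections I K W x i - reflections I K W y i) I = L2_set (reflections I K W (\<lambda>i. x i - y i)) I"
    by (intro L2_set_cong) auto
  also have "\<dots> = L2_set (\<lambda>i. x i - y i) I"
    unfolding L2_set_def using sum_square_reflections[OF assms] by simp
  finally show ?thesis .
qed

lemma nn_integral_PiM_gauss_reflections:
  fixes f :: "('i \<Rightarrow> real) \<Rightarrow> ennreal"
  assumes \<sigma>: "0 < \<sigma>" and fin: "finite I" and "finite K"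
    and W: "\<And>k l. k \<in> K \<Longrightarrow> l \<in> K \<Longrightarrow> (\<Sum>i\<in>I. W k i * W l i) = (if k = l then 1 else 0)"
    and f: "f \<in> borel_measurable (PiM I (\<lambda>_. borel))"
  shows "(\<integral>\<^sup>+x. f (reflections I K W x) \<partial>PiM I (\<lambda>_. gauss \<sigma>)) = (\<integral>\<^sup>+x. f x \<partial>PiM I (\<lambda>_. gauss \<sigma>))"
  using assms(3,4,5)
proof (induction K arbitrary: f rule: finite_induct)
  case empty
  have "reflections I {} W x = x" if "x \<in> extensional I" for x
    using that by (auto simp: reflections_def extensional_def restrict_def fun_eq_iff)
  then show ?case by (intro nn_integral_cong) (simp add: space_PiM_gauss)
next
  case (insert k K)
  have w1: "(\<Sum>i\<in>I. (W k i)\<^sup>2) = 1" using insert.prems(1)[of k k] by (simp add: power2_eq_square)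
  have eq: "reflections I (insert k K) W x = reflect I (W k) (reflections I K W x)" for x
    by (rule reflections_insert[OF insert(1,2)]) (use insert.prems(1) insert(2) in \<open>auto split: if_splits\<close>)
  have "(\<integral>\<^sup>+x. f (reflections I (insert k K) W x) \<partial>PiM I (\<lambda>_. gauss \<sigma>)) =
     (\<integral>\<^sup>+x. f (reflect I (W k) x) \<partial>PiM I (\<lambda>_. gauss \<sigma>))"
    unfolding eq using insert.prems
    by (intro insert.IH measurable_compose[OF measurable_reflect]) auto
  also have "\<dots> = (\<integral>\<^sup>+x. f x \<partial>PiM I (\<lambda>_. gauss \<sigma>))"
    by (rule nn_integral_PiM_gauss_reflect[OF \<sigma> fin w1 insert.prems(2)])
  finally show ?case .
qed

text \<open>Negation is the composition of the reflections along all coordinate vectors.\<close>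

lemma nn_integral_PiM_gauss_uminus:
  fixes f :: "('i \<Rightarrow> real) \<Rightarrow> ennreal"
  assumes \<sigma>: "0 < \<sigma>" and fin: "finite I" and f: "f \<in> borel_measurable (PiM I (\<lambda>_. borel))"
  shows "(\<integral>\<^sup>+x. f (\<lambda>i\<in>I. - x i) \<partial>PiM I (\<lambda>_. gauss \<sigma>)) = (\<integral>\<^sup>+x. f x \<partial>PiM I (\<lambda>_. gauss \<sigma>))"
proof -
  let ?W = "\<lambda>(k::'i) i. if i = k then 1 else 0 :: real"
  have s: "(\<Sum>j\<in>I. ?W k j * x j) = x k" if "k \<in> I" for k x
    using that fin by (simp add: if_distrib[where f = "\<lambda>u. u * _"] sum.delta cong: if_cong)
  have "reflections I I ?W x = (\<lambda>i\<in>I. - x i)" for x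
  proof -
    have "(\<Sum>k\<in>I. (\<Sum>j\<in>I. ?W k j * x j) * ?W k i) = x i" if "i \<in> I" for i
    proof -
      have "(\<Sum>k\<in>I. (\<Sum>j\<in>I. ?W k j * x j) * ?W k i) = (\<Sum>k\<in>I. if k = i then x k else 0)"
        by (intro sum.cong refl) (simp only: s, simp)
      also have "\<dots> = x i" using that fin by simp
      finally show ?thesis .
    qed
    then show ?thesis by (auto simp: reflections_def restrict_def fun_eq_iff)
  qed
  moreover have "(\<Sum>i\<in>I. ?W k i * ?W l i) = (if k = l then 1 else 0)" if "k \<in> I" "l \<in> I" for k l
    using s[OF that(1), of "?W l"] by simp
  ultimately show ?thesis using nn_integral_PiM_gauss_reflections[OF \<sigma> fin fin, of ?W f] f by simp
qed

text \<open>Cameron-Martin formula: the exponential weight is the ratio of the Gaussian density at x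
  - a to the one at x, so translating Lebesgue measure by a absorbs it.\<close>

lemma nn_integral_PiM_gauss_translate:
  fixes f :: "('i \<Rightarrow> real) \<Rightarrow> ennreal"
  assumes \<sigma>: "0 < \<sigma>" and fin: "finite I" and f: "f \<in> borel_measurable (PiM I (\<lambda>_. borel))"
  shows "(\<integral>\<^sup>+x. f x * exp ((2 * (\<Sum>i\<in>I. a i * x i) - (\<Sum>i\<in>I. (a i)\<^sup>2)) / (2 * \<sigma>\<^sup>2)) \<partial>PiM I (\<lambda>_. gauss \<sigma>)) =
    (\<integral>\<^sup>+x. f (\<lambda>i\<in>I. x i + a i) \<partial>PiM I (\<lambda>_. gauss \<sigma>))"
proof -
  let ?d = "\<lambda>x. ennreal (\<Prod>i\<in>I. normal_density 0 \<sigma> (x i))"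
  let ?e = "\<lambda>x. ennreal (exp ((2 * (\<Sum>i\<in>I. a i * x i) - (\<Sum>i\<in>I. (a i)\<^sup>2)) / (2 * \<sigma>\<^sup>2)))"
  have fe: "(\<lambda>x. f x * ?e x) \<in> borel_measurable (PiM I (\<lambda>_. borel))"
    by (intro borel_measurable_times_ennreal f) measurable
  have fed: "(\<lambda>x. f x * ?e x * ?d x) \<in> borel_measurable (PiM I (\<lambda>_. borel))"
    by (intro borel_measurable_times_ennreal fe borel_measurable_prod_density)
  have tr: "?e (\<lambda>i\<in>I. x i + a i) * ?d (\<lambda>i\<in>I. x i + a i) = ?d x" for x
  proof -
    have 1: "(\<Sum>i\<in>I. a i * (\<lambda>i\<in>I. x i + a i) i) = (\<Sum>i\<in>I. a i * x i) + (\<Sum>i\<in>I. (a i)\<^sup>2)"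
      unfolding sum.distrib[symmetric] by (intro sum.cong) (auto simp: power2_eq_square algebra_simps)
    have 2: "(\<Sum>i\<in>I. ((\<lambda>i\<in>I. x i + a i) i)\<^sup>2) = (\<Sum>i\<in>I. (x i)\<^sup>2) + 2 * (\<Sum>i\<in>I. a i * x i) + (\<Sum>i\<in>I. (a i)\<^sup>2)"
      unfolding sum_distrib_left sum.distrib[symmetric] by (intro sum.cong) (auto simp: power2_eq_square algebra_simps)
    let ?s = "(\<Sum>i\<in>I. a i * x i)" and ?q = "(\<Sum>i\<in>I. (a i)\<^sup>2)" and ?p = "(\<Sum>i\<in>I. (x i)\<^sup>2)"
    have 3: "(2 * (?s + ?q) - ?q) / (2 * \<sigma>\<^sup>2) + (- (?p + 2 * ?s + ?q) / (2 * \<sigma>\<^sup>2)) = - ?p / (2 * \<sigma>\<^sup>2)"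
      using \<sigma> by (simp add: field_simps)
    have "exp ((2 * (?s + ?q) - ?q) / (2 * \<sigma>\<^sup>2)) * ((1 / sqrt (2 * pi * \<sigma>\<^sup>2)) ^ card I * exp (- (?p + 2 * ?s + ?q) / (2 * \<sigma>\<^sup>2)))
        = (1 / sqrt (2 * pi * \<sigma>\<^sup>2)) ^ card I * exp (- ?p / (2 * \<sigma>\<^sup>2))"
      unfolding 3[symmetric] exp_add by (simp only: mult.left_commute)
    then show ?thesis unfolding prod_normal_density[OF fin] 1 2
      by (subst ennreal_mult[symmetric]) simp_all
  qed
  have "(\<integral>\<^sup>+x. f x * ?e x \<partial>PiM I (\<lambda>_. gauss \<sigma>)) = (\<integral>\<^sup>+x. f x * ?e x * ?d x \<partial>PiM I (\<lambda>_. lborel))"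
    by (rule nn_integral_PiM_gauss[OF \<sigma> fin fe])
  also have "\<dots> = (\<integral>\<^sup>+x. f (\<lambda>i\<in>I. x i + a i) * ?e (\<lambda>i\<in>I. x i + a i) * ?d (\<lambda>i\<in>I. x i + a i) \<partial>PiM I (\<lambda>_. lborel))"
    by (rule nn_integral_PiM_lborel_translate[OF fin fed, symmetric])
  also have "\<dots> = (\<integral>\<^sup>+x. f (\<lambda>i\<in>I. x i + a i) * ?d x \<partial>PiM I (\<lambda>_. lborel))"
    unfolding mult.assoc tr ..
  also have "\<dots> = (\<integral>\<^sup>+x. f (\<lambda>i\<in>I. x i + a i) \<partial>PiM I (\<lambda>_. gauss \<sigma>))"
    by (rule nn_integral_PiM_gauss[OF \<sigma> fin measurable_compose[OF measurable_translate f], symmetric])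
  finally show ?thesis .
qed

section \<open>Gaussian exponential moments and decoupling by an independent Gaussian vector\<close>

lemma nn_integral_PiM_gauss_exp_linear:
  assumes "finite I"
  shows "(\<integral>\<^sup>+y. exp (\<Sum>i\<in>I. a i * y i) \<partial>PiM I (\<lambda>_. gauss 1)) = exp ((\<Sum>i\<in>I. (a i)\<^sup>2) / 2)"
proof -
  interpret prob_space "PiM I (\<lambda>_. gauss 1)" by (rule prob_space_PiM_gauss) simp
  let ?q = "\<Sum>i\<in>I. (a i)\<^sup>2"
  have eq: "ennreal (exp (\<Sum>i\<in>I. a i * y i)) = exp (?q / 2) * ennreal (exp ((2 * (\<Sum>i\<in>I. a i * y i) - ?q) / (2 * 1\<^sup>2)))" for y
  proof -
    have "(\<Sum>i\<in>I. a i * y i) = ?q / 2 + (2 * (\<Sum>i\<in>I. a i * y i) - ?q) / (2 * 1\<^sup>2)" by (simp add: field_simps)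
    then have "exp (\<Sum>i\<in>I. a i * y i) = exp (?q / 2) * exp ((2 * (\<Sum>i\<in>I. a i * y i) - ?q) / (2 * 1\<^sup>2))"
      unfolding exp_add[symmetric] by (rule arg_cong)
    then show ?thesis by (simp only: ennreal_mult exp_ge_zero)
  qed
  have "(\<integral>\<^sup>+y. exp (\<Sum>i\<in>I. a i * y i) \<partial>PiM I (\<lambda>_. gauss 1)) =
      exp (?q / 2) * (\<integral>\<^sup>+y. 1 * ennreal (exp ((2 * (\<Sum>i\<in>I. a i * y i) - ?q) / (2 * 1\<^sup>2))) \<partial>PiM I (\<lambda>_. gauss 1))"
    unfolding eq mult_1 by (rule nn_integral_cmult) simp
  also have "(\<integral>\<^sup>+y. 1 * ennreal (exp ((2 * (\<Sum>i\<in>I. a i * y i) - ?q) / (2 * 1\<^sup>2))) \<partial>PiM I (\<lambda>_. gauss 1)) =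
     (\<integral>\<^sup>+y. 1 \<partial>PiM I (\<lambda>_. gauss 1))"
    by (rule nn_integral_PiM_gauss_translate[OF _ assms]) simp_all
  also have "\<dots> = 1" by (simp add: emeasure_space_1)
  finally show ?thesis by simp
qed

text \<open>The tilt exp (y^2 / 4) turns the standard normal density into \<open>sqrt 2\<close>
  times the normal density of variance 2. In dimension k it contributes the price
  \<open>sqrt 2 ^ k\<close> of passing from directions to the norm.\<close>

lemma nn_integral_gauss_exp_square: "(\<integral>\<^sup>+y. exp (y\<^sup>2 / 4) \<partial>gauss 1) = sqrt 2"
proof -
  have "(\<integral>\<^sup>+y. exp (y\<^sup>2 / 4) \<partial>gauss 1) = (\<integral>\<^sup>+y. ennreal (normal_density 0 1 y) * exp (y\<^sup>2 / 4) \<partial>lborel)"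
    by (rule nn_integral_density) auto
  also have "\<dots> = (\<integral>\<^sup>+y. ennreal (sqrt 2) * ennreal (normal_density 0 (sqrt 2) y) \<partial>lborel)"
  proof (intro nn_integral_cong)
    fix y :: real
    have "normal_density 0 1 y * exp (y\<^sup>2 / 4) = sqrt 2 * normal_density 0 (sqrt 2) y"
      by (simp add: normal_density_def exp_add[symmetric] real_sqrt_mult field_simps)
    then show "ennreal (normal_density 0 1 y) * exp (y\<^sup>2 / 4) = ennreal (sqrt 2) * ennreal (normal_density 0 (sqrt 2) y)"
      by (simp add: ennreal_mult[symmetric])
  qed
  also have "\<dots> = sqrt 2" by (simp add: nn_integral_cmult nn_integral_eq_integral)
  finally show ?thesis .
qed

lemma nn_integral_PiM_gauss_exp_square:
  assumes "finite I"
  shows "(\<integral>\<^sup>+y. exp ((\<Sum>i\<in>I. (y i)\<^sup>2) / 4) \<partial>PiM I (\<lambda>_. gauss 1)) = ennreal (sqrt 2 ^ card I)"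
proof -
  interpret product_sigma_finite "\<lambda>_. gauss 1" by (rule product_sigma_finite_gauss) simp
  have "(\<integral>\<^sup>+y. exp ((\<Sum>i\<in>I. (y i)\<^sup>2) / 4) \<partial>PiM I (\<lambda>_. gauss 1)) = (\<integral>\<^sup>+y. (\<Prod>i\<in>I. ennreal (exp ((y i)\<^sup>2 / 4))) \<partial>PiM I (\<lambda>_. gauss 1))"
    by (intro nn_integral_cong) (simp add: prod_ennreal exp_sum[OF assms, symmetric] sum_divide_distrib)
  also have "\<dots> = (\<Prod>i\<in>I. (\<integral>\<^sup>+y. exp (y\<^sup>2 / 4) \<partial>gauss 1))"
    by (rule product_nn_integral_prod[OF assms]) simp
  also have "\<dots> = ennreal (sqrt 2 ^ card I)" by (simp only: nn_integral_gauss_exp_square prod_constant) (simp add: ennreal_power)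
  finally show ?thesis .
qed

text \<open>Decoupling: \<open>\<Phi> x\<close> averages exp (H x y) over an independent standard
  Gaussian y. Where \<open>H x\<close> is linear with coefficients c, this average is exp (|c|^2 /
  2); in total mass, Fubini brings in the bound for each fixed y, whose exponent |y|^2 / 4 is small
  enough to be integrable. Linearity is asked only at the points x of interest, since the extended
  functions used for \<open>H\<close> are linear in y only there.\<close>

lemma subgaussian_vector:
  fixes H :: "'a \<Rightarrow> ('j \<Rightarrow> real) \<Rightarrow> real"
  assumes "sigma_finite_measure M" and J: "finite J"
    and H: "(\<lambda>(x, y). H x y) \<in> borel_measurable (M \<Otimes>\<^sub>M PiM J (\<lambda>_. borel))"
    and sub: "\<And>y. y \<in> extensional J \<Longrightarrow> (\<integral>\<^sup>+x. exp (H x y) \<partial>M) \<le> exp ((\<Sum>j\<in>J. (y j)\<^sup>2) / 4)"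
  obtains \<Phi> :: "'a \<Rightarrow> ennreal" where "\<Phi> \<in> borel_measurable M" "(\<integral>\<^sup>+x. \<Phi> x \<partial>M) \<le> ennreal (sqrt 2 ^ card J)"
    "\<And>x c. (\<And>y. y \<in> extensional J \<Longrightarrow> H x y = (\<Sum>j\<in>J. c j * y j)) \<Longrightarrow> \<Phi> x = exp ((\<Sum>j\<in>J. (c j)\<^sup>2) / 2)"
proof -
  let ?G = "PiM J (\<lambda>_. gauss 1)"
  interpret G: prob_space ?G by (rule prob_space_PiM_gauss) simp
  interpret sigma_finite_measure M by fact
  interpret pair_sigma_finite M ?G by standard
  have sets: "sets (M \<Otimes>\<^sub>M ?G) = sets (M \<Otimes>\<^sub>M PiM J (\<lambda>_. borel :: real measure))"
    by (intro sets_pair_measure_cong sets_PiM_gauss refl)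
  have "(\<lambda>p. ennreal (exp (case p of (x, y) \<Rightarrow> H x y))) \<in> borel_measurable (M \<Otimes>\<^sub>M PiM J (\<lambda>_. borel))"
    using H by measurable
  then have eH: "(\<lambda>(x, y). ennreal (exp (H x y))) \<in> borel_measurable (M \<Otimes>\<^sub>M ?G)"
    by (simp add: measurable_cong_sets[OF sets refl] case_prod_beta')
  define \<Phi> where "\<Phi> x = (\<integral>\<^sup>+y. exp (H x y) \<partial>?G)" for x
  show thesis
  proof (rule that[of \<Phi>])
    show "\<Phi> \<in> borel_measurable M" unfolding \<Phi>_def[abs_def] by (rule G.borel_measurable_nn_integral[OF eH])
    have "(\<integral>\<^sup>+x. \<Phi> x \<partial>M) = (\<integral>\<^sup>+y. (\<integral>\<^sup>+x. exp (H x y) \<partial>M) \<partial>?G)"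
      unfolding \<Phi>_def by (rule Fubini'[OF eH, symmetric])
    also have "\<dots> \<le> (\<integral>\<^sup>+y. exp ((\<Sum>j\<in>J. (y j)\<^sup>2) / 4) \<partial>?G)"
      by (intro nn_integral_mono sub) (simp add: space_PiM_gauss)
    also have "\<dots> = ennreal (sqrt 2 ^ card J)" by (rule nn_integral_PiM_gauss_exp_square[OF J])
    finally show "(\<integral>\<^sup>+x. \<Phi> x \<partial>M) \<le> ennreal (sqrt 2 ^ card J)" .
  next
    fix x c assume "\<And>y. y \<in> extensional J \<Longrightarrow> H x y = (\<Sum>j\<in>J. c j * y j)"
    then have "\<Phi> x = (\<integral>\<^sup>+y. exp (\<Sum>j\<in>J. c j * y j) \<partial>?G)"
      unfolding \<Phi>_def by (intro nn_integral_cong) (simp add: space_PiM_gauss)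
    also have "\<dots> = exp ((\<Sum>j\<in>J. (c j)\<^sup>2) / 2)" by (rule nn_integral_PiM_gauss_exp_linear[OF J])
    finally show "\<Phi> x = exp ((\<Sum>j\<in>J. (c j)\<^sup>2) / 2)" .
  qed
qed

subsection \<open>Concentration of odd Lipschitz maps\<close>

text \<open>McShane extension from \<open>S\<close> of the scalar function sending x to the inner
  product of y with g x, whose Lipschitz constant is at most L |y|. Keeping y as an argument makes
  the extension jointly measurable, as the Fubini argument over y requires; off \<open>S\<close> it
  need not be linear in y.\<close>

definition mcshane :: "'i set \<Rightarrow> 'j set \<Rightarrow> ('i \<Rightarrow> real) set \<Rightarrow> (('i \<Rightarrow> real) \<Rightarrow> 'j \<Rightarrow> real) \<Rightarrow> real \<Rightarrow>
    ('i \<Rightarrow> real) \<Rightarrow> ('j \<Rightarrow> real) \<Rightarrow> real" where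
  "mcshane I J S g L x y =
     (INF z\<in>S. (\<Sum>k\<in>J. y k * g z k) + L * L2_set y J * L2_set (\<lambda>i. x i - z i) I)"

lemma sum_mult_le_L2_set: "(\<Sum>k\<in>J. y k * c k) \<le> L2_set y J * L2_set c J" for y c :: "'j \<Rightarrow> real"
proof -
  have "(\<Sum>k\<in>J. y k * c k) \<le> (\<Sum>k\<in>J. \<bar>y k\<bar> * \<bar>c k\<bar>)"
    by (intro sum_mono) (simp add: abs_mult[symmetric])
  also have "\<dots> \<le> L2_set y J * L2_set c J" by (rule L2_set_mult_ineq)
  finally show ?thesis .
qed

lemma L2_set_diff_triangle: "L2_set (\<lambda>i. x i - z i) I \<le> L2_set (\<lambda>i. x i - y i) I + L2_set (\<lambda>i. y i - z i) I"
  for x y z :: "'i \<Rightarrow> real"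
  using L2_set_triangle_ineq[of "\<lambda>i. x i - y i" "\<lambda>i. y i - z i" I] by simp

lemma L2_set_diff_commute: "L2_set (\<lambda>i. x i - y i) I = L2_set (\<lambda>i. y i - x i) I" for x y :: "'i \<Rightarrow> real"
  by (simp add: L2_set_def power2_commute)

context
  fixes I :: "'i::countable set" and J :: "'j::countable set" and S g L
  assumes L: "0 \<le> L" and S: "S \<noteq> {}"
    and lip: "\<And>x y. x \<in> S \<Longrightarrow> y \<in> S \<Longrightarrow> L2_set (\<lambda>k. g x k - g y k) J \<le> L * L2_set (\<lambda>i. x i - y i) I"
begin

private definition pen :: "('i \<Rightarrow> real) \<Rightarrow> ('j \<Rightarrow> real) \<Rightarrow> ('i \<Rightarrow> real) \<Rightarrow> real" where
  "pen x y z = (\<Sum>k\<in>J. y k * g z k) + L * L2_set y J * L2_set (\<lambda>i. x i - z i) I"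

private lemma mcshane_pen: "mcshane I J S g L x y = (INF z\<in>S. pen x y z)"
  by (simp add: mcshane_def pen_def)

private lemma lip_linear:
  assumes "z \<in> S" "w \<in> S"
  shows "(\<Sum>k\<in>J. y k * g w k) \<le> (\<Sum>k\<in>J. y k * g z k) + L * L2_set y J * L2_set (\<lambda>i. w i - z i) I"
proof -
  have "(\<Sum>k\<in>J. y k * g w k) - (\<Sum>k\<in>J. y k * g z k) = (\<Sum>k\<in>J. y k * (g w k - g z k))"
    by (simp add: sum_subtractf right_diff_distrib)
  also have "\<dots> \<le> L2_set y J * L2_set (\<lambda>k. g w k - g z k) J" by (rule sum_mult_le_L2_set)
  also have "\<dots> \<le> L2_set y J * (L * L2_set (\<lambda>i. w i - z i) I)"
    by (intro mult_left_mono lip assms L2_set_nonneg)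
  finally show ?thesis by (simp add: ac_simps)
qed

private lemma bdd: "bdd_below (pen x y ` S)"
proof -
  obtain w where w: "w \<in> S" using S by auto
  have "(\<Sum>k\<in>J. y k * g w k) - L * L2_set y J * L2_set (\<lambda>i. w i - x i) I \<le> pen x y z" if z: "z \<in> S" for z
  proof -
    have "L * L2_set y J * L2_set (\<lambda>i. w i - z i) I \<le> L * L2_set y J * (L2_set (\<lambda>i. w i - x i) I + L2_set (\<lambda>i. x i - z i) I)"
      using L by (intro mult_left_mono L2_set_diff_triangle) (simp add: L2_set_nonneg)
    then show ?thesis using lip_linear[OF z w, of y] by (simp add: pen_def distrib_left)
  qed
  then show ?thesis by (rule bdd_belowI2)
qed

lemma mcshane_eq:
  assumes "x \<in> S" shows "mcshane I J S g L x y = (\<Sum>k\<in>J. y k * g x k)"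
proof (rule antisym)
  show "mcshane I J S g L x y \<le> (\<Sum>k\<in>J. y k * g x k)"
    using cINF_lower[OF bdd assms, of x y] by (simp add: mcshane_pen) (simp add: pen_def L2_set_def)
  show "(\<Sum>k\<in>J. y k * g x k) \<le> mcshane I J S g L x y"
    unfolding mcshane_pen by (intro cINF_greatest[OF S]) (use lip_linear[OF _ assms] in \<open>simp add: pen_def\<close>)
qed

lemma mcshane_lipschitz:
  "mcshane I J S g L x y - mcshane I J S g L x' y \<le> L * L2_set y J * L2_set (\<lambda>i. x i - x' i) I"
proof -
  have "mcshane I J S g L x y - L * L2_set y J * L2_set (\<lambda>i. x i - x' i) I \<le> mcshane I J S g L x' y"
    unfolding mcshane_pen[of x']
  proof (intro cINF_greatest[OF S])
    fix z assume z: "z \<in> S"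
    have "mcshane I J S g L x y \<le> pen x y z" unfolding mcshane_pen by (rule cINF_lower[OF bdd z])
    moreover have "L * L2_set y J * L2_set (\<lambda>i. x i - z i) I \<le> L * L2_set y J * (L2_set (\<lambda>i. x i - x' i) I + L2_set (\<lambda>i. x' i - z i) I)"
      using L by (intro mult_left_mono L2_set_diff_triangle) (simp add: L2_set_nonneg)
    ultimately show "mcshane I J S g L x y - L * L2_set y J * L2_set (\<lambda>i. x i - x' i) I \<le> pen x' y z"
      by (simp add: pen_def distrib_left)
  qed
  then show ?thesis by simp
qed

text \<open>An infimum of continuous functions is upper semicontinuous: its strict sublevel sets are
  unions of open sets, however large \<open>S\<close> is and whatever \<open>g\<close> is on it. The
  Borel structure is that of the product topology.\<close>

private lemma mcshane_borel: "(\<lambda>p. mcshane I J S g L (fst p) (snd p)) \<in> borel_measurable borel"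
proof (rule borel_measurableI_less)
  fix c
  have cont1: "continuous_on UNIV (\<lambda>p :: ('i \<Rightarrow> real) \<times> ('j \<Rightarrow> real). fst p i)" for i
    by (rule continuous_on_product_then_coordinatewise) (intro continuous_intros)
  have cont2: "continuous_on UNIV (\<lambda>p :: ('i \<Rightarrow> real) \<times> ('j \<Rightarrow> real). snd p j)" for j
    by (rule continuous_on_product_then_coordinatewise) (intro continuous_intros)
  have "open {p. pen (fst p) (snd p) z < c}" for z
    unfolding pen_def L2_set_def
    by (intro open_Collect_less continuous_intros cont1 cont2)
  then have "open (\<Union>z\<in>S. {p. pen (fst p) (snd p) z < c})" by blast
  moreover have "{p. mcshane I J S g L (fst p) (snd p) < c} = (\<Union>z\<in>S. {p. pen (fst p) (snd p) z < c})"
    unfolding mcshane_pen cINF_less_iff[OF S bdd] by blast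
  ultimately show "{p \<in> space borel. mcshane I J S g L (fst p) (snd p) < c} \<in> sets borel" by simp
qed

text \<open>The extension sees only the coordinates in \<open>I\<close> and \<open>J\<close>.
  Padding with zeros therefore carries Borel measurability on the full function spaces over to the
  product \<sigma>-algebras over \<open>I\<close> and \<open>J\<close>.\<close>

lemma measurable_mcshane:
  "(\<lambda>(x, y). mcshane I J S g L x y) \<in> borel_measurable (PiM I (\<lambda>_. borel) \<Otimes>\<^sub>M PiM J (\<lambda>_. borel))"
proof -
  define zx where "zx x = (\<lambda>i. if i \<in> I then x i else 0)" for x :: "'i \<Rightarrow> real"
  define zy where "zy y = (\<lambda>i. if i \<in> J then y i else 0)" for y :: "'j \<Rightarrow> real"
  have [measurable]: "zx \<in> PiM I (\<lambda>_. borel) \<rightarrow>\<^sub>M borel"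
  proof (rule measurable_coordinatewise_then_product)
    show "(\<lambda>x. zx x i) \<in> borel_measurable (PiM I (\<lambda>_. borel))" for i
      unfolding zx_def by (cases "i \<in> I") simp_all
  qed
  have [measurable]: "zy \<in> PiM J (\<lambda>_. borel) \<rightarrow>\<^sub>M borel"
  proof (rule measurable_coordinatewise_then_product)
    show "(\<lambda>x. zy x i) \<in> borel_measurable (PiM J (\<lambda>_. borel))" for i
      unfolding zy_def by (cases "i \<in> J") simp_all
  qed
  have "(\<lambda>(x, y). (zx x, zy y)) \<in> PiM I (\<lambda>_. borel) \<Otimes>\<^sub>M PiM J (\<lambda>_. borel) \<rightarrow>\<^sub>M (borel :: ('i \<Rightarrow> real) measure) \<Otimes>\<^sub>M (borel :: ('j \<Rightarrow> real) measure)"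
    by measurable
  from measurable_compose[OF this[unfolded borel_prod] mcshane_borel]
  have "(\<lambda>(x, y). mcshane I J S g L (zx x) (zy y)) \<in> borel_measurable (PiM I (\<lambda>_. borel) \<Otimes>\<^sub>M PiM J (\<lambda>_. borel))"
    by (simp add: case_prod_beta')
  moreover have "mcshane I J S g L (zx x) (zy y) = mcshane I J S g L x y" for x y
  proof -
    have "pen (zx x) (zy y) z = pen x y z" for z
      unfolding pen_def zx_def zy_def by (simp cong: L2_set_cong sum.cong)
    then show ?thesis by (simp add: mcshane_pen)
  qed
  ultimately show ?thesis by simp
qed

end

text \<open>Each scalar function is extended from \<open>S\<close> to the whole space, made odd
  under \<open>T\<close>, bounded by the scalar result and then decoupled. The conclusion is a
  measurable majorant \<open>\<Phi>\<close>, to which Markov's inequality can be applied although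
  \<open>S\<close> and \<open>g\<close> carry no measurability.\<close>

lemma odd_lipschitz_vector_concentration:
  fixes g :: "('i::countable \<Rightarrow> real) \<Rightarrow> ('j::countable) \<Rightarrow> real"
  assumes \<sigma>: "0 < \<sigma>" and I: "finite I" and J: "finite J" and L: "0 < L"
    and T: "T \<in> PiM I (\<lambda>_. borel) \<rightarrow>\<^sub>M PiM I (\<lambda>_. borel)"
    and T_gauss: "\<And>f. f \<in> borel_measurable (PiM I (\<lambda>_. borel)) \<Longrightarrow>
      (\<integral>\<^sup>+x. f (T x) \<partial>PiM I (\<lambda>_. gauss \<sigma>)) = (\<integral>\<^sup>+x. f x \<partial>PiM I (\<lambda>_. gauss \<sigma>))"
    and TT: "\<And>x. x \<in> extensional I \<Longrightarrow> T (T x) = x"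
    and T_iso: "\<And>x y. x \<in> extensional I \<Longrightarrow> y \<in> extensional I \<Longrightarrow>
      L2_set (\<lambda>i. T x i - T y i) I = L2_set (\<lambda>i. x i - y i) I"
    and S: "S \<subseteq> extensional I" and TS: "\<And>x. x \<in> S \<Longrightarrow> T x \<in> S"
    and odd: "\<And>x k. x \<in> S \<Longrightarrow> k \<in> J \<Longrightarrow> g (T x) k = - g x k"
    and lip: "\<And>x y. x \<in> S \<Longrightarrow> y \<in> S \<Longrightarrow> L2_set (\<lambda>k. g x k - g y k) J \<le> L * L2_set (\<lambda>i. x i - y i) I"
  obtains \<Phi> :: "('i \<Rightarrow> real) \<Rightarrow> ennreal" where "\<Phi> \<in> borel_measurable (PiM I (\<lambda>_. borel))"
    "(\<integral>\<^sup>+x. \<Phi> x \<partial>PiM I (\<lambda>_. gauss \<sigma>)) \<le> ennreal (sqrt 2 ^ card J)"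
    "\<And>x. x \<in> S \<Longrightarrow> exp ((\<Sum>k\<in>J. (g x k)\<^sup>2) / (4 * \<sigma>\<^sup>2 * L\<^sup>2)) \<le> \<Phi> x"
proof (cases "S = {}")
  case True
  then show ?thesis using that[of "\<lambda>_. 0"] by simp
next
  case False
  let ?G = "PiM I (\<lambda>_. gauss \<sigma>)"
  define e where "e x y = mcshane I J S g L x y" for x y
  \<comment> \<open>This scale makes the subgaussian exponent \<sigma>^2 (s L |y|)^2 / 2 equal to
    |y|^2 / 4, as the decoupling demands; in return s^2 |g x|^2 / 2 is the exponent in the
    conclusion.\<close>
  define s where "s = 1 / (sqrt 2 * \<sigma> * L)"
  have s: "0 < s" "s\<^sup>2 = 1 / (2 * \<sigma>\<^sup>2 * L\<^sup>2)" using \<sigma> L by (auto simp: s_def power_divide power_mult_distrib)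
  \<comment> \<open>Antisymmetrisation makes the extension odd everywhere, since \<open>T\<close> is
    an involution. On \<open>S\<close> nothing changes, because \<open>S\<close> is
    \<open>T\<close>-invariant and \<open>g\<close> is already odd there.\<close>
  define H where "H x y = s * ((e x y - e (T x) y) / 2)" for x y
  have mc: "x \<in> S \<Longrightarrow> e x y = (\<Sum>k\<in>J. y k * g x k)"
    "e x y - e x' y \<le> L * L2_set y J * L2_set (\<lambda>i. x i - x' i) I" for x x' y
  proof -
    show "x \<in> S \<Longrightarrow> e x y = (\<Sum>k\<in>J. y k * g x k)"
      unfolding e_def by (rule mcshane_eq[where I = I and J = J and S = S and g = g and L = L, OF less_imp_le[OF L] False]) (rule lip)
    show "e x y - e x' y \<le> L * L2_set y J * L2_set (\<lambda>i. x i - x' i) I"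
      unfolding e_def by (rule mcshane_lipschitz[where I = I and J = J and S = S and g = g and L = L, OF less_imp_le[OF L] False]) (rule lip)
  qed
  have em[measurable]: "(\<lambda>(x, y). e x y) \<in> borel_measurable (PiM I (\<lambda>_. borel) \<Otimes>\<^sub>M PiM J (\<lambda>_. borel))"
    unfolding e_def
    by (rule measurable_mcshane[OF less_imp_le[OF L] False]) (rule lip)
  have [measurable]: "(\<lambda>(x, y). (T x, y)) \<in> PiM I (\<lambda>_. borel) \<Otimes>\<^sub>M PiM J (\<lambda>_. borel) \<rightarrow>\<^sub>M PiM I (\<lambda>_. borel) \<Otimes>\<^sub>M PiM J (\<lambda>_. borel :: real measure)"
    using T by measurable
  have eTm: "(\<lambda>(x, y). e (T x) y) \<in> borel_measurable (PiM I (\<lambda>_. borel) \<Otimes>\<^sub>M PiM J (\<lambda>_. borel))"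
    using measurable_compose[OF \<open>(\<lambda>(x, y). (T x, y)) \<in> _\<close> em] by (simp only: case_prod_beta' fst_conv snd_conv)
  have Hm: "(\<lambda>(x, y). H x y) \<in> borel_measurable (PiM I (\<lambda>_. borel) \<Otimes>\<^sub>M PiM J (\<lambda>_. borel))"
    using em eTm unfolding H_def case_prod_beta'
    by (intro borel_measurable_times borel_measurable_divide borel_measurable_diff borel_measurable_const)
  have sets: "sets (?G \<Otimes>\<^sub>M PiM J (\<lambda>_. borel :: real measure)) = sets (PiM I (\<lambda>_. borel :: real measure) \<Otimes>\<^sub>M PiM J (\<lambda>_. borel :: real measure))"
    by (intro sets_pair_measure_cong sets_PiM_gauss refl)
  have Hm': "(\<lambda>(x, y). H x y) \<in> borel_measurable (?G \<Otimes>\<^sub>M PiM J (\<lambda>_. borel))"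
    using Hm by (simp only: measurable_cong_sets[OF sets refl])
  have Text: "T x \<in> extensional I" if "x \<in> extensional I" for x
    using measurable_space[OF T, of x] that by (simp add: space_PiM PiE_def)
  have sub: "(\<integral>\<^sup>+x. exp (H x y) \<partial>?G) \<le> exp ((\<Sum>j\<in>J. (y j)\<^sup>2) / 4)" if y: "y \<in> extensional J" for y
  proof -
    have Hy: "(\<lambda>x. H x y) \<in> borel_measurable (PiM I (\<lambda>_. borel))"
    proof -
      have "y \<in> space (PiM J (\<lambda>_. borel))" using y by (simp add: space_PiM PiE_def)
      from measurable_compose[OF measurable_Pair2'[OF this] Hm] show ?thesis by (simp only: prod.case)
    qed
    have "(\<integral>\<^sup>+x. exp (H x y) \<partial>?G) \<le> exp (\<sigma>\<^sup>2 * (s * L * L2_set y J)\<^sup>2 / 2)"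
    proof (rule odd_lipschitz_gauss_exp[OF \<sigma> I Hy])
      fix x x' :: "'i \<Rightarrow> real" assume x: "x \<in> extensional I" "x' \<in> extensional I"
      have "e x y - e x' y \<le> L * L2_set y J * L2_set (\<lambda>i. x i - x' i) I" by (rule mc(2))
      moreover have "e (T x') y - e (T x) y \<le> L * L2_set y J * L2_set (\<lambda>i. T x' i - T x i) I" by (rule mc(2))
      \<comment> \<open>As \<open>T\<close> is an isometry, both halves have the same Lipschitz
        constant, and averaging does not increase it.\<close>
      ultimately have "(e x y - e (T x) y) / 2 - (e x' y - e (T x') y) / 2 \<le> L * L2_set y J * L2_set (\<lambda>i. x i - x' i) I"
        using T_iso[OF x(2,1)] L2_set_diff_commute[of x x' I] by (simp add: field_simps)
      then have "s * ((e x y - e (T x) y) / 2 - (e x' y - e (T x') y) / 2) \<le> s * (L * L2_set y J * L2_set (\<lambda>i. x i - x' i) I)"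
        using s by (intro mult_left_mono) auto
      then show "H x y - H x' y \<le> s * L * L2_set y J * L2_set (\<lambda>i. x i - x' i) I"
        by (simp add: H_def right_diff_distrib mult.assoc)
    next
      have "H (T x) y = - H x y" if "x \<in> extensional I" for x
        by (simp add: H_def TT[OF that] field_simps)
      then have "(\<integral>\<^sup>+x. exp (- H x y) \<partial>?G) = (\<integral>\<^sup>+x. exp (H (T x) y) \<partial>?G)"
        by (intro nn_integral_cong) (simp add: space_PiM_gauss)
      also have "\<dots> = (\<integral>\<^sup>+x. exp (H x y) \<partial>?G)"
      proof (rule T_gauss[of "\<lambda>x. ennreal (exp (H x y))"])
        show "(\<lambda>x. ennreal (exp (H x y))) \<in> borel_measurable (PiM I (\<lambda>_. borel))" using Hy by measurable
      qed
      finally show "(\<integral>\<^sup>+x. exp (- H x y) \<partial>?G) = (\<integral>\<^sup>+x. exp (H x y) \<partial>?G)" .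
    qed
    also have "\<sigma>\<^sup>2 * (s * L * L2_set y J)\<^sup>2 / 2 = (\<Sum>j\<in>J. (y j)\<^sup>2) / 4"
      using \<sigma> L by (simp add: power_mult_distrib s(2) L2_set_square_sum)
    finally show ?thesis .
  qed
  show ?thesis
  proof (rule subgaussian_vector[where M = ?G and H = H and J = J, OF prob_space_imp_sigma_finite[OF prob_space_PiM_gauss[OF \<sigma>]] J Hm'])
    fix \<Phi> :: "('i \<Rightarrow> real) \<Rightarrow> ennreal"
    assume \<Phi>: "\<Phi> \<in> borel_measurable ?G" "(\<integral>\<^sup>+x. \<Phi> x \<partial>?G) \<le> ennreal (sqrt 2 ^ card J)"
      "\<And>x c. (\<And>y. y \<in> extensional J \<Longrightarrow> H x y = (\<Sum>j\<in>J. c j * y j)) \<Longrightarrow> \<Phi> x = exp ((\<Sum>j\<in>J. (c j)\<^sup>2) / 2)"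
    show ?thesis
  proof (rule that[of \<Phi>])
    show "\<Phi> \<in> borel_measurable (PiM I (\<lambda>_. borel))" using \<Phi>(1) by simp
    show "(\<integral>\<^sup>+x. \<Phi> x \<partial>?G) \<le> ennreal (sqrt 2 ^ card J)" by (rule \<Phi>(2))
  next
    fix x assume x: "x \<in> S"
    have "H x y = (\<Sum>j\<in>J. (s * g x j) * y j)" for y
    proof -
      have "e x y = (\<Sum>k\<in>J. y k * g x k)" by (rule mc(1)[OF x])
      moreover have "e (T x) y = - (\<Sum>k\<in>J. y k * g x k)"
        unfolding mc(1)[OF TS[OF x]] sum_negf[symmetric] by (intro sum.cong) (simp_all add: odd[OF x])
      ultimately show ?thesis by (simp add: H_def sum_distrib_left ac_simps)
    qed
    then have "\<Phi> x = exp ((\<Sum>j\<in>J. (s * g x j)\<^sup>2) / 2)" by (rule \<Phi>(3))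
    also have "(\<Sum>j\<in>J. (s * g x j)\<^sup>2) / 2 = (\<Sum>k\<in>J. (g x k)\<^sup>2) / (4 * \<sigma>\<^sup>2 * L\<^sup>2)"
      by (simp add: power_mult_distrib sum_distrib_left[symmetric] s(2) sum_divide_distrib[symmetric])
    finally show "exp ((\<Sum>k\<in>J. (g x k)\<^sup>2) / (4 * \<sigma>\<^sup>2 * L\<^sup>2)) \<le> \<Phi> x" by simp
  qed
  qed (rule sub)
qed

subsection \<open>Operator norm of a Gaussian matrix\<close>

lemma nn_integral_gauss_square:
  assumes "0 < \<delta>" shows "(\<integral>\<^sup>+x. ennreal (x\<^sup>2) \<partial>gauss \<delta>) = ennreal (\<delta>\<^sup>2)"
proof -
  have "(\<integral>\<^sup>+x. ennreal (x\<^sup>2) \<partial>gauss \<delta>) = (\<integral>\<^sup>+x. ennreal (normal_density 0 \<delta> x) * ennreal (x\<^sup>2) \<partial>lborel)"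
    by (rule nn_integral_density) auto
  also have "\<dots> = (\<integral>\<^sup>+x. ennreal (normal_density 0 \<delta> x * (x - 0) ^ (2 * 1)) \<partial>lborel)"
    by (intro nn_integral_cong) (simp add: ennreal_mult[symmetric])
  also have "\<dots> = ennreal (\<integral>x. normal_density 0 \<delta> x * (x - 0) ^ (2 * 1) \<partial>lborel)"
    by (intro nn_integral_eq_integral integrable_normal_moment[OF assms]) auto
  also have "(\<integral>x. normal_density 0 \<delta> x * (x - 0) ^ (2 * 1) \<partial>lborel) = \<delta>\<^sup>2"
    using assms by (subst integral_normal_moment_even[OF assms]) (simp add: fact_numeral field_simps)
  finally show ?thesis .
qed

lemma nn_integral_PiM_gauss_square:
  fixes \<delta> :: real
  assumes \<delta>: "0 < \<delta>" and J: "finite J"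
  shows "(\<integral>\<^sup>+x. ennreal (\<Sum>j\<in>J. (x j)\<^sup>2) \<partial>PiM J (\<lambda>_. gauss \<delta>)) = ennreal (card J * \<delta>\<^sup>2)"
proof -
  interpret product_sigma_finite "\<lambda>_. gauss \<delta>" using \<delta> by (rule product_sigma_finite_gauss)
  have one: "emeasure (gauss \<delta>) UNIV = 1"
    using prob_space.emeasure_space_1[OF prob_space_normal_density[OF \<delta>, of 0]] by simp
  have "(\<integral>\<^sup>+x. ennreal ((x i)\<^sup>2) \<partial>PiM J (\<lambda>_. gauss \<delta>)) = ennreal (\<delta>\<^sup>2)" if i: "i \<in> J" for i
  proof -
    let ?f = "\<lambda>j x. if j = i then ennreal (x\<^sup>2) else 1"
    have "(\<integral>\<^sup>+x. ennreal ((x i)\<^sup>2) \<partial>PiM J (\<lambda>_. gauss \<delta>)) = (\<integral>\<^sup>+x. (\<Prod>j\<in>J. ?f j (x j)) \<partial>PiM J (\<lambda>_. gauss \<delta>))"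
      using i J by (intro nn_integral_cong) simp
    also have "\<dots> = (\<Prod>j\<in>J. (\<integral>\<^sup>+x. ?f j x \<partial>gauss \<delta>))"
      by (rule product_nn_integral_prod[OF J]) simp
    also have "\<dots> = (\<Prod>j\<in>J. if j = i then ennreal (\<delta>\<^sup>2) else 1)"
      by (intro prod.cong refl) (auto simp: nn_integral_gauss_square[OF \<delta>] one)
    also have "\<dots> = ennreal (\<delta>\<^sup>2)" using i J by simp
    finally show ?thesis .
  qed
  then have "(\<Sum>i\<in>J. (\<integral>\<^sup>+x. ennreal ((x i)\<^sup>2) \<partial>PiM J (\<lambda>_. gauss \<delta>))) = ennreal (card J * \<delta>\<^sup>2)"
    by (simp add: ennreal_mult ennreal_of_nat_eq_real_of_nat)
  moreover have "(\<integral>\<^sup>+x. ennreal (\<Sum>j\<in>J. (x j)\<^sup>2) \<partial>PiM J (\<lambda>_. gauss \<delta>)) = (\<Sum>i\<in>J. (\<integral>\<^sup>+x. ennreal ((x i)\<^sup>2) \<partial>PiM J (\<lambda>_. gauss \<delta>)))"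
    by (subst nn_integral_sum[symmetric]) (auto intro!: nn_integral_cong simp: sum_ennreal)
  ultimately show ?thesis by simp
qed

text \<open>Markov's inequality for the squared norm, whose mean is 1/2: pointwise, 1 is at most the
  indicator of the unit ball plus the squared norm.\<close>

lemma gauss_ball_ge_half:
  fixes \<delta> :: real
  assumes \<delta>: "0 < \<delta>" and J: "finite J" and "card J * \<delta>\<^sup>2 = 1 / 2"
  shows "ennreal (1 / 2) \<le> (\<integral>\<^sup>+x. of_bool ((\<Sum>j\<in>J. (x j)\<^sup>2) \<le> 1) \<partial>PiM J (\<lambda>_. gauss \<delta>))"
proof -
  let ?P = "PiM J (\<lambda>_. gauss \<delta>)"
  interpret prob_space ?P using \<delta> by (rule prob_space_PiM_gauss)
  have "1 = (\<integral>\<^sup>+x. 1 \<partial>?P)" by (simp add: emeasure_space_1)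
  also have "\<dots> \<le> (\<integral>\<^sup>+x. of_bool ((\<Sum>j\<in>J. (x j)\<^sup>2) \<le> 1) + ennreal (\<Sum>j\<in>J. (x j)\<^sup>2) \<partial>?P)"
    by (intro nn_integral_mono) (auto simp: of_bool_def)
  also have "\<dots> = (\<integral>\<^sup>+x. of_bool ((\<Sum>j\<in>J. (x j)\<^sup>2) \<le> 1) \<partial>?P) + (\<integral>\<^sup>+x. ennreal (\<Sum>j\<in>J. (x j)\<^sup>2) \<partial>?P)"
    by (intro nn_integral_add) (simp_all add: of_bool_def)
  also have "(\<integral>\<^sup>+x. ennreal (\<Sum>j\<in>J. (x j)\<^sup>2) \<partial>?P) = ennreal (1 / 2)"
    unfolding nn_integral_PiM_gauss_square[OF \<delta> J] assms(3) ..
  finally have *: "1 \<le> (\<integral>\<^sup>+x. of_bool ((\<Sum>j\<in>J. (x j)\<^sup>2) \<le> 1) \<partial>?P) + ennreal (1 / 2)" .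
  have "ennreal (1 / 2) = ennreal (1 - 1 / 2)" by simp
  also have "\<dots> = ennreal 1 - ennreal (1 / 2)" by (rule ennreal_minus[symmetric]) simp
  also have "\<dots> \<le> (\<integral>\<^sup>+x. of_bool ((\<Sum>j\<in>J. (x j)\<^sup>2) \<le> 1) \<partial>?P)"
    using * by (simp only: ennreal_minus_le_iff ennreal_1 add.commute) simp
  finally show ?thesis .
qed

lemma exp_add_ge_midpoint: "2 * exp ((s + t) / 2) \<le> exp s + exp (t::real)"
proof -
  have "0 \<le> (exp (s / 2) - exp (t / 2))\<^sup>2" by simp
  also have "\<dots> = exp s + exp t - 2 * exp ((s + t) / 2)"
    by (simp add: power2_diff exp_double[symmetric] exp_add[symmetric] add_divide_distrib mult.assoc)
  finally show ?thesis by simp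
qed

text \<open>Shift the Gaussian prior to the point \<open>a\<close> and average over \<open>\<plusminus>\<eta>\<close>: the linear terms cancel, and
  the parallelogram inequality for \<open>q\<close> replaces Jensen's inequality.\<close>

lemma gauss_local_average_ge:
  fixes q :: "('j \<Rightarrow> real) \<Rightarrow> real"
  assumes J: "finite J" and M: "card J = M" "0 < M" and a: "(\<Sum>j\<in>J. (a j)\<^sup>2) = 1"
    and qm: "q \<in> borel_measurable (PiM J (\<lambda>_. borel))"
    and q: "\<And>x. 2 * q a \<le> q (\<lambda>j\<in>J. x j + a j) + q (\<lambda>j\<in>J. - x j + a j)"
    and \<delta>: "\<delta> = 1 / sqrt (2 * real M)"
  shows "ennreal (exp (q a - M) / 2) \<le>
     (\<integral>\<^sup>+x. ennreal (exp (q x)) * of_bool ((\<Sum>j\<in>J. (x j)\<^sup>2) \<le> 4) \<partial>PiM J (\<lambda>_. gauss \<delta>))"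
proof -
  let ?P = "PiM J (\<lambda>_. gauss \<delta>)"
  \<comment> \<open>The variance 1 / (2 M) serves twice: the mean squared norm of the prior is 1/2,
    so the unit ball has at least half of its mass, and 1 / (2 \<delta>^2) = M, so shifting the
    prior by a unit vector costs only the factor exp (- M).\<close>
  have \<delta>0: "0 < \<delta>" and \<delta>2: "\<delta>\<^sup>2 = 1 / (2 * M)" using M by (auto simp: \<delta> power_divide)
  define u where "u x = ennreal (exp (q x)) * of_bool ((\<Sum>j\<in>J. (x j)\<^sup>2) \<le> 4)" for x
  define l where "l x = (\<Sum>j\<in>J. a j * x j)" for x
  \<comment> \<open>The Cameron-Martin weight of the shift by \<open>a\<close> is divided out
    beforehand, so that the translation formula turns the integral of \<open>u\<close> into that of
    \<open>G\<close>, which is centred at \<open>a\<close>.\<close>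
  define f0 where "f0 x = u x * ennreal (exp (- ((2 * l x - 1) / (2 * \<delta>\<^sup>2))))" for x
  define G where "G x = f0 (\<lambda>j\<in>J. x j + a j)" for x
  have um: "u \<in> borel_measurable (PiM J (\<lambda>_. borel))"
    unfolding u_def[abs_def] of_bool_def using qm by measurable
  have lm: "l \<in> borel_measurable (PiM J (\<lambda>_. borel))" unfolding l_def[abs_def] by measurable
  have f0m: "f0 \<in> borel_measurable (PiM J (\<lambda>_. borel))"
    unfolding f0_def[abs_def] using um lm by measurable
  have Gm: "G \<in> borel_measurable (PiM J (\<lambda>_. borel))"
    unfolding G_def[abs_def] by (rule measurable_compose[OF measurable_translate f0m])
  have Gnm: "(\<lambda>x. G (\<lambda>j\<in>J. - x j)) \<in> borel_measurable (PiM J (\<lambda>_. borel))"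
    by (rule measurable_compose[OF _ Gm]) measurable
  have "f0 x * ennreal (exp ((2 * l x - 1) / (2 * \<delta>\<^sup>2))) = u x" for x
    by (simp add: f0_def mult.assoc ennreal_mult[symmetric] exp_add[symmetric])
  then have "(\<integral>\<^sup>+x. u x \<partial>?P) = (\<integral>\<^sup>+x. f0 x * ennreal (exp ((2 * (\<Sum>j\<in>J. a j * x j) - (\<Sum>j\<in>J. (a j)\<^sup>2)) / (2 * \<delta>\<^sup>2))) \<partial>?P)"
    by (simp add: a l_def)
  also have "\<dots> = (\<integral>\<^sup>+x. G x \<partial>?P)"
    unfolding G_def by (rule nn_integral_PiM_gauss_translate[OF \<delta>0 J f0m])
  finally have uG: "(\<integral>\<^sup>+x. u x \<partial>?P) = (\<integral>\<^sup>+x. G x \<partial>?P)" .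
  have Gneg: "(\<integral>\<^sup>+x. G (\<lambda>j\<in>J. - x j) \<partial>?P) = (\<integral>\<^sup>+x. G x \<partial>?P)"
    by (rule nn_integral_PiM_gauss_uminus[OF \<delta>0 J Gm])
  \<comment> \<open>A point of the unit ball shifted by the unit vector \<open>a\<close> has norm at
    most 2, which is why \<open>u\<close> is cut off at squared norm 4.\<close>
  have Gval: "G x = ennreal (exp (q (\<lambda>j\<in>J. x j + a j) - 2 * M * l x - M))" if x: "(\<Sum>j\<in>J. (x j)\<^sup>2) \<le> 1" for x
  proof -
    have "L2_set (\<lambda>j. x j + a j) J \<le> L2_set x J + L2_set a J" by (rule L2_set_triangle_ineq)
    also have "\<dots> \<le> 2" using x a by (simp add: L2_set_def)
    finally have "(L2_set (\<lambda>j. x j + a j) J)\<^sup>2 \<le> 2\<^sup>2" by (intro power_mono) (simp_all add: L2_set_nonneg)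
    then have 1: "(\<Sum>j\<in>J. ((\<lambda>j\<in>J. x j + a j) j)\<^sup>2) \<le> 4" by (simp add: L2_set_square_sum)
    have 2: "l (\<lambda>j\<in>J. x j + a j) = l x + 1"
      unfolding l_def using a by (simp add: distrib_left sum.distrib power2_eq_square)
    have 3: "q (\<lambda>j\<in>J. x j + a j) + - ((2 * (l x + 1) - 1) / (2 * \<delta>\<^sup>2)) = q (\<lambda>j\<in>J. x j + a j) - 2 * M * l x - M"
      using M by (simp add: \<delta>2 field_simps)
    show ?thesis unfolding G_def f0_def u_def 2 3[symmetric] exp_add using 1 by (simp add: ennreal_mult)
  qed
  have Gneg': "G (\<lambda>j\<in>J. - x j) = ennreal (exp (q (\<lambda>j\<in>J. - x j + a j) + 2 * M * l x - M))" if x: "(\<Sum>j\<in>J. (x j)\<^sup>2) \<le> 1" for x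
  proof -
    have 1: "(\<lambda>j\<in>J. (\<lambda>j\<in>J. - x j) j + a j) = (\<lambda>j\<in>J. - x j + a j)" by auto
    have 2: "l (\<lambda>j\<in>J. - x j) = - l x" by (simp add: l_def sum_negf)
    have "(\<Sum>j\<in>J. ((\<lambda>j\<in>J. - x j) j)\<^sup>2) \<le> 1" using x by simp
    from Gval[OF this] show ?thesis unfolding 1 2 by (simp only: mult_minus_right diff_minus_eq_add)
  qed
  let ?c = "ennreal (exp (q a - M))"
  have "2 * ?c * of_bool ((\<Sum>j\<in>J. (x j)\<^sup>2) \<le> 1) \<le> G x + G (\<lambda>j\<in>J. - x j)" for x
  proof (cases "(\<Sum>j\<in>J. (x j)\<^sup>2) \<le> 1")
    case True
    define s t where "s = q (\<lambda>j\<in>J. x j + a j) - 2 * M * l x - M" and "t = q (\<lambda>j\<in>J. - x j + a j) + 2 * M * l x - M"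
    have "2 * exp (q a - M) \<le> 2 * exp ((s + t) / 2)"
      using q[of x] by (simp add: s_def t_def)
    also have "\<dots> \<le> exp s + exp t" by (rule exp_add_ge_midpoint)
    finally have "ennreal (2 * exp (q a - M)) \<le> ennreal (exp s + exp t)" by (rule ennreal_leI)
    then show ?thesis unfolding Gval[OF True] Gneg'[OF True] s_def[symmetric] t_def[symmetric]
      using True by (simp add: ennreal_mult ennreal_plus)
  qed simp
  then have "(\<integral>\<^sup>+x. 2 * ?c * of_bool ((\<Sum>j\<in>J. (x j)\<^sup>2) \<le> 1) \<partial>?P) \<le> (\<integral>\<^sup>+x. G x + G (\<lambda>j\<in>J. - x j) \<partial>?P)"
    by (intro nn_integral_mono)
  also have "\<dots> = (\<integral>\<^sup>+x. G x \<partial>?P) + (\<integral>\<^sup>+x. G (\<lambda>j\<in>J. - x j) \<partial>?P)"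
    using Gm Gnm by (intro nn_integral_add) simp_all
  also have "\<dots> = 2 * (\<integral>\<^sup>+x. u x \<partial>?P)" unfolding Gneg uG mult_2 ..
  finally have up: "(\<integral>\<^sup>+x. 2 * ?c * of_bool ((\<Sum>j\<in>J. (x j)\<^sup>2) \<le> 1) \<partial>?P) \<le> 2 * (\<integral>\<^sup>+x. u x \<partial>?P)" .
  have "ennreal (exp (q a - M) / 2) = ?c * ennreal (1 / 2)"
    by (subst ennreal_mult[symmetric]) simp_all
  then have "2 * ennreal (exp (q a - M) / 2) = 2 * ?c * ennreal (1 / 2)"
    by (simp only: mult.assoc)
  also have "\<dots> \<le> 2 * ?c * (\<integral>\<^sup>+x. of_bool ((\<Sum>j\<in>J. (x j)\<^sup>2) \<le> 1) \<partial>?P)"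
  proof (intro mult_left_mono)
    have "real (card J) * \<delta>\<^sup>2 = 1 / 2" using M by (simp add: \<delta>2)
    from gauss_ball_ge_half[OF \<delta>0 J this]
    show "ennreal (1 / 2) \<le> (\<integral>\<^sup>+x. of_bool ((\<Sum>j\<in>J. (x j)\<^sup>2) \<le> 1) \<partial>?P)" .
  qed simp
  also have "\<dots> = (\<integral>\<^sup>+x. 2 * ?c * of_bool ((\<Sum>j\<in>J. (x j)\<^sup>2) \<le> 1) \<partial>?P)"
    by (intro nn_integral_cmult[symmetric]) (simp add: of_bool_def)
  also note up
  finally have "2 * ennreal (exp (q a - M) / 2) \<le> 2 * (\<integral>\<^sup>+x. u x \<partial>?P)" .
  then have "ennreal (exp (q a - M) / 2) \<le> (\<integral>\<^sup>+x. u x \<partial>?P)"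
    by (subst (asm) ennreal_mult_le_mult_iff) auto
  then show ?thesis by (simp only: u_def)
qed

text \<open>For fixed y of norm at most 2, the product of the noise matrix with y is linear in the
  noise, hence odd under negation, and 2-Lipschitz for the Frobenius norm. Concentration applies
  with \<open>S\<close> the whole space, and 16 is 4 times 2^2.\<close>

lemma gauss_matrix_vector_exp:
  fixes y :: "nat \<Rightarrow> real"
  assumes \<sigma>: "0 < \<sigma>" and y: "(\<Sum>j=0..<m. (y j)\<^sup>2) \<le> 4"
  shows "(\<integral>\<^sup>+f. exp ((\<Sum>i=0..<n. (\<Sum>j=0..<m. f (i,j) * y j)\<^sup>2) / (16 * \<sigma>\<^sup>2)) \<partial>PiM ({0..<n} \<times> {0..<m}) (\<lambda>_. gauss \<sigma>))
    \<le> ennreal (sqrt 2 ^ n)"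
proof -
  let ?I = "{0..<n} \<times> {0..<m}"
  define g where "g f i = (\<Sum>j=0..<m. f (i,j) * y j)" for f :: "nat \<times> nat \<Rightarrow> real" and i
  define T where "T f = (\<lambda>p\<in>?I. - f p)" for f :: "nat \<times> nat \<Rightarrow> real"
  have Tm: "T \<in> PiM ?I (\<lambda>_. borel) \<rightarrow>\<^sub>M PiM ?I (\<lambda>_. borel :: real measure)"
    unfolding T_def[abs_def] by measurable
  show ?thesis
  proof (rule odd_lipschitz_vector_concentration[where I = ?I and J = "{0..<n}" and L = 2 and T = T
        and S = "extensional ?I" and g = g and \<sigma> = \<sigma>])
    fix h :: "(nat \<times> nat \<Rightarrow> real) \<Rightarrow> ennreal" assume h: "h \<in> borel_measurable (PiM ?I (\<lambda>_. borel))"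
    show "(\<integral>\<^sup>+x. h (T x) \<partial>PiM ?I (\<lambda>_. gauss \<sigma>)) = (\<integral>\<^sup>+x. h x \<partial>PiM ?I (\<lambda>_. gauss \<sigma>))"
      unfolding T_def by (rule nn_integral_PiM_gauss_uminus[OF \<sigma> _ h]) simp
  next
    fix x :: "nat \<times> nat \<Rightarrow> real" assume "x \<in> extensional ?I"
    then show "T (T x) = x" by (auto simp: T_def extensional_def restrict_def fun_eq_iff)
  next
    fix x x' :: "nat \<times> nat \<Rightarrow> real"
    have "L2_set (\<lambda>i. T x i - T x' i) ?I = L2_set (\<lambda>i. x' i - x i) ?I"
      by (intro L2_set_cong) (auto simp: T_def)
    then show "L2_set (\<lambda>i. T x i - T x' i) ?I = L2_set (\<lambda>i. x i - x' i) ?I"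
      using L2_set_diff_commute[of x x' ?I] by simp
  next
    fix x :: "nat \<times> nat \<Rightarrow> real" and k :: nat assume "k \<in> {0..<n}"
    then show "g (T x) k = - g x k" by (simp add: g_def T_def sum_negf)
  next
    fix x x' :: "nat \<times> nat \<Rightarrow> real"
    define d where "d p = x p - x' p" for p
    have "(\<Sum>i=0..<n. (g x i - g x' i)\<^sup>2) \<le> (\<Sum>i=0..<n. (\<Sum>j=0..<m. (d (i,j))\<^sup>2) * 4)"
    proof (intro sum_mono)
      fix i
      have "(g x i - g x' i)\<^sup>2 = (\<Sum>j=0..<m. d (i,j) * y j)\<^sup>2"
        by (simp add: g_def d_def sum_subtractf[symmetric] left_diff_distrib)
      also have "\<dots> \<le> (\<Sum>j=0..<m. (d (i,j))\<^sup>2) * (\<Sum>j=0..<m. (y j)\<^sup>2)" by (rule Cauchy_Schwarz_ineq_sum)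
      also have "\<dots> \<le> (\<Sum>j=0..<m. (d (i,j))\<^sup>2) * 4" using y by (intro mult_left_mono sum_nonneg) auto
      finally show "(g x i - g x' i)\<^sup>2 \<le> (\<Sum>j=0..<m. (d (i,j))\<^sup>2) * 4" .
    qed
    also have "\<dots> = 4 * (\<Sum>p\<in>?I. (d p)\<^sup>2)"
      by (simp add: sum_distrib_right[symmetric] sum.cartesian_product)
    finally have "sqrt (\<Sum>i=0..<n. (g x i - g x' i)\<^sup>2) \<le> sqrt (4 * (\<Sum>p\<in>?I. (d p)\<^sup>2))" by (rule real_sqrt_le_mono)
    then show "L2_set (\<lambda>k. g x k - g x' k) {0..<n} \<le> 2 * L2_set (\<lambda>i. x i - x' i) ?I"
      by (simp add: L2_set_def d_def real_sqrt_mult)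
  next
    fix \<Phi> :: "(nat \<times> nat \<Rightarrow> real) \<Rightarrow> ennreal"
    assume 1: "(\<integral>\<^sup>+x. \<Phi> x \<partial>PiM ?I (\<lambda>_. gauss \<sigma>)) \<le> ennreal (sqrt 2 ^ card {0..<n})"
      and 2: "\<And>x. x \<in> extensional ?I \<Longrightarrow> ennreal (exp ((\<Sum>k\<in>{0..<n}. (g x k)\<^sup>2) / (4 * \<sigma>\<^sup>2 * 2\<^sup>2))) \<le> \<Phi> x"
    have "(\<integral>\<^sup>+f. exp ((\<Sum>i=0..<n. (g f i)\<^sup>2) / (16 * \<sigma>\<^sup>2)) \<partial>PiM ?I (\<lambda>_. gauss \<sigma>)) \<le> (\<integral>\<^sup>+x. \<Phi> x \<partial>PiM ?I (\<lambda>_. gauss \<sigma>))"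
      using 2 by (intro nn_integral_mono) (simp add: space_PiM_gauss mult.commute[of "\<sigma>\<^sup>2"])
    also note 1
    finally show ?thesis by (simp add: g_def)
  qed (use \<sigma> Tm in \<open>auto simp: T_def\<close>)
qed

lemma (in prob_space) prob_ge_le_inverse:
  assumes \<Phi>: "\<Phi> \<in> borel_measurable M" "(\<integral>\<^sup>+x. \<Phi> x \<partial>M) \<le> ennreal a" and aK: "0 < a" "0 < K"
  shows "prob {x \<in> space M. ennreal (a * K) \<le> \<Phi> x} \<le> 1 / K"
proof -
  define B where "B = {x \<in> space M. ennreal (a * K) \<le> \<Phi> x}"
  have B: "B \<in> events" unfolding B_def using \<Phi>(1) by measurable
  let ?t = "ennreal (1 / (a * K))"
  have one: "?t * ennreal (a * K) = 1" using aK by (simp add: ennreal_mult[symmetric])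
  have ind: "(\<integral>\<^sup>+x. indicator B x \<partial>M) \<le> (\<integral>\<^sup>+x. ?t * \<Phi> x \<partial>M)"
  proof (intro nn_integral_mono)
    fix x
    show "indicator B x \<le> ?t * \<Phi> x"
    proof (cases "x \<in> B")
      case True
      then have "?t * ennreal (a * K) \<le> ?t * \<Phi> x" by (intro mult_left_mono) (auto simp: B_def)
      then show ?thesis using True unfolding one by simp
    qed simp
  qed
  have mult: "(\<integral>\<^sup>+x. ?t * \<Phi> x \<partial>M) = ?t * (\<integral>\<^sup>+x. \<Phi> x \<partial>M)" by (rule nn_integral_cmult[OF \<Phi>(1)])
  have le: "?t * (\<integral>\<^sup>+x. \<Phi> x \<partial>M) \<le> ?t * ennreal a" using \<Phi>(2) by (intro mult_left_mono) simp_all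
  have val: "?t * ennreal a = ennreal (1 / K)" using aK by (subst ennreal_mult[symmetric]) simp_all
  have "emeasure M B \<le> ennreal (1 / K)" using order_trans[OF ind[unfolded mult] le[unfolded val]] B by simp
  then show ?thesis using aK unfolding B_def[symmetric] by (simp add: emeasure_eq_measure)
qed

text \<open>Averaging the exponential over a Gaussian prior of directions gives one random variable
  \<open>K\<close> with a controlled mean, so a single use of Markov's inequality suffices. On the
  resulting event every unit vector \<open>a\<close> is controlled at once, because the average over
  the prior dominates the value at each \<open>a\<close> up to a factor exponential in the
  dimension.\<close>

lemma gauss_operator_norm:
  assumes \<sigma>: "0 < \<sigma>" and N: "n \<le> N" "m \<le> N" "2 \<le> N" and m: "0 < m"
  obtains E where "E \<in> sets (PiM ({0..<n} \<times> {0..<m}) (\<lambda>_. gauss \<sigma>))"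
    "measure (PiM ({0..<n} \<times> {0..<m}) (\<lambda>_. gauss \<sigma>)) E \<ge> 1 - exp (- (real N / 2))"
    "\<And>f a. f \<in> E \<Longrightarrow> (\<Sum>j=0..<m. (a j)\<^sup>2) = 1 \<Longrightarrow>
      (\<Sum>i=0..<n. (\<Sum>j=0..<m. f (i,j) * a j)\<^sup>2) \<le> 36 * \<sigma>\<^sup>2 * real N"
proof -
  let ?I = "{0..<n} \<times> {0..<m}" and ?J = "{0..<m}"
  let ?M = "PiM ?I (\<lambda>_. gauss \<sigma>)"
  define \<delta> where "\<delta> = 1 / sqrt (2 * real m)"
  have \<delta>: "0 < \<delta>" using m by (simp add: \<delta>_def)
  let ?P = "PiM ?J (\<lambda>_. gauss \<delta>)"
  interpret M: prob_space ?M using \<sigma> by (rule prob_space_PiM_gauss)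
  interpret prior: prob_space ?P using \<delta> by (rule prob_space_PiM_gauss)
  interpret pair_sigma_finite ?M ?P by standard
  define q where "q f y = (\<Sum>i=0..<n. (\<Sum>j=0..<m. f (i,j) * y j)\<^sup>2) / (16 * \<sigma>\<^sup>2)" for f :: "nat \<times> nat \<Rightarrow> real" and y :: "nat \<Rightarrow> real"
  define u where "u f y = ennreal (exp (q f y)) * of_bool ((\<Sum>j\<in>?J. (y j)\<^sup>2) \<le> 4)" for f y
  define K where "K f = (\<integral>\<^sup>+y. u f y \<partial>?P)" for f
  have "(\<lambda>(f, y). u f y) \<in> borel_measurable (PiM ?I (\<lambda>_. borel) \<Otimes>\<^sub>M PiM ?J (\<lambda>_. borel))"
    unfolding u_def q_def of_bool_def by measurable
  moreover have sets: "sets (?M \<Otimes>\<^sub>M ?P) = sets (PiM ?I (\<lambda>_. borel :: real measure) \<Otimes>\<^sub>M PiM ?J (\<lambda>_. borel :: real measure))"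
    by (intro sets_pair_measure_cong sets_PiM_gauss)
  ultimately have um: "(\<lambda>(f, y). u f y) \<in> borel_measurable (?M \<Otimes>\<^sub>M ?P)"
    by (simp only: measurable_cong_sets[OF sets refl])
  have Km: "K \<in> borel_measurable ?M" unfolding K_def[abs_def] by (rule prior.borel_measurable_nn_integral[OF um])
  let ?R = "ennreal (sqrt 2 ^ n)" and ?c = "exp (real N / 2)"
  have "(\<integral>\<^sup>+f. K f \<partial>?M) = (\<integral>\<^sup>+y. (\<integral>\<^sup>+f. u f y \<partial>?M) \<partial>?P)"
    unfolding K_def by (rule Fubini'[OF um, symmetric])
  also have "\<dots> \<le> (\<integral>\<^sup>+y. ?R \<partial>?P)"
  proof (intro nn_integral_mono)
    fix y :: "nat \<Rightarrow> real"
    show "(\<integral>\<^sup>+f. u f y \<partial>?M) \<le> ?R"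
    proof (cases "(\<Sum>j\<in>?J. (y j)\<^sup>2) \<le> 4")
      case True
      then show ?thesis using gauss_matrix_vector_exp[OF \<sigma> True] by (simp add: u_def q_def)
    qed (simp add: u_def)
  qed
  also have "\<dots> = ?R" by (simp add: prior.emeasure_space_1)
  finally have EK: "(\<integral>\<^sup>+f. K f \<partial>?M) \<le> ?R" .
  define B where "B = {f \<in> space ?M. ennreal (sqrt 2 ^ n * ?c) \<le> K f}"
  define E where "E = space ?M - B"
  have [measurable]: "B \<in> sets ?M" unfolding B_def using Km by measurable
  have "measure ?M B \<le> 1 / ?c"
    unfolding B_def by (rule M.prob_ge_le_inverse[OF Km EK]) simp_all
  then have "measure ?M B \<le> exp (- (real N / 2))" by (simp only: exp_minus inverse_eq_divide)
  then have E1: "measure ?M E \<ge> 1 - exp (- (real N / 2))" unfolding E_def by (simp add: M.prob_compl)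
  show thesis
  proof (rule that[of E])
    show "E \<in> sets ?M" by (simp add: E_def)
    show "measure ?M E \<ge> 1 - exp (- (real N / 2))" by (rule E1)
  next
    fix f :: "nat \<times> nat \<Rightarrow> real" and a :: "nat \<Rightarrow> real" assume f: "f \<in> E" and a: "(\<Sum>j=0..<m. (a j)\<^sup>2) = 1"
    have KR: "K f < ennreal (sqrt 2 ^ n * ?c)" using f by (auto simp: E_def B_def)
    have "ennreal (exp (q f a - m) / 2) \<le> (\<integral>\<^sup>+x. ennreal (exp (q f x)) * of_bool ((\<Sum>j\<in>?J. (x j)\<^sup>2) \<le> 4) \<partial>?P)"
    proof (rule gauss_local_average_ge[OF _ _ m a _ _ \<delta>_def])
      show "q f \<in> borel_measurable (PiM ?J (\<lambda>_. borel))" unfolding q_def[abs_def] by measurable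
    next
      fix x :: "nat \<Rightarrow> real"
      \<comment> \<open>The parallelogram identity (t + s)^2 + (t - s)^2 = 2 t^2 + 2 s^2 in each row
        supplies the convexity that the local average needs.\<close>
      have "2 * (\<Sum>j=0..<m. f (i,j) * a j)\<^sup>2 \<le> (\<Sum>j=0..<m. f (i,j) * (\<lambda>j\<in>?J. x j + a j) j)\<^sup>2 + (\<Sum>j=0..<m. f (i,j) * (\<lambda>j\<in>?J. - x j + a j) j)\<^sup>2" for i
      proof -
        define s t where "s = (\<Sum>j=0..<m. f (i,j) * x j)" and "t = (\<Sum>j=0..<m. f (i,j) * a j)"
        have 1: "(\<Sum>j=0..<m. f (i,j) * (\<lambda>j\<in>?J. x j + a j) j) = s + t"
          unfolding s_def t_def sum.distrib[symmetric] by (intro sum.cong) (auto simp: distrib_left)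
        have 2: "(\<Sum>j=0..<m. f (i,j) * (\<lambda>j\<in>?J. - x j + a j) j) = t - s"
          unfolding s_def t_def sum_subtractf[symmetric] by (intro sum.cong) (auto simp: algebra_simps)
        show ?thesis unfolding 1 2 t_def[symmetric] by (simp add: power2_eq_square algebra_simps)
      qed
      then show "2 * q f a \<le> q f (\<lambda>j\<in>?J. x j + a j) + q f (\<lambda>j\<in>?J. - x j + a j)"
        unfolding q_def add_divide_distrib[symmetric] sum.distrib[symmetric] times_divide_eq_right sum_distrib_left
        by (intro divide_right_mono sum_mono) simp_all
    qed simp_all
    then have "ennreal (exp (q f a - m) / 2) \<le> K f" by (simp only: K_def u_def)
    then have "ennreal (exp (q f a - m) / 2) < ennreal (sqrt 2 ^ n * ?c)" using KR by (rule le_less_trans)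
    then have 1: "exp (q f a - m) < 2 * (sqrt 2 ^ n * ?c)" by (simp add: ennreal_less_iff)
    have "sqrt 2 ^ n \<le> sqrt 2 ^ N" using N(1) by (intro power_increasing) auto
    moreover have "sqrt 2 ^ N = exp (real N * (ln 2 / 2))"
      by (simp add: ln_sqrt[symmetric] exp_of_nat_mult)
    ultimately have "2 * (sqrt 2 ^ n * ?c) \<le> 2 * (exp (real N * (ln 2 / 2)) * ?c)" by simp
    also have "\<dots> = exp (ln 2 + (real N * (ln 2 / 2) + real N / 2))"
      by (simp only: exp_add) simp
    finally have "exp (q f a - m) < exp (ln 2 + (real N * (ln 2 / 2) + real N / 2))" using 1 by linarith
    then have 2: "q f a < m + ln 2 + real N * (ln 2 / 2) + real N / 2" by simp
    \<comment> \<open>As N is at least 2 and m at most N, the bound is at most (1 + 0.35 + 0.35 +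
      0.5) N = 2.2 N, below 9 N / 4. Multiplying by 16 \<sigma>^2 gives 36 \<sigma>^2 N, the square
      of 6 \<sigma> \<surd>N.\<close>
    have l: "ln 2 \<le> (7/10 :: real)" using ln2_le_25_over_36 by simp
    then have "real N * (ln 2 / 2) \<le> real N * (7/20)" by (intro mult_left_mono) auto
    then have "q f a \<le> 9 / 4 * real N" using 2 l N by linarith
    then show "(\<Sum>i=0..<n. (\<Sum>j=0..<m. f (i,j) * a j)\<^sup>2) \<le> 36 * \<sigma>\<^sup>2 * real N"
      using \<sigma> by (simp add: q_def field_simps)
  qed
qed

subsection \<open>Singular values\<close>

unbundle no inner_syntax
unbundle no vec_syntax

definition vnorm :: "real vec \<Rightarrow> real" where
  "vnorm v = sqrt (v \<bullet> v)"

lemma vnorm_eq_L2_set: "vnorm v = L2_set (\<lambda>i. v $ i) {0..<dim_vec v}"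
  by (simp add: vnorm_def scalar_prod_def L2_set_def power2_eq_square)

lemma vnorm_nonneg [simp]: "0 \<le> vnorm v"
  by (simp add: vnorm_eq_L2_set)

lemma scalar_prod_self_nonneg: "0 \<le> (v :: real vec) \<bullet> v"
  by (simp add: scalar_prod_def sum_nonneg)

lemma vnorm_power2: "(vnorm v)\<^sup>2 = v \<bullet> v"
  by (simp add: vnorm_def scalar_prod_self_nonneg)

lemma vnorm_eq_0_iff: "v \<in> carrier_vec n \<Longrightarrow> vnorm v = 0 \<longleftrightarrow> v = 0\<^sub>v n"
  by (auto simp: vnorm_eq_L2_set L2_set_eq_0_iff)

lemma vnorm_zero [simp]: "vnorm (0\<^sub>v n) = 0"
  by (simp add: vnorm_def)

lemma vnorm_diff_self: "vnorm (x - x) = 0"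
  by (simp add: vnorm_eq_L2_set L2_set_def)

lemma scalar_prod_abs_le:
  assumes "dim_vec x = dim_vec y"
  shows "\<bar>x \<bullet> y\<bar> \<le> vnorm x * vnorm y"
proof -
  have "\<bar>x \<bullet> y\<bar> \<le> (\<Sum>i\<in>{0..<dim_vec y}. \<bar>x $ i\<bar> * \<bar>y $ i\<bar>)"
    unfolding scalar_prod_def by (rule order.trans[OF sum_abs]) (simp add: abs_mult)
  also have "\<dots> \<le> vnorm x * vnorm y"
    using L2_set_mult_ineq by (simp add: vnorm_eq_L2_set assms)
  finally show ?thesis .
qed

lemma vnorm_add_le: "dim_vec x = dim_vec y \<Longrightarrow> vnorm (x + y) \<le> vnorm x + vnorm y"
  using L2_set_triangle_ineq[of "\<lambda>i. x $ i" "\<lambda>i. y $ i" "{0..<dim_vec y}"]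
  by (simp add: vnorm_eq_L2_set L2_set_def)

lemma vnorm_smult: "vnorm (c \<cdot>\<^sub>v x) = \<bar>c\<bar> * vnorm x"
proof -
  have "(c \<cdot>\<^sub>v x) \<bullet> (c \<cdot>\<^sub>v x) = c\<^sup>2 * (x \<bullet> x)"
    by (simp add: scalar_prod_def sum_distrib_left power2_eq_square ac_simps)
  then show ?thesis by (simp add: vnorm_def real_sqrt_mult)
qed

lemma vnorm_uminus: "vnorm (- x) = vnorm x"
  by (simp add: vnorm_def)

lemma vnorm_minus_le: "dim_vec x = dim_vec y \<Longrightarrow> vnorm (x - y) \<le> vnorm x + vnorm y"
  using L2_set_triangle_ineq[of "\<lambda>i. x $ i" "\<lambda>i. - y $ i" "{0..<dim_vec y}"]
  by (simp add: vnorm_eq_L2_set L2_set_def)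

lemma vnorm_le_of_square: "0 \<le> c \<Longrightarrow> x \<bullet> x \<le> c * vnorm x \<Longrightarrow> vnorm x \<le> c"
  by (metis mult_right_le_imp_le vnorm_power2 power2_eq_square vnorm_nonneg order_le_less)

text \<open>Fewer than n vectors, written as rows of a square matrix whose row k is zero, make its
  determinant vanish; a normalised kernel vector is orthogonal to all of them.\<close>

lemma ex_orthogonal_vec:
  fixes z :: "nat \<Rightarrow> real vec"
  assumes "\<And>j. j < k \<Longrightarrow> z j \<in> carrier_vec n" "k < n"
  shows "\<exists>x\<in>carrier_vec n. x \<bullet> x = 1 \<and> (\<forall>j<k. z j \<bullet> x = 0)"
proof -
  define M where "M = mat\<^sub>r n n (\<lambda>i. if i = k then 0\<^sub>v n else if i < k then z i else 0\<^sub>v n)"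
  have M: "M \<in> carrier_mat n n" by (simp add: M_def)
  have "det M = 0" unfolding M_def by (rule det_row_0) (use assms in auto)
  then obtain v where v: "v \<in> carrier_vec n" "v \<noteq> 0\<^sub>v n" "M *\<^sub>v v = 0\<^sub>v n"
    using det_0_iff_vec_prod_zero_field[OF M] by auto
  have orth: "z j \<bullet> v = 0" if j: "j < k" for j
  proof -
    have "(M *\<^sub>v v) $ j = z j \<bullet> v" using assms j M by (auto simp: M_def)
    then show ?thesis using v(3) assms j by simp
  qed
  have pos: "vnorm v \<noteq> 0" using vnorm_eq_0_iff[OF v(1)] v(2) by simp
  define x where "x = (1 / vnorm v) \<cdot>\<^sub>v v"
  have "vnorm x = 1" using pos by (simp add: x_def vnorm_smult)
  then have "x \<bullet> x = 1" using vnorm_power2[of x] by simp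
  moreover have "z j \<bullet> x = 0" if "j < k" for j
    using orth[OF that] assms(1)[OF that] v(1) by (simp add: x_def)
  ultimately show ?thesis using v(1) by (intro bexI[of _ x]) (auto simp: x_def)
qed

text \<open>The quadratic form attains its maximum on the unit sphere of the orthogonal complement
  by compactness, and homogeneity extends the bound from unit vectors to all vectors.\<close>

lemma ex_max_quadratic_form:
  fixes z :: "nat \<Rightarrow> real vec" and A :: "real mat"
  assumes A: "A \<in> carrier_mat n n" and z: "\<And>j. j < k \<Longrightarrow> z j \<in> carrier_vec n" and "k < n"
  shows "\<exists>x\<in>carrier_vec n. x \<bullet> x = 1 \<and> (\<forall>j<k. z j \<bullet> x = 0) \<and>
     (\<forall>y\<in>carrier_vec n. (\<forall>j<k. z j \<bullet> y = 0) \<longrightarrow> y \<bullet> (A *\<^sub>v y) \<le> (x \<bullet> (A *\<^sub>v x)) * (y \<bullet> y))"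
proof -
  \<comment> \<open>Vectors are encoded as functions on all of nat whose entries from n on are
    pinned to 0, so that the box is compact in the product topology.\<close>
  define B :: "(nat \<Rightarrow> real) set" where "B = PiE UNIV (\<lambda>i. if i < n then {-1..1} else {0})"
  define C :: "(nat \<Rightarrow> real) set" where "C = {f. (\<Sum>i=0..<n. f i * f i) = 1}"
  define D :: "nat \<Rightarrow> (nat \<Rightarrow> real) set" where "D j = {f. (\<Sum>i=0..<n. z j $ i * f i) = 0}" for j
  define K where "K = B \<inter> (C \<inter> (\<Inter>j\<in>{..<k}. D j))"
  define q where "q f = (\<Sum>i=0..<n. f i * (\<Sum>j=0..<n. A $$ (i,j) * f j))" for f :: "nat \<Rightarrow> real"
  have qv: "q (\<lambda>i. if i < n then y $ i else 0) = y \<bullet> (A *\<^sub>v y)" if "y \<in> carrier_vec n" for y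
    using that A by (auto simp: q_def scalar_prod_def intro!: sum.cong)
  have coord: "continuous_on S (\<lambda>f. f i)" for S :: "(nat \<Rightarrow> real) set" and i
    by (rule continuous_on_subset[OF continuous_on_product_coordinates]) simp
  have "compactin (product_topology (\<lambda>i. euclidean) UNIV) B"
    unfolding B_def compactin_PiE by auto
  then have cB: "compact B" by (simp add: euclidean_product_topology flip: compactin_euclidean_iff)
  have "closed C" unfolding C_def by (intro closed_Collect_eq continuous_intros coord)
  moreover have "closed (D j)" for j unfolding D_def by (intro closed_Collect_eq continuous_intros coord)
  ultimately have cK: "compact K" unfolding K_def using cB by (intro compact_Int_closed closed_Int closed_INT) auto
  have inK: "(\<lambda>i. if i < n then y $ i else 0) \<in> K"
    if y: "y \<in> carrier_vec n" "y \<bullet> y = 1" "\<forall>j<k. z j \<bullet> y = 0" for y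
  proof -
    have s: "(\<Sum>i=0..<n. y $ i * y $ i) = 1" using y(1,2) by (simp add: scalar_prod_def)
    have "\<bar>y $ i\<bar> \<le> 1" if "i < n" for i
    proof -
      have "y $ i * y $ i \<le> (\<Sum>i=0..<n. y $ i * y $ i)" by (rule member_le_sum) (use that in auto)
      then show ?thesis using s abs_square_le_1[of "y $ i"] by (simp add: power2_eq_square)
    qed
    then show ?thesis using y s by (auto simp: K_def B_def C_def D_def scalar_prod_def abs_le_iff)
  qed
  obtain x0 where "x0 \<in> carrier_vec n" "x0 \<bullet> x0 = 1" "\<forall>j<k. z j \<bullet> x0 = 0"
    using ex_orthogonal_vec[of k z n] z \<open>k < n\<close> by auto
  then have "K \<noteq> {}" using inK by blast
  moreover have "continuous_on K q" unfolding q_def by (intro continuous_intros coord)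
  ultimately obtain f where f: "f \<in> K" "\<And>g. g \<in> K \<Longrightarrow> q g \<le> q f"
    using continuous_attains_sup[OF cK] by blast
  define x where "x = vec n f"
  have fB: "f \<in> PiE UNIV (\<lambda>i. if i < n then {-1..1} else {0})" using f(1) by (simp add: K_def B_def)
  have f0: "f i = 0" if "\<not> i < n" for i using PiE_mem[OF fB UNIV_I, of i] that by simp
  then have fx: "(\<lambda>i. if i < n then x $ i else 0) = f" by (auto simp: x_def)
  have x: "x \<in> carrier_vec n" "x \<bullet> x = 1" "\<forall>j<k. z j \<bullet> x = 0"
    using f(1) by (auto simp: x_def K_def C_def D_def scalar_prod_def)
  have "y \<bullet> (A *\<^sub>v y) \<le> (x \<bullet> (A *\<^sub>v x)) * (y \<bullet> y)" if y: "y \<in> carrier_vec n" "\<forall>j<k. z j \<bullet> y = 0" for y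
  proof (cases "vnorm y = 0")
    case True
    then show ?thesis using A vnorm_eq_0_iff[OF y(1)] by simp
  next
    case False
    define c where "c = 1 / vnorm y"
    have cy: "c\<^sup>2 * (y \<bullet> y) = 1" using False by (simp add: c_def vnorm_power2[symmetric] power_divide)
    have "c \<cdot>\<^sub>v y \<in> carrier_vec n" "(c \<cdot>\<^sub>v y) \<bullet> (c \<cdot>\<^sub>v y) = 1" "\<forall>j<k. z j \<bullet> (c \<cdot>\<^sub>v y) = 0"
      using y z cy by (auto simp: power2_eq_square mult.assoc)
    from f(2)[OF inK[OF this]] have "(c \<cdot>\<^sub>v y) \<bullet> (A *\<^sub>v (c \<cdot>\<^sub>v y)) \<le> x \<bullet> (A *\<^sub>v x)"
      using qv[of "c \<cdot>\<^sub>v y"] qv[of x] fx x y by simp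
    also have "(c \<cdot>\<^sub>v y) \<bullet> (A *\<^sub>v (c \<cdot>\<^sub>v y)) = c\<^sup>2 * (y \<bullet> (A *\<^sub>v y))"
      using A y by (simp add: mult_mat_vec power2_eq_square)
    finally have "(c\<^sup>2 * (y \<bullet> (A *\<^sub>v y))) * (y \<bullet> y) \<le> (x \<bullet> (A *\<^sub>v x)) * (y \<bullet> y)"
      by (intro mult_right_mono scalar_prod_self_nonneg)
    moreover have "(c\<^sup>2 * (y \<bullet> (A *\<^sub>v y))) * (y \<bullet> y) = y \<bullet> (A *\<^sub>v y) * (c\<^sup>2 * (y \<bullet> y))" by simp
    ultimately show ?thesis unfolding cy by simp
  qed
  then show ?thesis using x by blast
qed

text \<open>First-order condition for the constrained maximum. The residual y = A x - c x is
  orthogonal to the earlier eigenvectors, so x + t y is admissible for all t. Maximality then bounds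
  the linear term 2 t |y|^2 by a multiple of t^2, which forces y = 0.\<close>

lemma eigenvector_of_max_quadratic_form:
  fixes z :: "nat \<Rightarrow> real vec" and A :: "real mat"
  assumes A: "A \<in> carrier_mat n n" "transpose_mat A = A"
    and z: "\<And>j. j < k \<Longrightarrow> z j \<in> carrier_vec n" "\<And>j. j < k \<Longrightarrow> A *\<^sub>v z j = d j \<cdot>\<^sub>v z j"
    and x: "x \<in> carrier_vec n" "x \<bullet> x = 1" "\<And>j. j < k \<Longrightarrow> z j \<bullet> x = 0"
    and max: "\<And>y. y \<in> carrier_vec n \<Longrightarrow> (\<And>j. j < k \<Longrightarrow> z j \<bullet> y = 0) \<Longrightarrow>
      y \<bullet> (A *\<^sub>v y) \<le> (x \<bullet> (A *\<^sub>v x)) * (y \<bullet> y)"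
  shows "A *\<^sub>v x = (x \<bullet> (A *\<^sub>v x)) \<cdot>\<^sub>v x"
proof -
  define c where "c = x \<bullet> (A *\<^sub>v x)"
  define y where "y = A *\<^sub>v x - c \<cdot>\<^sub>v x"
  have Ax: "A *\<^sub>v x \<in> carrier_vec n" and y: "y \<in> carrier_vec n" and Ay: "A *\<^sub>v y \<in> carrier_vec n"
    using A x by (auto simp: y_def)
  have symm: "u \<bullet> (A *\<^sub>v v) = (A *\<^sub>v u) \<bullet> v" if "u \<in> carrier_vec n" "v \<in> carrier_vec n" for u v
    using transpose_vec_mult_scalar[OF A(1) that(2,1)] A(2) by simp
  have zy: "z j \<bullet> y = 0" if "j < k" for j
  proof -
    have "z j \<bullet> (A *\<^sub>v x) = d j * (z j \<bullet> x)"
      using symm[OF z(1)[OF that] x(1)] z[OF that] x(1) by simp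
    then show ?thesis using z(1)[OF that] x Ax x(3)[OF that] by (simp add: y_def scalar_prod_minus_distrib[of _ n])
  qed
  have yy: "y \<bullet> (A *\<^sub>v x) - c * (y \<bullet> x) = y \<bullet> y"
    using y x Ax by (subst (4) y_def) (simp add: scalar_prod_minus_distrib[of _ n])
  define b where "b = c * (y \<bullet> y) - y \<bullet> (A *\<^sub>v y)"
  have quad: "2 * (y \<bullet> y) * t \<le> b * t\<^sup>2" for t :: real
  proof -
    have w: "x + t \<cdot>\<^sub>v y \<in> carrier_vec n" using x y by simp
    have "z j \<bullet> (x + t \<cdot>\<^sub>v y) = 0" if "j < k" for j
      using z(1)[OF that] x y x(3)[OF that] zy[OF that] by (simp add: scalar_prod_add_distrib[of _ n])
    from max[OF w this] have "(x + t \<cdot>\<^sub>v y) \<bullet> (A *\<^sub>v (x + t \<cdot>\<^sub>v y)) \<le> c * ((x + t \<cdot>\<^sub>v y) \<bullet> (x + t \<cdot>\<^sub>v y))"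
      by (simp add: c_def)
    moreover have "(x + t \<cdot>\<^sub>v y) \<bullet> (A *\<^sub>v (x + t \<cdot>\<^sub>v y)) = c + 2 * t * (y \<bullet> (A *\<^sub>v x)) + t\<^sup>2 * (y \<bullet> (A *\<^sub>v y))"
    proof -
      have "A *\<^sub>v (x + t \<cdot>\<^sub>v y) = A *\<^sub>v x + t \<cdot>\<^sub>v (A *\<^sub>v y)"
        using A x y by (simp add: mult_add_distrib_mat_vec mult_mat_vec)
      moreover have "x \<bullet> (A *\<^sub>v y) = y \<bullet> (A *\<^sub>v x)"
        using symm[OF x(1) y] comm_scalar_prod[OF Ax y] by simp
      ultimately show ?thesis using x y Ax Ay
        by (simp add: scalar_prod_add_distrib[of _ n] add_scalar_prod_distrib[of _ n] c_def power2_eq_square algebra_simps)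
    qed
    moreover have "(x + t \<cdot>\<^sub>v y) \<bullet> (x + t \<cdot>\<^sub>v y) = 1 + 2 * t * (y \<bullet> x) + t\<^sup>2 * (y \<bullet> y)"
      using x y comm_scalar_prod[OF x(1) y]
      by (simp add: scalar_prod_add_distrib[of _ n] add_scalar_prod_distrib[of _ n] power2_eq_square algebra_simps)
    ultimately show ?thesis by (simp add: b_def yy[symmetric] algebra_simps)
  qed
  have "y \<bullet> y = 0"
  proof (rule ccontr)
    assume "y \<bullet> y \<noteq> 0"
    then have pos: "0 < y \<bullet> y" using scalar_prod_self_nonneg[of y] by simp
    \<comment> \<open>Small enough that b t is at most |y|^2, contradicting the factor 2 in the
      linear term.\<close>
    define t where "t = (y \<bullet> y) / (\<bar>b\<bar> + 1)"
    have t: "0 < t" using pos by (simp add: t_def)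
    have "2 * (y \<bullet> y) * t \<le> (b * t) * t" using quad[of t] by (simp add: power2_eq_square)
    then have "2 * (y \<bullet> y) \<le> b * t" using t by (simp only: mult_le_cancel_right)
    also have "\<dots> \<le> (\<bar>b\<bar> + 1) * t" using t by (intro mult_right_mono) auto
    also have "\<dots> = y \<bullet> y" by (simp add: t_def)
    finally show False using pos by simp
  qed
  then have "vnorm y = 0" by (simp add: vnorm_def)
  then have "y = 0\<^sub>v n" using vnorm_eq_0_iff[OF y] by simp
  then have "(A *\<^sub>v x) $ i - c * x $ i = 0" if "i < n" for i
    using that Ax x(1) unfolding y_def by (metis carrier_vecD index_minus_vec(1) index_smult_vec index_zero_vec(1) smult_carrier_vec)
  then show ?thesis using Ax x(1) A(1) unfolding c_def[symmetric] by (intro eq_vecI) auto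
qed

text \<open>Greedy deflation: the next eigenvector maximises the quadratic form on the complement of
  the previous ones. The maximality clause is kept because it later provides the upper half of
  Courant-Fischer.\<close>

lemma ex_orthonormal_eigenvectors:
  fixes A :: "real mat"
  assumes A: "A \<in> carrier_mat n n" "transpose_mat A = A" and "k \<le> n"
  shows "\<exists>z d. \<forall>i<k. z i \<in> carrier_vec n \<and> z i \<bullet> z i = 1 \<and> A *\<^sub>v z i = d i \<cdot>\<^sub>v z i \<and> (\<forall>j<i. z j \<bullet> z i = 0) \<and>
    (\<forall>y\<in>carrier_vec n. (\<forall>j<i. z j \<bullet> y = 0) \<longrightarrow> y \<bullet> (A *\<^sub>v y) \<le> d i * (y \<bullet> y))"
  using assms(3)
proof (induction k)
  case (Suc k)
  then obtain z d where zd: "\<forall>i<k. z i \<in> carrier_vec n \<and> z i \<bullet> z i = 1 \<and> A *\<^sub>v z i = d i \<cdot>\<^sub>v z i \<and> (\<forall>j<i. z j \<bullet> z i = 0) \<and>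
    (\<forall>y\<in>carrier_vec n. (\<forall>j<i. z j \<bullet> y = 0) \<longrightarrow> y \<bullet> (A *\<^sub>v y) \<le> d i * (y \<bullet> y))" by auto
  obtain x where x: "x \<in> carrier_vec n" "x \<bullet> x = 1" "\<forall>j<k. z j \<bullet> x = 0"
     "\<forall>y\<in>carrier_vec n. (\<forall>j<k. z j \<bullet> y = 0) \<longrightarrow> y \<bullet> (A *\<^sub>v y) \<le> (x \<bullet> (A *\<^sub>v x)) * (y \<bullet> y)"
    using ex_max_quadratic_form[OF A(1), of k z] zd Suc.prems by auto
  have "A *\<^sub>v x = (x \<bullet> (A *\<^sub>v x)) \<cdot>\<^sub>v x"
    by (rule eigenvector_of_max_quadratic_form[OF A, of k z d]) (use zd x in auto)
  then show ?case using zd x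
    by (intro exI[of _ "z(k := x)"] exI[of _ "d(k := x \<bullet> (A *\<^sub>v x))"]) (auto simp: less_Suc_eq)
qed auto

lemma mat_eq_colsI:
  assumes "A \<in> carrier_mat n k" "B \<in> carrier_mat n k" "\<And>j. j < k \<Longrightarrow> col A j = col B j"
  shows "A = B"
  using assms by (intro mat_col_eqI) auto

text \<open>The last conjunct ties the greedy eigenvalues, with multiplicity, to the roots of the
  characteristic polynomial, through which \<open>sing_vals\<close> is defined.\<close>

lemma spectral_theorem_sorted:
  fixes A :: "real mat"
  assumes A: "A \<in> carrier_mat n n" "transpose_mat A = A"
  shows "\<exists>z d. (\<forall>i<n. z i \<in> carrier_vec n) \<and>
    (\<forall>i<n. \<forall>j<n. z i \<bullet> z j = (if i = j then 1 else 0)) \<and>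
    (\<forall>i<n. A *\<^sub>v z i = d i \<cdot>\<^sub>v z i) \<and>
    (\<forall>j<n. \<forall>i\<le>j. d j \<le> d i) \<and>
    (\<forall>i<n. \<forall>y\<in>carrier_vec n. (\<forall>j<i. z j \<bullet> y = 0) \<longrightarrow> y \<bullet> (A *\<^sub>v y) \<le> d i * (y \<bullet> y)) \<and>
    proots (char_poly A) = mset (map d [0..<n])"
proof -
  obtain z d where zd: "\<forall>i<n. z i \<in> carrier_vec n \<and> z i \<bullet> z i = 1 \<and> A *\<^sub>v z i = d i \<cdot>\<^sub>v z i \<and> (\<forall>j<i. z j \<bullet> z i = 0) \<and>
    (\<forall>y\<in>carrier_vec n. (\<forall>j<i. z j \<bullet> y = 0) \<longrightarrow> y \<bullet> (A *\<^sub>v y) \<le> d i * (y \<bullet> y))"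
    using ex_orthonormal_eigenvectors[OF A order_refl] by auto
  have on: "z i \<bullet> z j = (if i = j then 1 else 0)" if "i < n" "j < n" for i j
    using zd that comm_scalar_prod[of "z i" n "z j"] by (cases i j rule: linorder_cases) auto
  have dec: "d j \<le> d i" if "i \<le> j" "j < n" for i j
  proof -
    have zj: "z j \<in> carrier_vec n" "z j \<bullet> z j = 1" "A *\<^sub>v z j = d j \<cdot>\<^sub>v z j" and zi: "\<forall>m<i. z m \<bullet> z j = 0"
      using zd that by auto
    have "z j \<bullet> (A *\<^sub>v z j) \<le> d i * (z j \<bullet> z j)" using zd that zj(1) zi by (meson le_less_trans)
    then show ?thesis using zj by simp
  qed
  define Z where "Z = mat n n (\<lambda>(i,j). z j $ i)"
  define D where "D = mat n n (\<lambda>(i,j). if i = j then d j else 0)"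
  have Z: "Z \<in> carrier_mat n n" and D: "D \<in> carrier_mat n n" by (auto simp: Z_def D_def)
  have col: "col Z j = z j" if "j < n" for j using zd that by (intro eq_vecI) (auto simp: Z_def)
  have "transpose_mat Z * Z = 1\<^sub>m n"
    by (rule eq_matI) (use Z on col in \<open>auto simp: \<close>)
  then have ZZ: "Z * transpose_mat Z = 1\<^sub>m n"
    by (rule mat_mult_left_right_inverse[rotated -1]) (use Z in auto)
  have AZ: "A * Z = Z * D"
  proof (rule mat_eq_colsI[of _ n n])
    fix j assume j: "j < n"
    have "col D j = d j \<cdot>\<^sub>v unit_vec n j" using j by (auto simp: D_def unit_vec_def)
    then have "col (Z * D) j = d j \<cdot>\<^sub>v (Z *\<^sub>v unit_vec n j)"
      using col_mult2[OF Z D j] mult_mat_vec[OF Z, of "unit_vec n j"] by simp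
    also have "Z *\<^sub>v unit_vec n j = z j" using Z j by (simp add: col[OF j, symmetric], intro eq_vecI) auto
    finally show "col (A * Z) j = col (Z * D) j" using zd j col col_mult2[OF A(1) Z j] by simp
  qed (use A Z D in auto)
  have "A = Z * D * transpose_mat Z"
    using AZ ZZ A Z by (metis assoc_mult_mat right_mult_one_mat transpose_carrier_mat)
  then have "similar_mat_wit A D Z (transpose_mat Z)"
    using \<open>transpose_mat Z * Z = 1\<^sub>m n\<close> ZZ A Z D by (auto simp: similar_mat_wit_def Let_def)
  then have "char_poly A = char_poly D" by (intro char_poly_similar) (auto simp: similar_mat_def)
  also have "\<dots> = (\<Prod>a\<leftarrow>diag_mat D. [:- a, 1:])"
    by (rule char_poly_upper_triangular[OF D]) (auto simp: D_def upper_triangular_def)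
  also have "diag_mat D = map d [0..<n]" by (auto simp: diag_mat_def D_def)
  finally have cp: "char_poly A = (\<Prod>a\<leftarrow>map d [0..<n]. [:- a, 1:])" .
  have "proots (\<Prod>a\<leftarrow>xs. [:- a, 1:]) = mset xs" for xs :: "real list"
  proof (induction xs)
    case (Cons a xs)
    have "proots ([:- a, 1:] * (\<Prod>a\<leftarrow>xs. [:- a, 1:])) = proots [:- a, 1:] + proots (\<Prod>a\<leftarrow>xs. [:- a, 1:])"
      by (rule proots_mult) (auto simp: prod_list_zero_iff)
    then show ?case by (simp only: list.map prod_list.Cons Cons proots_linear_factor) simp
  qed simp
  then have "proots (char_poly A) = mset (map d [0..<n])" unfolding cp .
  then show ?thesis using zd on dec by (intro exI[of _ z] exI[of _ d]) simp
qed

section \<open>Courant-Fischer bounds, Weyl's inequality and uniqueness of the leading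
  subspace\<close>

lemma parseval:
  fixes z :: "nat \<Rightarrow> real vec"
  assumes z: "\<And>i. i < n \<Longrightarrow> z i \<in> carrier_vec n"
    and on: "\<And>i j. i < n \<Longrightarrow> j < n \<Longrightarrow> z i \<bullet> z j = (if i = j then 1 else 0)"
    and xy: "x \<in> carrier_vec n" "y \<in> carrier_vec n"
  shows "x \<bullet> y = (\<Sum>j<n. (z j \<bullet> x) * (z j \<bullet> y))"
proof -
  define Z where "Z = mat n n (\<lambda>(i,j). z j $ i)"
  have Z: "Z \<in> carrier_mat n n" by (simp add: Z_def)
  have col: "col Z j = z j" if "j < n" for j using z[OF that] that by (intro eq_vecI) (auto simp: Z_def)
  have "transpose_mat Z * Z = 1\<^sub>m n" by (rule eq_matI) (use Z on col in auto)
  then have ZZ: "Z * transpose_mat Z = 1\<^sub>m n"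
    by (rule mat_mult_left_right_inverse[rotated -1]) (use Z in auto)
  have ent: "(transpose_mat Z *\<^sub>v v) $ j = z j \<bullet> v" if "v \<in> carrier_vec n" "j < n" for v j
    using that Z col by simp
  have "x \<bullet> y = x \<bullet> ((Z * transpose_mat Z) *\<^sub>v y)" using ZZ xy by simp
  also have "\<dots> = x \<bullet> (Z *\<^sub>v (transpose_mat Z *\<^sub>v y))" using Z xy by (simp add: assoc_mult_mat_vec[of _ n n _ n])
  also have "\<dots> = (transpose_mat Z *\<^sub>v x) \<bullet> (transpose_mat Z *\<^sub>v y)"
    using transpose_vec_mult_scalar[OF Z, of "transpose_mat Z *\<^sub>v y" x] Z xy by simp
  also have "\<dots> = (\<Sum>j<n. (z j \<bullet> x) * (z j \<bullet> y))"
    unfolding scalar_prod_def[of "transpose_mat Z *\<^sub>v x"] using Z xy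
    by (simp add: ent lessThan_atLeast0 del: index_mult_mat_vec)
  finally show ?thesis .
qed

lemma gram_quadratic_form:
  fixes A :: "real mat"
  assumes "A \<in> carrier_mat n m" "y \<in> carrier_vec n"
  shows "y \<bullet> ((A * transpose_mat A) *\<^sub>v y) = (vnorm (transpose_mat A *\<^sub>v y))\<^sup>2"
proof -
  have "y \<bullet> ((A * transpose_mat A) *\<^sub>v y) = y \<bullet> (A *\<^sub>v (transpose_mat A *\<^sub>v y))"
    using assms by (simp add: assoc_mult_mat_vec[of _ n m _ n])
  also have "\<dots> = (transpose_mat A *\<^sub>v y) \<bullet> (transpose_mat A *\<^sub>v y)"
    using transpose_vec_mult_scalar[OF assms(1), of "transpose_mat A *\<^sub>v y" y] assms by simp
  finally show ?thesis by (simp add: vnorm_power2)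
qed

text \<open>\<open>z\<close> is a full orthonormal eigenbasis of \<open>A * transpose_mat A\<close>,
  including indices beyond \<open>min n m\<close>, and \<open>d\<close> holds the squared singular
  values. The last two clauses are the two halves of Courant-Fischer. \<open>z\<close> and
  \<open>d\<close> count from 0, \<open>sing_val\<close> from 1.\<close>

definition left_svd :: "nat \<Rightarrow> nat \<Rightarrow> real mat \<Rightarrow> (nat \<Rightarrow> real vec) \<Rightarrow> (nat \<Rightarrow> real) \<Rightarrow> bool" where
  "left_svd n m A z d \<longleftrightarrow>
    (\<forall>i<n. z i \<in> carrier_vec n) \<and>
    (\<forall>i<n. \<forall>j<n. z i \<bullet> z j = (if i = j then 1 else 0)) \<and>
    (\<forall>i<n. (A * transpose_mat A) *\<^sub>v z i = d i \<cdot>\<^sub>v z i) \<and>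
    (\<forall>j<n. \<forall>i\<le>j. d j \<le> d i) \<and> (\<forall>i<n. 0 \<le> d i) \<and>
    (\<forall>i<min n m. sing_val A (i + 1) = sqrt (d i)) \<and>
    (\<forall>i<min n m. \<forall>y\<in>carrier_vec n. (\<forall>j<i. z j \<bullet> y = 0) \<longrightarrow>
       vnorm (transpose_mat A *\<^sub>v y) \<le> sing_val A (i + 1) * vnorm y) \<and>
    (\<forall>i<min n m. \<forall>y\<in>carrier_vec n. (\<forall>j<n. i < j \<longrightarrow> z j \<bullet> y = 0) \<longrightarrow>
       sing_val A (i + 1) * vnorm y \<le> vnorm (transpose_mat A *\<^sub>v y))"

lemma left_svdD:
  assumes "left_svd n m A z d"
  shows "\<And>i. i < n \<Longrightarrow> z i \<in> carrier_vec n"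
    "\<And>i j. i < n \<Longrightarrow> j < n \<Longrightarrow> z i \<bullet> z j = (if i = j then 1 else 0)"
    "\<And>i. i < n \<Longrightarrow> (A * transpose_mat A) *\<^sub>v z i = d i \<cdot>\<^sub>v z i"
    "\<And>i j. i \<le> j \<Longrightarrow> j < n \<Longrightarrow> d j \<le> d i" "\<And>i. i < n \<Longrightarrow> 0 \<le> d i"
    "\<And>i. i < min n m \<Longrightarrow> sing_val A (i + 1) = sqrt (d i)"
  using assms unfolding left_svd_def by simp_all

lemma left_svd_upper:
  assumes "left_svd n m A z d" "i < min n m" "y \<in> carrier_vec n" "\<And>j. j < i \<Longrightarrow> z j \<bullet> y = 0"
  shows "vnorm (transpose_mat A *\<^sub>v y) \<le> sing_val A (i + 1) * vnorm y"
  by (rule assms(1)[unfolded left_svd_def, THEN conjunct2, THEN conjunct2, THEN conjunct2, THEN conjunct2, THEN conjunct2, THEN conjunct2, THEN conjunct1, rule_format])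
    (use assms(2-4) in simp_all)

lemma left_svd_lower:
  assumes "left_svd n m A z d" "i < min n m" "y \<in> carrier_vec n" "\<And>j. i < j \<Longrightarrow> j < n \<Longrightarrow> z j \<bullet> y = 0"
  shows "sing_val A (i + 1) * vnorm y \<le> vnorm (transpose_mat A *\<^sub>v y)"
  by (rule assms(1)[unfolded left_svd_def, THEN conjunct2, THEN conjunct2, THEN conjunct2, THEN conjunct2, THEN conjunct2, THEN conjunct2, THEN conjunct2, rule_format])
    (use assms(2-4) in simp_all)

lemma ex_left_svd:
  fixes A :: "real mat"
  assumes A: "A \<in> carrier_mat n m"
  shows "\<exists>z d. left_svd n m A z d"
proof -
  let ?G = "A * transpose_mat A"
  have G: "?G \<in> carrier_mat n n" using A by simp
  have symm: "transpose_mat ?G = ?G" using A by (simp add: transpose_mult[of _ n m _ n])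
  obtain z d where zd: "\<forall>i<n. z i \<in> carrier_vec n"
    "\<forall>i<n. \<forall>j<n. z i \<bullet> z j = (if i = j then 1 else 0)"
    "\<forall>i<n. ?G *\<^sub>v z i = d i \<cdot>\<^sub>v z i" "\<forall>j<n. \<forall>i\<le>j. d j \<le> d i"
    "\<forall>i<n. \<forall>y\<in>carrier_vec n. (\<forall>j<i. z j \<bullet> y = 0) \<longrightarrow> y \<bullet> (?G *\<^sub>v y) \<le> d i * (y \<bullet> y)"
    "proots (char_poly ?G) = mset (map d [0..<n])"
    using spectral_theorem_sorted[OF G symm] by (auto intro: that)
  have zd': "\<And>i. i < n \<Longrightarrow> z i \<in> carrier_vec n"
    "\<And>i j. i < n \<Longrightarrow> j < n \<Longrightarrow> z i \<bullet> z j = (if i = j then 1 else 0)"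
    "\<And>i. i < n \<Longrightarrow> ?G *\<^sub>v z i = d i \<cdot>\<^sub>v z i" "\<And>i j. i \<le> j \<Longrightarrow> j < n \<Longrightarrow> d j \<le> d i"
    using zd(1-4) by blast+
  have d0: "0 \<le> d i" if "i < n" for i
  proof -
    have "z i \<bullet> (?G *\<^sub>v z i) = d i" using zd'(1-3)[OF that] zd'(2)[OF that that] by simp
    then show ?thesis using gram_quadratic_form[OF A zd'(1)[OF that]] by (metis zero_le_power2)
  qed
  \<comment> \<open>\<open>d\<close> is already decreasing, so reversing the ascending list of roots
    in \<open>sing_vals\<close> gives back \<open>d\<close> itself.\<close>
  have "sort (map d [0..<n]) = rev (map d [0..<n])"
  proof (rule properties_for_sort)
    show "sorted (rev (map d [0..<n]))"
      unfolding sorted_rev_iff_nth_mono using zd'(4) by auto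
  qed simp
  then have sl: "sing_vals A = map sqrt (take (min n m) (map d [0..<n]))"
    unfolding sing_vals_def zd(6) sorted_list_of_multiset_mset \<open>sort _ = _\<close> using A by simp
  have sv: "sing_val A (i + 1) = sqrt (d i)" if "i < min n m" for i
    using that by (simp add: sing_val_def sl)
  have up: "vnorm (transpose_mat A *\<^sub>v y) \<le> sing_val A (i + 1) * vnorm y"
    if i: "i < min n m" and y: "y \<in> carrier_vec n" "\<And>j. j < i \<Longrightarrow> z j \<bullet> y = 0" for i y
  proof -
    have "(vnorm (transpose_mat A *\<^sub>v y))\<^sup>2 \<le> d i * (vnorm y)\<^sup>2"
      using zd(5)[rule_format, of i y] i y gram_quadratic_form[OF A y(1)] by (simp add: vnorm_power2)
    also have "\<dots> = (sing_val A (i + 1) * vnorm y)\<^sup>2" using sv[OF i] d0[of i] i by (simp add: power_mult_distrib)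
    finally show ?thesis by (rule power2_le_imp_le) (use sv[OF i] d0[of i] i in auto)
  qed
  \<comment> \<open>In the eigenbasis y has components only along \<open>z j\<close> with j at most
    i, and each of these has eigenvalue at least \<open>d i\<close>.\<close>
  have lo: "sing_val A (i + 1) * vnorm y \<le> vnorm (transpose_mat A *\<^sub>v y)"
    if i: "i < min n m" and y: "y \<in> carrier_vec n" "\<And>j. i < j \<Longrightarrow> j < n \<Longrightarrow> z j \<bullet> y = 0" for i y
  proof -
    have pv: "u \<bullet> v = (\<Sum>j<n. (z j \<bullet> u) * (z j \<bullet> v))" if "u \<in> carrier_vec n" "v \<in> carrier_vec n" for u v
      by (rule parseval) (use zd'(1,2) that in auto)
    have Gy: "z j \<bullet> (?G *\<^sub>v y) = d j * (z j \<bullet> y)" if j: "j < n" for j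
      using transpose_vec_mult_scalar[OF G y(1) zd'(1)[OF j]] symm zd'(3)[OF j] zd'(1)[OF j] y(1) by simp
    have "d i * (y \<bullet> y) = (\<Sum>j<n. d i * ((z j \<bullet> y) * (z j \<bullet> y)))"
      unfolding pv[OF y(1) y(1)] sum_distrib_left by simp
    also have "\<dots> \<le> (\<Sum>j<n. (z j \<bullet> y) * (z j \<bullet> (?G *\<^sub>v y)))"
    proof (rule sum_mono)
      fix j assume "j \<in> {..<n}"
      then have j: "j < n" by simp
      show "d i * ((z j \<bullet> y) * (z j \<bullet> y)) \<le> (z j \<bullet> y) * (z j \<bullet> (?G *\<^sub>v y))"
      proof (cases "j \<le> i")
        case True
        then have "d i * ((z j \<bullet> y) * (z j \<bullet> y)) \<le> d j * ((z j \<bullet> y) * (z j \<bullet> y))"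
          using zd'(4)[of j i] i by (intro mult_right_mono) auto
        then show ?thesis unfolding Gy[OF j] by (simp add: ac_simps)
      next
        case False
        then show ?thesis using y(2)[of j] j by simp
      qed
    qed
    also have "\<dots> = y \<bullet> (?G *\<^sub>v y)"
      by (rule pv[symmetric]) (use y G in auto)
    finally have "(sing_val A (i + 1) * vnorm y)\<^sup>2 \<le> (vnorm (transpose_mat A *\<^sub>v y))\<^sup>2"
      using sv[OF i] d0[of i] i gram_quadratic_form[OF A y(1)] by (simp add: power_mult_distrib vnorm_power2)
    then show ?thesis by (rule power2_le_imp_le) simp
  qed
  have "left_svd n m A z d"
    unfolding left_svd_def using zd(1-4) d0 sv up lo by simp
  then show ?thesis by blast
qed

lemma sing_val_decreasing:
  assumes "A \<in> carrier_mat n m" "i \<le> j" "j < min n m"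
  shows "sing_val A (j + 1) \<le> sing_val A (i + 1)" "0 \<le> sing_val A (j + 1)"
proof -
  obtain z d where "left_svd n m A z d" using ex_left_svd[OF assms(1)] by blast
  note d = left_svdD(4-6)[OF this]
  show "sing_val A (j + 1) \<le> sing_val A (i + 1)" "0 \<le> sing_val A (j + 1)"
    using assms(2,3) d(1)[of i j] d(2)[of j] d(3)[of i] d(3)[of j] by auto
qed

text \<open>Weyl's inequality. A single unit vector is found on which A is at least as large as its
  own singular value and B at most as large as its own, and the two are compared there.\<close>

lemma sing_val_perturbation:
  assumes A: "A \<in> carrier_mat n m" and B: "B \<in> carrier_mat n m" and i: "i < min n m"
    and e: "\<And>x. x \<in> carrier_vec n \<Longrightarrow> vnorm (transpose_mat A *\<^sub>v x - transpose_mat B *\<^sub>v x) \<le> e * vnorm x"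
  shows "sing_val A (i + 1) \<le> sing_val B (i + 1) + e"
proof -
  obtain z d where "left_svd n m A z d" using ex_left_svd[OF A] by blast
  note z = left_svdD(1)[OF this] left_svd_lower[OF this]
  obtain w d' where "left_svd n m B w d'" using ex_left_svd[OF B] by blast
  note w = left_svdD(1)[OF this] left_svd_upper[OF this]
  \<comment> \<open>The i leading vectors of B together with the n - 1 - i trailing vectors of A are
    n - 1 conditions, one fewer than the dimension.\<close>
  define v where "v j = (if j < i then w j else z (j + 1))" for j
  have "\<exists>x\<in>carrier_vec n. x \<bullet> x = 1 \<and> (\<forall>j<n-1. v j \<bullet> x = 0)"
    by (rule ex_orthogonal_vec) (use z(1) w(1) i in \<open>auto simp: v_def\<close>)
  then obtain x where x: "x \<in> carrier_vec n" "x \<bullet> x = 1" "\<forall>j<n-1. v j \<bullet> x = 0" by blast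
  have nx: "vnorm x = 1" using x(2) by (simp add: vnorm_def)
  have wx: "w j \<bullet> x = 0" if "j < i" for j
  proof -
    have "v j = w j" "j < n - 1" using that i by (auto simp: v_def)
    then show ?thesis using x(3) by metis
  qed
  have zx: "z j \<bullet> x = 0" if "i < j" "j < n" for j
  proof -
    have "v (j - 1) = z j" "j - 1 < n - 1" using that by (auto simp: v_def)
    then show ?thesis using x(3) by metis
  qed
  have 1: "sing_val A (i + 1) * vnorm x \<le> vnorm (transpose_mat A *\<^sub>v x)"
    by (rule z(2)[OF i x(1)]) (rule zx)
  have 2: "vnorm (transpose_mat B *\<^sub>v x) \<le> sing_val B (i + 1) * vnorm x"
    by (rule w(2)[OF i x(1)]) (rule wx)
  have d: "dim_vec (transpose_mat A *\<^sub>v x - transpose_mat B *\<^sub>v x) = dim_vec (transpose_mat B *\<^sub>v x)" by simp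
  have "(transpose_mat A *\<^sub>v x - transpose_mat B *\<^sub>v x) + transpose_mat B *\<^sub>v x = transpose_mat A *\<^sub>v x"
    using A B by (intro eq_vecI) auto
  then have "vnorm (transpose_mat A *\<^sub>v x) \<le> vnorm (transpose_mat A *\<^sub>v x - transpose_mat B *\<^sub>v x) + vnorm (transpose_mat B *\<^sub>v x)"
    using vnorm_add_le[OF d] by simp
  then show ?thesis using 1 2 e[OF x(1)] unfolding nx by linarith
qed

text \<open>The definition of \<open>leading_left_sing_vecs\<close> leaves the choice of basis open.
  Under the gap any admissible \<open>U\<close> spans the same space as the first r eigenvectors, so
  its complement is theirs and the Courant-Fischer upper bound applies.\<close>

lemma leading_left_sing_vecs_complement:
  assumes B: "B \<in> carrier_mat n m" and r: "1 \<le> r" "r < min n m"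
    and gap: "sing_val B (r + 1) < sing_val B r" and U: "leading_left_sing_vecs B r U"
    and x: "x \<in> carrier_vec n" "transpose_mat U *\<^sub>v x = 0\<^sub>v r"
  shows "vnorm (transpose_mat B *\<^sub>v x) \<le> sing_val B (r + 1) * vnorm x"
proof -
  let ?S = "mat r r (\<lambda>(i,j). if i = j then sing_val B (i + 1) else 0)"
  let ?G = "B * transpose_mat B"
  obtain V where V: "V \<in> carrier_mat m r" and UO: "U \<in> carrier_mat n r" "transpose_mat U * U = 1\<^sub>m r"
    and BV: "B * V = U * ?S" and BU: "transpose_mat B * U = V * ?S"
    using U B by (auto simp: leading_left_sing_vecs_def orthonormal_cols_def)
  obtain z d where svd: "left_svd n m B z d" using ex_left_svd[OF B] by blast
  note z = left_svdD(1-3)[OF svd] and d = left_svdD(4-6)[OF svd] and up = left_svd_upper[OF svd]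
  have G: "?G \<in> carrier_mat n n" "transpose_mat ?G = ?G" using B by (simp_all add: transpose_mult[of _ n m _ n])
  have u: "col U k \<in> carrier_vec n" if "k < r" for k using UO(1) by auto
  have colS: "col (M * ?S) k = sing_val B (k + 1) \<cdot>\<^sub>v col M k" if M: "M \<in> carrier_mat q r" and k: "k < r" for M q k
    using M k by (intro eq_vecI) (auto simp: scalar_prod_def if_distrib[where f = "\<lambda>t. _ * t"] sum.delta cong: if_cong)
  have Gu: "?G *\<^sub>v col U k = d k \<cdot>\<^sub>v col U k" if k: "k < r" for k
  proof -
    have 1: "?G *\<^sub>v col U k = B *\<^sub>v (transpose_mat B *\<^sub>v col U k)"
      using B u[OF k] by (simp add: assoc_mult_mat_vec[of _ n m _ n])
    have 2: "transpose_mat B *\<^sub>v col U k = col (V * ?S) k"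
      unfolding BU[symmetric] by (rule col_mult2[symmetric]) (use B UO(1) k in auto)
    have 3: "B *\<^sub>v (sing_val B (k + 1) \<cdot>\<^sub>v col V k) = sing_val B (k + 1) \<cdot>\<^sub>v (B *\<^sub>v col V k)"
      using B V by (intro mult_mat_vec) auto
    have 4: "B *\<^sub>v col V k = col (U * ?S) k"
      unfolding BV[symmetric] by (rule col_mult2[symmetric]) (use B V k in auto)
    have 5: "sing_val B (k + 1) * sing_val B (k + 1) = d k"
      using d(2)[of k] d(3)[of k] k r by simp
    show ?thesis unfolding 1 2 colS[OF V k] 3 4 colS[OF UO(1) k] smult_smult_assoc 5 ..
  qed
  have "r - 1 < min n m" using r by auto
  from d(3)[OF this] have "sing_val B r = sqrt (d (r - 1))" using r by simp
  then have gapd: "d r < d (r - 1)" using gap d(3)[of r] r by simp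
  have pv: "u \<bullet> v = (\<Sum>j<n. (z j \<bullet> u) * (z j \<bullet> v))" if "u \<in> carrier_vec n" "v \<in> carrier_vec n" for u v
    by (rule parseval) (use z(1,2) that in auto)
  \<comment> \<open>Eigenvectors of a symmetric matrix for different eigenvalues are orthogonal; the
    gap separates \<open>d j\<close> with j at least r from \<open>d k\<close> with k below
    r.\<close>
  have zu: "z j \<bullet> col U k = 0" if j: "r \<le> j" "j < n" and k: "k < r" for j k
  proof -
    have "d j * (z j \<bullet> col U k) = (?G *\<^sub>v z j) \<bullet> col U k"
      using smult_scalar_prod_distrib[OF z(1)[OF j(2)] u[OF k]] by (simp only: z(3)[OF j(2)])
    also have "\<dots> = z j \<bullet> (?G *\<^sub>v col U k)"
      using transpose_vec_mult_scalar[OF G(1) u[OF k] z(1)[OF j(2)]] G(2) by simp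
    also have "\<dots> = d k * (z j \<bullet> col U k)" using Gu[OF k] z(1)[OF j(2)] u[OF k] by simp
    finally have "(d k - d j) * (z j \<bullet> col U k) = 0" by (simp only: left_diff_distrib)
    moreover have "d j < d k" using gapd d(1)[of r j] d(1)[of k "r - 1"] j k r by linarith
    ultimately show ?thesis by simp
  qed
  \<comment> \<open>Coefficients of the columns of \<open>U\<close> in the eigenbasis. Those of
    index r and above vanish, so this square block inherits orthonormal columns, and being square it
    is invertible: a vector orthogonal to \<open>U\<close> has no component along the first r
    eigenvectors.\<close>
  define C where "C = mat r r (\<lambda>(j,k). z j \<bullet> col U k)"
  have C: "C \<in> carrier_mat r r" by (simp add: C_def)
  have trunc: "(\<Sum>j<n. (z j \<bullet> col U k) * c j) = (\<Sum>j<r. (z j \<bullet> col U k) * c j)" if "k < r" for k c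
    using r zu[OF _ _ that] by (intro sum.mono_neutral_right) auto
  have "transpose_mat C * C = 1\<^sub>m r"
  proof (rule eq_matI)
    fix k l assume "k < dim_row (1\<^sub>m r)" "l < dim_col (1\<^sub>m r)"
    then have kl: "k < r" "l < r" by auto
    have "(transpose_mat C * C) $$ (k,l) = (\<Sum>j=0..<r. C $$ (j,k) * C $$ (j,l))"
      using kl C by (simp add: scalar_prod_def)
    then have 1: "(transpose_mat C * C) $$ (k,l) = (\<Sum>j<r. (z j \<bullet> col U k) * (z j \<bullet> col U l))"
      using kl by (simp add: C_def lessThan_atLeast0)
    have 2: "(\<Sum>j<r. (z j \<bullet> col U k) * (z j \<bullet> col U l)) = col U k \<bullet> col U l"
      using trunc[OF kl(1), of "\<lambda>j. z j \<bullet> col U l"] pv[OF u[OF kl(1)] u[OF kl(2)]] by metis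
    have 3: "col U k \<bullet> col U l = (transpose_mat U * U) $$ (k,l)" using kl UO(1) by simp
    show "(transpose_mat C * C) $$ (k,l) = 1\<^sub>m r $$ (k,l)" by (simp only: 1 2 3 UO(2))
  qed (use C in auto)
  then have CC: "C * transpose_mat C = 1\<^sub>m r"
    by (rule mat_mult_left_right_inverse[rotated -1]) (use C in auto)
  define c where "c = vec r (\<lambda>j. z j \<bullet> x)"
  have c: "c \<in> carrier_vec r" by (simp add: c_def)
  have C0: "transpose_mat C *\<^sub>v c = 0\<^sub>v r"
  proof (rule eq_vecI)
    fix k assume "k < dim_vec (0\<^sub>v r)"
    then have k: "k < r" by simp
    have "(transpose_mat C *\<^sub>v c) $ k = (\<Sum>j=0..<r. C $$ (j,k) * c $ j)"
      using k C c by (simp add: scalar_prod_def)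
    then have 1: "(transpose_mat C *\<^sub>v c) $ k = (\<Sum>j<r. (z j \<bullet> col U k) * (z j \<bullet> x))"
      using k by (simp add: C_def c_def lessThan_atLeast0)
    have 2: "(\<Sum>j<r. (z j \<bullet> col U k) * (z j \<bullet> x)) = col U k \<bullet> x"
      using trunc[OF k, of "\<lambda>j. z j \<bullet> x"] pv[OF u[OF k] x(1)] by metis
    have 3: "col U k \<bullet> x = (transpose_mat U *\<^sub>v x) $ k" using k UO(1) by simp
    show "(transpose_mat C *\<^sub>v c) $ k = 0\<^sub>v r $ k" by (simp only: 1 2 3 x(2))
  qed (use C in auto)
  have "c = 0\<^sub>v r"
  proof -
    have 1: "c = (C * transpose_mat C) *\<^sub>v c" using CC c by simp
    have 2: "(C * transpose_mat C) *\<^sub>v c = C *\<^sub>v (transpose_mat C *\<^sub>v c)"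
      by (rule assoc_mult_mat_vec) (use C c in auto)
    have 3: "C *\<^sub>v 0\<^sub>v r = 0\<^sub>v r" using C by (intro eq_vecI) auto
    show ?thesis by (rule trans[OF 1 2[unfolded C0 3]])
  qed
  then have "z j \<bullet> x = 0" if "j < r" for j using that unfolding c_def by (metis index_vec index_zero_vec(1))
  then show ?thesis using up[of r x] r x(1) by simp
qed

subsection \<open>Perturbation of singular subspaces\<close>

definition proj :: "real mat \<Rightarrow> real vec \<Rightarrow> real vec" where
  "proj U x = U *\<^sub>v (transpose_mat U *\<^sub>v x)"

definition proj_compl :: "real mat \<Rightarrow> real vec \<Rightarrow> real vec" where
  "proj_compl U x = x - proj U x"

lemma orthonormal_colsD:
  assumes "orthonormal_cols n r U"
  shows "U \<in> carrier_mat n r" "transpose_mat U \<in> carrier_mat r n" "transpose_mat U * U = 1\<^sub>m r"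
  using assms by (auto simp: orthonormal_cols_def)

lemma orthonormal_cols_transpose_mult:
  assumes U: "orthonormal_cols n r U" and z: "z \<in> carrier_vec r"
  shows "transpose_mat U *\<^sub>v (U *\<^sub>v z) = z"
  using assoc_mult_mat_vec[OF orthonormal_colsD(2,1)[OF U] z] orthonormal_colsD(3)[OF U] z by simp

lemma adjoint_scalar_prod:
  fixes A :: "real mat"
  assumes "A \<in> carrier_mat n m" "x \<in> carrier_vec m" "y \<in> carrier_vec n"
  shows "(A *\<^sub>v x) \<bullet> y = x \<bullet> (transpose_mat A *\<^sub>v y)"
  using transpose_vec_mult_scalar[of "transpose_mat A" m n y x] assms by simp

lemma vnorm_orthonormal_cols:
  assumes U: "orthonormal_cols n r U" and z: "z \<in> carrier_vec r"
  shows "vnorm (U *\<^sub>v z) = vnorm z"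
proof -
  have "(U *\<^sub>v z) \<bullet> (U *\<^sub>v z) = z \<bullet> (transpose_mat U *\<^sub>v (U *\<^sub>v z))"
    by (rule adjoint_scalar_prod[OF orthonormal_colsD(1)[OF U] z mult_mat_vec_carrier[OF orthonormal_colsD(1)[OF U] z]])
  then show ?thesis by (simp add: vnorm_def orthonormal_cols_transpose_mult[OF U z])
qed

lemma proj_carrier:
  assumes "orthonormal_cols n r U" "x \<in> carrier_vec n"
  shows "proj U x \<in> carrier_vec n" "proj_compl U x \<in> carrier_vec n" "transpose_mat U *\<^sub>v x \<in> carrier_vec r"
  using orthonormal_colsD(1)[OF assms(1)] assms(2) by (auto simp: proj_def proj_compl_def)

lemma transpose_mult_proj_compl:
  assumes U: "orthonormal_cols n r U" and x: "x \<in> carrier_vec n"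
  shows "transpose_mat U *\<^sub>v proj_compl U x = 0\<^sub>v r"
proof -
  have "transpose_mat U *\<^sub>v proj_compl U x = transpose_mat U *\<^sub>v x - transpose_mat U *\<^sub>v proj U x"
    unfolding proj_compl_def
    by (rule mult_minus_distrib_mat_vec[OF orthonormal_colsD(2)[OF U] x proj_carrier(1)[OF U x]])
  also have "transpose_mat U *\<^sub>v proj U x = transpose_mat U *\<^sub>v x"
    unfolding proj_def by (rule orthonormal_cols_transpose_mult[OF U proj_carrier(3)[OF U x]])
  finally show ?thesis using proj_carrier(3)[OF U x] by simp
qed

lemma proj_plus_compl:
  assumes U: "orthonormal_cols n r U" and x: "x \<in> carrier_vec n"
  shows "proj U x + proj_compl U x = x"
  using proj_carrier[OF U x] x by (intro eq_vecI) (auto simp: proj_compl_def)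

lemma proj_pythagoras:
  assumes U: "orthonormal_cols n r U" and x: "x \<in> carrier_vec n"
  shows "(vnorm x)\<^sup>2 = (vnorm (transpose_mat U *\<^sub>v x))\<^sup>2 + (vnorm (proj_compl U x))\<^sup>2"
proof -
  note c = proj_carrier[OF U x]
  have o: "proj U x \<bullet> proj_compl U x = 0"
    unfolding proj_def adjoint_scalar_prod[OF orthonormal_colsD(1)[OF U] c(3) c(2)] transpose_mult_proj_compl[OF U x]
    using c(3) by simp
  then have o': "proj_compl U x \<bullet> proj U x = 0" using comm_scalar_prod[OF c(1,2)] by simp
  have "x \<bullet> x = (proj U x + proj_compl U x) \<bullet> (proj U x + proj_compl U x)" by (simp only: proj_plus_compl[OF U x])
  also have "\<dots> = proj U x \<bullet> proj U x + proj_compl U x \<bullet> proj_compl U x"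
    using c o o' by (simp add: scalar_prod_add_distrib[of _ n] add_scalar_prod_distrib[of _ n])
  finally have "(vnorm x)\<^sup>2 = (vnorm (proj U x))\<^sup>2 + (vnorm (proj_compl U x))\<^sup>2" by (simp only: vnorm_power2)
  then show ?thesis unfolding proj_def vnorm_orthonormal_cols[OF U c(3)] .
qed

lemma proj_norm_le:
  assumes U: "orthonormal_cols n r U" and x: "x \<in> carrier_vec n"
  shows "vnorm (transpose_mat U *\<^sub>v x) \<le> vnorm x" "vnorm (proj_compl U x) \<le> vnorm x"
proof -
  show "vnorm (transpose_mat U *\<^sub>v x) \<le> vnorm x"
    by (rule power2_le_imp_le) (simp_all add: proj_pythagoras[OF assms])
  show "vnorm (proj_compl U x) \<le> vnorm x"
    by (rule power2_le_imp_le) (simp_all add: proj_pythagoras[OF assms])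
qed

lemma vnorm_vec_le_mono:
  assumes "x \<in> carrier_vec n" "y \<in> carrier_vec n" "\<And>i. i < n \<Longrightarrow> \<bar>x $ i\<bar> \<le> \<bar>y $ i\<bar>"
  shows "vnorm x \<le> vnorm y"
proof -
  have "(\<Sum>i=0..<n. (x $ i)\<^sup>2) \<le> (\<Sum>i=0..<n. (y $ i)\<^sup>2)"
    using assms(3) by (intro sum_mono) (simp add: abs_le_square_iff[symmetric])
  then show ?thesis using assms(1,2) by (simp add: vnorm_eq_L2_set L2_set_def)
qed

text \<open>Transposing one singular vector relation gives U'^T B' = S' V'^T, the other is B' V' =
  U' S'; both sides are then U' S' V'^T v.\<close>

lemma proj_intertwine:
  fixes B' :: "real mat"
  assumes U': "orthonormal_cols n r U'" and V': "orthonormal_cols m r V'" and B': "B' \<in> carrier_mat n m"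
    and BV': "B' * V' = U' * mat r r (\<lambda>(i,j). if i = j then s' i else 0)"
    and BU': "transpose_mat B' * U' = V' * mat r r (\<lambda>(i,j). if i = j then s' i else 0)"
    and v: "v \<in> carrier_vec m"
  shows "proj U' (B' *\<^sub>v v) = B' *\<^sub>v proj V' v"
proof -
  let ?S' = "mat r r (\<lambda>(i,j). if i = j then s' i else 0)"
  note Uc' = orthonormal_colsD(1)[OF U'] and Vc' = orthonormal_colsD(1)[OF V']
  have cv: "transpose_mat V' *\<^sub>v v \<in> carrier_vec r" by (rule proj_carrier(3)[OF V' v])
  have UB: "transpose_mat U' * B' = ?S' * transpose_mat V'"
  proof -
    have "transpose_mat U' * B' = transpose_mat (transpose_mat B' * U')"
      using B' Uc' by (simp add: transpose_mult[of _ m n _ r])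
    also have "\<dots> = transpose_mat ?S' * transpose_mat V'"
      unfolding BU' using Vc' by (simp add: transpose_mult[of _ m r _ r])
    also have "transpose_mat ?S' = ?S'" by (rule eq_matI) auto
    finally show ?thesis .
  qed
  show ?thesis
  proof -
    have "transpose_mat U' *\<^sub>v (B' *\<^sub>v v) = (transpose_mat U' * B') *\<^sub>v v"
      using assoc_mult_mat_vec[of "transpose_mat U'" r n B' m v] Uc' B' v by simp
    also have "\<dots> = ?S' *\<^sub>v (transpose_mat V' *\<^sub>v v)"
      unfolding UB using assoc_mult_mat_vec[of ?S' r r "transpose_mat V'" m v] Vc' v by simp
    finally have 3: "transpose_mat U' *\<^sub>v (B' *\<^sub>v v) = ?S' *\<^sub>v (transpose_mat V' *\<^sub>v v)" .
    have "U' *\<^sub>v (?S' *\<^sub>v (transpose_mat V' *\<^sub>v v)) = (U' * ?S') *\<^sub>v (transpose_mat V' *\<^sub>v v)"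
      using assoc_mult_mat_vec[OF Uc' _ cv, of ?S'] by simp
    also have "\<dots> = B' *\<^sub>v proj V' v"
      unfolding BV'[symmetric] proj_def by (rule assoc_mult_mat_vec[OF B' Vc' cv])
    finally show ?thesis unfolding proj_def[of U'] 3 .
  qed
qed

text \<open>One half of Wedin's argument. Dividing by the singular values writes U z as B v with v =
  V w and |w| at most |z| / a. Outside the range of U', the difference B v - B' v contributes e |w|,
  while B' v contributes only B' applied to the part of v outside V', at most \<tau> \<beta> |w|.
  The left defect is thus bounded through the right defect \<beta>.\<close>

lemma subspace_perturbation_step:
  fixes B B' :: "real mat"
  assumes U: "orthonormal_cols n r U" and V: "orthonormal_cols m r V"
    and U': "orthonormal_cols n r U'" and V': "orthonormal_cols m r V'"
    and B: "B \<in> carrier_mat n m" and B': "B' \<in> carrier_mat n m"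
    and BV: "B * V = U * mat r r (\<lambda>(i,j). if i = j then s i else 0)"
    and BV': "B' * V' = U' * mat r r (\<lambda>(i,j). if i = j then s' i else 0)"
    and BU': "transpose_mat B' * U' = V' * mat r r (\<lambda>(i,j). if i = j then s' i else 0)"
    and s: "\<And>i. i < r \<Longrightarrow> a \<le> s i" and a: "0 < a" and \<tau>: "0 \<le> \<tau>"
    and compl: "\<And>y. y \<in> carrier_vec m \<Longrightarrow> transpose_mat V' *\<^sub>v y = 0\<^sub>v r \<Longrightarrow> vnorm (B' *\<^sub>v y) \<le> \<tau> * vnorm y"
    and e: "\<And>y. y \<in> carrier_vec m \<Longrightarrow> vnorm (B *\<^sub>v y - B' *\<^sub>v y) \<le> e * vnorm y"
    and \<beta>: "\<And>z. z \<in> carrier_vec r \<Longrightarrow> vnorm (proj_compl V' (V *\<^sub>v z)) \<le> \<beta> * vnorm z"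
    and nonneg: "0 \<le> e" "0 \<le> \<beta>"
    and z: "z \<in> carrier_vec r"
  shows "vnorm (proj_compl U' (U *\<^sub>v z)) \<le> (e + \<tau> * \<beta>) / a * vnorm z"
proof -
  let ?S = "mat r r (\<lambda>(i,j). if i = j then s i else 0)" and ?S' = "mat r r (\<lambda>(i,j). if i = j then s' i else 0)"
  note Uc = orthonormal_colsD(1)[OF U] and Vc = orthonormal_colsD(1)[OF V]
    and Uc' = orthonormal_colsD(1)[OF U'] and Vc' = orthonormal_colsD(1)[OF V']
  define w where "w = vec r (\<lambda>i. z $ i / s i)"
  have w: "w \<in> carrier_vec r" by (simp add: w_def)
  have Sw: "?S *\<^sub>v w = z"
  proof (rule eq_vecI)
    fix i assume "i < dim_vec z"
    then have i: "i < r" using z by simp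
    have "(?S *\<^sub>v w) $ i = (\<Sum>j=0..<r. (if i = j then s i else 0) * w $ j)"
      using i by (simp add: scalar_prod_def w_def cong: if_cong)
    also have "\<dots> = s i * w $ i" using i by (simp add: if_distrib[where f = "\<lambda>t. t * _"] cong: if_cong)
    also have "\<dots> = z $ i" using i s[OF i] a by (simp add: w_def)
    finally show "(?S *\<^sub>v w) $ i = z $ i" .
  qed (use z in auto)
  have wn: "vnorm w \<le> vnorm z / a"
  proof -
    have "vnorm w \<le> vnorm ((1 / a) \<cdot>\<^sub>v z)"
    proof (rule vnorm_vec_le_mono[of _ r])
      fix i assume i: "i < r"
      have "\<bar>z $ i\<bar> / s i \<le> \<bar>z $ i\<bar> / a" using s[OF i] a by (intro divide_left_mono) auto
      then show "\<bar>w $ i\<bar> \<le> \<bar>((1 / a) \<cdot>\<^sub>v z) $ i\<bar>" using i z s[OF i] a by (simp add: w_def abs_mult)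
    qed (use z w in auto)
    also have "\<dots> = vnorm z / a" using a by (simp add: vnorm_smult)
    finally show ?thesis .
  qed
  define v where "v = V *\<^sub>v w"
  have v: "v \<in> carrier_vec m" and vn: "vnorm v = vnorm w"
    using Vc w vnorm_orthonormal_cols[OF V w] by (auto simp: v_def)
  have Bv: "B *\<^sub>v v \<in> carrier_vec n" and Bv': "B' *\<^sub>v v \<in> carrier_vec n" using B B' v by auto
  have 1: "U *\<^sub>v z = (U * ?S) *\<^sub>v w" using assoc_mult_mat_vec[OF Uc _ w, of ?S] Sw by simp
  have 2: "(B * V) *\<^sub>v w = B *\<^sub>v v" unfolding v_def by (rule assoc_mult_mat_vec[OF B Vc w])
  have Uz: "U *\<^sub>v z = B *\<^sub>v v" using 1 2 unfolding BV by simp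
  have cv: "transpose_mat V' *\<^sub>v v \<in> carrier_vec r" by (rule proj_carrier(3)[OF V' v])
  have pc: "proj V' v \<in> carrier_vec m" by (rule proj_carrier(1)[OF V' v])
  have comm: "proj U' (B' *\<^sub>v v) = B' *\<^sub>v proj V' v"
    by (rule proj_intertwine[OF U' V' B' BV' BU' v])
  have cB: "proj_compl U' (B' *\<^sub>v v) = B' *\<^sub>v proj_compl V' v"
    unfolding proj_compl_def comm using mult_minus_distrib_mat_vec[OF B' v pc] by simp
  have b2: "vnorm (B' *\<^sub>v proj_compl V' v) \<le> \<tau> * (\<beta> * vnorm w)"
  proof -
    have "vnorm (B' *\<^sub>v proj_compl V' v) \<le> \<tau> * vnorm (proj_compl V' v)"
      by (rule compl[OF proj_carrier(2)[OF V' v] transpose_mult_proj_compl[OF V' v]])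
    also have "\<dots> \<le> \<tau> * (\<beta> * vnorm w)" using \<beta>[OF w] \<tau> unfolding v_def by (intro mult_left_mono)
    finally show ?thesis .
  qed
  define h k where "h = B *\<^sub>v v - B' *\<^sub>v v" and "k = B' *\<^sub>v v"
  have h: "h \<in> carrier_vec n" and k: "k \<in> carrier_vec n" using Bv Bv' by (auto simp: h_def k_def)
  have Uhk: "U *\<^sub>v z = h + k" unfolding Uz h_def k_def[symmetric] using B v k by (intro eq_vecI) auto
  have "transpose_mat U' *\<^sub>v (h + k) = transpose_mat U' *\<^sub>v h + transpose_mat U' *\<^sub>v k"
    by (rule mult_add_distrib_mat_vec[OF orthonormal_colsD(2)[OF U'] h k])
  then have "proj U' (h + k) = proj U' h + proj U' k"
    unfolding proj_def using mult_add_distrib_mat_vec[OF Uc' proj_carrier(3)[OF U' h] proj_carrier(3)[OF U' k]] by simp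
  then have "proj_compl U' (h + k) = proj_compl U' h + proj_compl U' k"
    unfolding proj_compl_def
    using h k proj_carrier(1)[OF U' h] proj_carrier(1)[OF U' k] by (intro eq_vecI) auto
  moreover have "dim_vec (proj_compl U' h) = dim_vec (proj_compl U' k)"
    using proj_carrier(2)[OF U' h] proj_carrier(2)[OF U' k] by simp
  ultimately have tri: "vnorm (proj_compl U' (U *\<^sub>v z)) \<le> vnorm (proj_compl U' h) + vnorm (proj_compl U' k)"
    unfolding Uhk using vnorm_add_le by simp
  have kc: "proj_compl U' k = B' *\<^sub>v proj_compl V' v" unfolding k_def by (rule cB)
  have "vnorm (proj_compl U' (U *\<^sub>v z)) \<le> e * vnorm w + \<tau> * (\<beta> * vnorm w)"
    using tri proj_norm_le(2)[OF U' h] e[OF v] b2 unfolding kc h_def vn by linarith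
  also have "\<dots> = (e + \<tau> * \<beta>) * vnorm w" by (simp add: distrib_right)
  also have "\<dots> \<le> (e + \<tau> * \<beta>) * (vnorm z / a)" using wn nonneg \<tau> by (intro mult_left_mono) auto
  finally show ?thesis by simp
qed

text \<open>The previous step is applied to the matrices and to their transposes. With \<alpha> and
  \<beta> the sines on the left and right side, each is at most (e + \<tau> times the other) / a,
  and the system closes because \<tau> < a.\<close>

lemma subspace_perturbation:
  fixes B B' :: "real mat"
  assumes U: "orthonormal_cols n r U" and V: "orthonormal_cols m r V"
    and U': "orthonormal_cols n r U'" and V': "orthonormal_cols m r V'"
    and B: "B \<in> carrier_mat n m" and B': "B' \<in> carrier_mat n m"
    and BV: "B * V = U * mat r r (\<lambda>(i,j). if i = j then s i else 0)"
    and BU: "transpose_mat B * U = V * mat r r (\<lambda>(i,j). if i = j then s i else 0)"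
    and BV': "B' * V' = U' * mat r r (\<lambda>(i,j). if i = j then s' i else 0)"
    and BU': "transpose_mat B' * U' = V' * mat r r (\<lambda>(i,j). if i = j then s' i else 0)"
    and s: "\<And>i. i < r \<Longrightarrow> a \<le> s i" and \<tau>: "0 \<le> \<tau>" "\<tau> < a"
    and complU: "\<And>x. x \<in> carrier_vec n \<Longrightarrow> transpose_mat U' *\<^sub>v x = 0\<^sub>v r \<Longrightarrow> vnorm (transpose_mat B' *\<^sub>v x) \<le> \<tau> * vnorm x"
    and e: "0 \<le> e" "\<And>y. y \<in> carrier_vec m \<Longrightarrow> vnorm (B *\<^sub>v y - B' *\<^sub>v y) \<le> e * vnorm y"
    and eT: "\<And>x. x \<in> carrier_vec n \<Longrightarrow> vnorm (transpose_mat B *\<^sub>v x - transpose_mat B' *\<^sub>v x) \<le> e * vnorm x"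
    and z: "z \<in> carrier_vec r"
  shows "vnorm (proj_compl U' (U *\<^sub>v z)) \<le> 2 * e / (a - \<tau>) * vnorm z"
proof -
  have a: "0 < a" using \<tau> by simp
  note Uc = orthonormal_colsD(1)[OF U] and Vc = orthonormal_colsD(1)[OF V]
  \<comment> \<open>The bound on the left complement passes to the right one by duality: if y is
    orthogonal to V' then B' y is orthogonal to U', and |B' y|^2 is the inner product of y with B'^T
    B' y.\<close>
  have complV: "vnorm (B' *\<^sub>v y) \<le> \<tau> * vnorm y"
    if y: "y \<in> carrier_vec m" "transpose_mat V' *\<^sub>v y = 0\<^sub>v r" for y
  proof (rule vnorm_le_of_square)
    let ?S' = "mat r r (\<lambda>(i,j). if i = j then s' i else 0)"
    have By: "B' *\<^sub>v y \<in> carrier_vec n" using B' y by simp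
    have "transpose_mat U' * B' = transpose_mat (transpose_mat B' * U')"
      using B' orthonormal_colsD(1)[OF U'] by (simp add: transpose_mult[of _ m n _ r])
    also have "\<dots> = transpose_mat ?S' * transpose_mat V'"
      unfolding BU' using orthonormal_colsD(1)[OF V'] by (simp add: transpose_mult[of _ m r _ r])
    finally have UB: "transpose_mat U' * B' = transpose_mat ?S' * transpose_mat V'" .
    have "transpose_mat U' *\<^sub>v (B' *\<^sub>v y) = (transpose_mat U' * B') *\<^sub>v y"
      using assoc_mult_mat_vec[OF orthonormal_colsD(2)[OF U'] B' y(1)] by simp
    also have "\<dots> = transpose_mat ?S' *\<^sub>v (transpose_mat V' *\<^sub>v y)"
      unfolding UB by (rule assoc_mult_mat_vec[of _ r r, OF _ orthonormal_colsD(2)[OF V'] y(1)]) simp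
    also have "\<dots> = 0\<^sub>v r" unfolding y(2) by (intro eq_vecI) auto
    finally have UBy: "transpose_mat U' *\<^sub>v (B' *\<^sub>v y) = 0\<^sub>v r" .
    have "(B' *\<^sub>v y) \<bullet> (B' *\<^sub>v y) = y \<bullet> (transpose_mat B' *\<^sub>v (B' *\<^sub>v y))"
      by (rule adjoint_scalar_prod[OF B' y(1) By])
    also have "\<dots> \<le> vnorm y * vnorm (transpose_mat B' *\<^sub>v (B' *\<^sub>v y))"
      using scalar_prod_abs_le[of y "transpose_mat B' *\<^sub>v (B' *\<^sub>v y)"] y(1) B' by simp
    also have "\<dots> \<le> vnorm y * (\<tau> * vnorm (B' *\<^sub>v y))"
      by (intro mult_left_mono complU[OF By UBy]) simp
    finally show "(B' *\<^sub>v y) \<bullet> (B' *\<^sub>v y) \<le> \<tau> * vnorm y * vnorm (B' *\<^sub>v y)" by (simp add: ac_simps)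
  qed (use \<tau> in simp)
  \<comment> \<open>The sine of the largest angle as a supremum over the unit ball of coefficients.
    A least constant is needed, since the coupled inequalities are solved for it.\<close>
  define f where "f W W' = (SUP z\<in>{z\<in>carrier_vec r. vnorm z \<le> 1}. vnorm (proj_compl W' (W *\<^sub>v z)))" for W W'
  have f: "vnorm (proj_compl W' (W *\<^sub>v z)) \<le> f W W' * vnorm z \<and> 0 \<le> f W W'"
    if W: "orthonormal_cols k r W" "orthonormal_cols k r W'" and z: "z \<in> carrier_vec r" for k W W' z
  proof -
    have bd: "bdd_above ((\<lambda>z. vnorm (proj_compl W' (W *\<^sub>v z))) ` {z\<in>carrier_vec r. vnorm z \<le> 1})"
    proof (rule bdd_aboveI2)
      fix z assume "z \<in> {z\<in>carrier_vec r. vnorm z \<le> 1}"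
      then have z: "z \<in> carrier_vec r" "vnorm z \<le> 1" by auto
      have "W *\<^sub>v z \<in> carrier_vec k" using orthonormal_colsD(1)[OF W(1)] z by simp
      from proj_norm_le(2)[OF W(2) this] show "vnorm (proj_compl W' (W *\<^sub>v z)) \<le> 1"
        using z(2) unfolding vnorm_orthonormal_cols[OF W(1) z(1)] by simp
    qed
    have up: "vnorm (proj_compl W' (W *\<^sub>v z)) \<le> f W W'" if "z \<in> carrier_vec r" "vnorm z \<le> 1" for z
      unfolding f_def by (rule cSUP_upper[OF _ bd]) (use that in auto)
    have "vnorm (proj_compl W' (W *\<^sub>v 0\<^sub>v r)) \<le> f W W'" by (rule up) simp_all
    then have f0: "0 \<le> f W W'" by (rule order_trans[OF vnorm_nonneg])
    show ?thesis
    proof (cases "vnorm z = 0")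
      case True
      then have "vnorm (W *\<^sub>v z) = 0" using vnorm_orthonormal_cols[OF W(1) z] by simp
      moreover have "W *\<^sub>v z \<in> carrier_vec k" using orthonormal_colsD(1)[OF W(1)] z by simp
      ultimately show ?thesis using proj_norm_le(2)[OF W(2), of "W *\<^sub>v z"] f0 True by simp
    next
      case False
      let ?c = "1 / vnorm z"
      have pos: "0 < vnorm z" using False vnorm_nonneg[of z] by linarith
      have Wz: "W *\<^sub>v z \<in> carrier_vec k" using orthonormal_colsD(1)[OF W(1)] z by simp
      have "W *\<^sub>v (?c \<cdot>\<^sub>v z) = ?c \<cdot>\<^sub>v (W *\<^sub>v z)" by (rule mult_mat_vec[OF orthonormal_colsD(1)[OF W(1)] z])
      moreover have "proj_compl W' (?c \<cdot>\<^sub>v (W *\<^sub>v z)) = ?c \<cdot>\<^sub>v proj_compl W' (W *\<^sub>v z)"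
        unfolding proj_compl_def proj_def mult_mat_vec[OF orthonormal_colsD(2)[OF W(2)] Wz]
          mult_mat_vec[OF orthonormal_colsD(1)[OF W(2)] proj_carrier(3)[OF W(2) Wz]]
        using Wz orthonormal_colsD(1)[OF W(1)] orthonormal_colsD(1)[OF W(2)]
        by (intro eq_vecI) (auto simp: right_diff_distrib)
      ultimately have eq: "vnorm (proj_compl W' (W *\<^sub>v (?c \<cdot>\<^sub>v z))) = ?c * vnorm (proj_compl W' (W *\<^sub>v z))"
        using pos by (simp add: vnorm_smult)
      have "?c * vnorm (proj_compl W' (W *\<^sub>v z)) \<le> f W W'"
        unfolding eq[symmetric] by (rule up) (use z pos in \<open>auto simp: vnorm_smult\<close>)
      then show ?thesis using f0 pos by (simp add: field_simps)
    qed
  qed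
  have f_least: "f W W' \<le> c" if "\<And>z. z \<in> carrier_vec r \<Longrightarrow> vnorm (proj_compl W' (W *\<^sub>v z)) \<le> c * vnorm z" "0 \<le> c" for W W' c
    unfolding f_def
  proof (rule cSUP_least)
    show "{z \<in> carrier_vec r. vnorm z \<le> 1} \<noteq> {}" by (auto intro!: exI[of _ "0\<^sub>v r"])
    fix z assume "z \<in> {z \<in> carrier_vec r. vnorm z \<le> 1}"
    then have z: "z \<in> carrier_vec r" "vnorm z \<le> 1" by auto
    have "c * vnorm z \<le> c * 1" using z(2) that(2) by (intro mult_left_mono)
    then show "vnorm (proj_compl W' (W *\<^sub>v z)) \<le> c" using that(1)[OF z(1)] by simp
  qed
  define \<alpha> \<beta> where "\<alpha> = f U U'" and "\<beta> = f V V'"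
  have nn: "0 \<le> \<alpha>" "0 \<le> \<beta>" using f[OF U U' z] f[OF V V' z] by (auto simp: \<alpha>_def \<beta>_def)
  have q: "0 \<le> (e + \<tau> * c) / a" if "0 \<le> c" for c
    by (rule divide_nonneg_pos[OF add_nonneg_nonneg[OF e(1) mult_nonneg_nonneg[OF \<tau>(1) that]] a])
  have \<alpha>1: "\<alpha> \<le> (e + \<tau> * \<beta>) / a" unfolding \<alpha>_def
  proof (rule f_least)
    fix z :: "real vec" assume z: "z \<in> carrier_vec r"
    have fV: "\<And>z. z \<in> carrier_vec r \<Longrightarrow> vnorm (proj_compl V' (V *\<^sub>v z)) \<le> \<beta> * vnorm z"
      using f[OF V V'] by (simp add: \<beta>_def)
    show "vnorm (proj_compl U' (U *\<^sub>v z)) \<le> (e + \<tau> * \<beta>) / a * vnorm z"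
      by (rule subspace_perturbation_step[where U = U and V = V and U' = U' and V' = V' and B = B and B' = B'
            and s = s and s' = s' and n = n and m = m and r = r and \<beta> = \<beta>],
          rule U, rule V, rule U', rule V', rule B, rule B', rule BV, rule BV', rule BU', erule s, rule a,
          rule \<tau>(1), erule (1) complV, erule e(2), erule fV, rule e(1), rule nn(2), rule z)
  qed (rule q[OF nn(2)])
  have \<beta>1: "\<beta> \<le> (e + \<tau> * \<alpha>) / a" unfolding \<beta>_def
  proof (rule f_least)
    fix z :: "real vec" assume z: "z \<in> carrier_vec r"
    have fU: "\<And>z. z \<in> carrier_vec r \<Longrightarrow> vnorm (proj_compl U' (U *\<^sub>v z)) \<le> \<alpha> * vnorm z"
      using f[OF U U'] by (simp add: \<alpha>_def)
    have BT: "transpose_mat B \<in> carrier_mat m n" "transpose_mat B' \<in> carrier_mat m n" using B B' by auto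
    have BVT: "transpose_mat (transpose_mat B') * V' = U' * mat r r (\<lambda>(i,j). if i = j then s' i else 0)" using BV' by simp
    show "vnorm (proj_compl V' (V *\<^sub>v z)) \<le> (e + \<tau> * \<alpha>) / a * vnorm z"
      by (rule subspace_perturbation_step[where U = V and V = U and U' = V' and V' = U' and B = "transpose_mat B"
            and B' = "transpose_mat B'" and s = s and s' = s' and n = m and m = n and r = r and \<beta> = \<alpha>],
          rule V, rule U, rule V', rule U', rule BT(1), rule BT(2), rule BU, rule BU', rule BVT, erule s, rule a,
          rule \<tau>(1), erule (1) complU, erule eT, erule fU, rule e(1), rule nn(1), rule z)
  qed (rule q[OF nn(1)])
  \<comment> \<open>Adding the two inequalities gives (a - \<tau>) (\<alpha> + \<beta>) at most 2 e,
    and dropping \<beta> leaves the claim.\<close>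
  have 1: "\<alpha> * a \<le> e + \<tau> * \<beta>" by (rule iffD1[OF pos_le_divide_eq[OF a] \<alpha>1])
  have 2: "\<beta> * a \<le> e + \<tau> * \<alpha>" by (rule iffD1[OF pos_le_divide_eq[OF a] \<beta>1])
  have 3: "(a - \<tau>) * (\<alpha> + \<beta>) = \<alpha> * a + \<beta> * a - \<tau> * \<alpha> - \<tau> * \<beta>" by (simp add: algebra_simps)
  have 4: "\<alpha> * (a - \<tau>) \<le> (a - \<tau>) * (\<alpha> + \<beta>)" using nn \<tau> by (simp add: mult.commute mult_left_mono)
  have "\<alpha> * (a - \<tau>) \<le> 2 * e" using 1 2 3 4 by linarith
  moreover have "0 < a - \<tau>" using \<tau> by simp
  ultimately have "\<alpha> \<le> 2 * e / (a - \<tau>)" by (simp only: pos_le_divide_eq)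
  then have "\<alpha> * vnorm z \<le> 2 * e / (a - \<tau>) * vnorm z" by (intro mult_right_mono) auto
  then show ?thesis using f[OF U U' z] by (simp add: \<alpha>_def)
qed

text \<open>Wedin's theorem with a the r-th singular value of A and \<tau> the next one of B: the
  gap is mixed between the two matrices and is compared with the gap of a reference matrix only
  later.\<close>

lemma leading_left_sing_vecs_perturbation:
  assumes A: "A \<in> carrier_mat n m" and B: "B \<in> carrier_mat n m" and r: "1 \<le> r" "r < min n m"
    and U: "leading_left_sing_vecs A r U" and U': "leading_left_sing_vecs B r U'"
    and gap: "sing_val B (r + 1) < sing_val A r" "sing_val B (r + 1) < sing_val B r"
    and e0: "0 \<le> e"
    and e: "\<And>y. y \<in> carrier_vec m \<Longrightarrow> vnorm (A *\<^sub>v y - B *\<^sub>v y) \<le> e * vnorm y"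
    and eT: "\<And>x. x \<in> carrier_vec n \<Longrightarrow> vnorm (transpose_mat A *\<^sub>v x - transpose_mat B *\<^sub>v x) \<le> e * vnorm x"
    and z: "z \<in> carrier_vec r"
  shows "vnorm (proj_compl U' (U *\<^sub>v z)) \<le> 2 * e / (sing_val A r - sing_val B (r + 1)) * vnorm z"
proof -
  obtain V where V: "orthonormal_cols m r V"
    "A * V = U * mat r r (\<lambda>(i,j). if i = j then sing_val A (i + 1) else 0)"
    "transpose_mat A * U = V * mat r r (\<lambda>(i,j). if i = j then sing_val A (i + 1) else 0)"
    using U A unfolding leading_left_sing_vecs_def by auto
  obtain V' where V': "orthonormal_cols m r V'"
    "B * V' = U' * mat r r (\<lambda>(i,j). if i = j then sing_val B (i + 1) else 0)"
    "transpose_mat B * U' = V' * mat r r (\<lambda>(i,j). if i = j then sing_val B (i + 1) else 0)"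
    using U' B unfolding leading_left_sing_vecs_def by auto
  have Uo: "orthonormal_cols n r U" "orthonormal_cols n r U'"
    using U U' A B by (auto simp: leading_left_sing_vecs_def)
  have s: "sing_val A r \<le> sing_val A (i + 1)" if "i < r" for i
  proof -
    have "i \<le> r - 1" "r - 1 < min n m" using that r by auto
    from sing_val_decreasing(1)[OF A this] show ?thesis using r by simp
  qed
  have t: "0 \<le> sing_val B (r + 1)" by (rule sing_val_decreasing(2)[OF B order_refl r(2)])
  have c: "vnorm (transpose_mat B *\<^sub>v x) \<le> sing_val B (r + 1) * vnorm x"
    if "x \<in> carrier_vec n" "transpose_mat U' *\<^sub>v x = 0\<^sub>v r" for x
    by (rule leading_left_sing_vecs_complement[OF B r gap(2) U' that])
  show ?thesis
    by (rule subspace_perturbation[where U = U and V = V and U' = U' and V' = V' and B = A and B' = B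
          and s = "\<lambda>i. sing_val A (i + 1)" and s' = "\<lambda>i. sing_val B (i + 1)"],
        rule Uo, rule V, rule Uo, rule V', rule A, rule B, rule V, rule V, rule V', rule V', erule s,
        rule t, rule gap(1), erule (1) c, rule e0, erule e, erule eT, rule z)
qed

section \<open>Differences of projectors, the polar factor and the row-wise bound\<close>

lemma proj_compl_self_adjoint:
  assumes U: "orthonormal_cols n r U" and x: "x \<in> carrier_vec n" and y: "y \<in> carrier_vec n"
  shows "x \<bullet> proj_compl U y = proj_compl U x \<bullet> y"
proof -
  note c = proj_carrier[OF U]
  have 1: "x \<bullet> proj U y = (transpose_mat U *\<^sub>v x) \<bullet> (transpose_mat U *\<^sub>v y)"
    unfolding proj_def by (rule transpose_vec_mult_scalar[OF orthonormal_colsD(1)[OF U] c(3)[OF y] x, symmetric])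
  have 2: "proj U x \<bullet> y = (transpose_mat U *\<^sub>v x) \<bullet> (transpose_mat U *\<^sub>v y)"
    unfolding proj_def by (rule adjoint_scalar_prod[OF orthonormal_colsD(1)[OF U] c(3)[OF x] y])
  show ?thesis unfolding proj_compl_def scalar_prod_minus_distrib[OF x y c(1)[OF y]]
      minus_scalar_prod_distrib[OF x c(1)[OF x] y] 1 2 ..
qed

text \<open>Splitting w by P gives P w - P' w = (1 - P') P w - P' (1 - P) w. The first term is
  controlled by the angle in one direction; the second is the adjoint of (1 - P) P' and is
  controlled by the angle in the other.\<close>

lemma proj_difference_le:
  assumes U: "orthonormal_cols n r U" and U': "orthonormal_cols n r U'"
    and a: "\<And>z. z \<in> carrier_vec r \<Longrightarrow> vnorm (proj_compl U' (U *\<^sub>v z)) \<le> a * vnorm z" "0 \<le> a"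
    and b: "\<And>z. z \<in> carrier_vec r \<Longrightarrow> vnorm (proj_compl U (U' *\<^sub>v z)) \<le> b * vnorm z" "0 \<le> b"
    and w: "w \<in> carrier_vec n"
  shows "vnorm (proj U w - proj U' w) \<le> (a + b) * vnorm w"
proof -
  note c = proj_carrier[OF U w]
  have P: "proj U' (proj U w) \<in> carrier_vec n" "proj U' (proj_compl U w) \<in> carrier_vec n"
      "proj_compl U' (proj U w) \<in> carrier_vec n"
    using proj_carrier[OF U'] c by auto
  have "proj U' w = proj U' (proj U w) + proj U' (proj_compl U w)"
  proof -
    have "transpose_mat U' *\<^sub>v w = transpose_mat U' *\<^sub>v (proj U w + proj_compl U w)" by (simp only: proj_plus_compl[OF U w])
    then have 1: "transpose_mat U' *\<^sub>v w = transpose_mat U' *\<^sub>v proj U w + transpose_mat U' *\<^sub>v proj_compl U w"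
      by (simp only: mult_add_distrib_mat_vec[OF orthonormal_colsD(2)[OF U'] c(1,2)])
    show ?thesis unfolding proj_def[of U'] 1
      by (rule mult_add_distrib_mat_vec[OF orthonormal_colsD(1)[OF U'] proj_carrier(3)[OF U' c(1)] proj_carrier(3)[OF U' c(2)]])
  qed
  then have eq: "proj U w - proj U' w = proj_compl U' (proj U w) - proj U' (proj_compl U w)"
    unfolding proj_compl_def[of U' "proj U w"] using P c by (intro eq_vecI) auto
  have 1: "vnorm (proj_compl U' (proj U w)) \<le> a * vnorm w"
  proof -
    have "vnorm (proj_compl U' (proj U w)) \<le> a * vnorm (transpose_mat U *\<^sub>v w)"
      unfolding proj_def by (rule a(1)[OF c(3)])
    moreover have "a * vnorm (transpose_mat U *\<^sub>v w) \<le> a * vnorm w"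
      by (rule mult_left_mono[OF proj_norm_le(1)[OF U w] a(2)])
    ultimately show ?thesis by linarith
  qed
  have 2: "vnorm (proj U' (proj_compl U w)) \<le> b * vnorm w"
  proof -
    define h where "h = transpose_mat U' *\<^sub>v proj_compl U w"
    have h: "h \<in> carrier_vec r" unfolding h_def by (rule proj_carrier(3)[OF U' c(2)])
    have Uh: "U' *\<^sub>v h \<in> carrier_vec n" using orthonormal_colsD(1)[OF U'] h by simp
    have "h \<bullet> h = (U' *\<^sub>v h) \<bullet> proj_compl U w"
      using adjoint_scalar_prod[OF orthonormal_colsD(1)[OF U'] h c(2)] by (simp only: h_def)
    also have "\<dots> = proj_compl U (U' *\<^sub>v h) \<bullet> w" by (rule proj_compl_self_adjoint[OF U Uh w])
    finally have hh: "h \<bullet> h = proj_compl U (U' *\<^sub>v h) \<bullet> w" .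
    have "proj_compl U (U' *\<^sub>v h) \<bullet> w \<le> vnorm (proj_compl U (U' *\<^sub>v h)) * vnorm w"
      using scalar_prod_abs_le[of "proj_compl U (U' *\<^sub>v h)" w] proj_carrier(2)[OF U Uh] w by simp
    moreover have "vnorm (proj_compl U (U' *\<^sub>v h)) * vnorm w \<le> b * vnorm h * vnorm w"
      by (rule mult_right_mono[OF b(1)[OF h] vnorm_nonneg])
    ultimately have "h \<bullet> h \<le> b * vnorm w * vnorm h" unfolding hh by (simp add: mult.commute mult.left_commute)
    then have "vnorm h \<le> b * vnorm w" by (rule vnorm_le_of_square[rotated]) (use b(2) in simp)
    then show ?thesis unfolding proj_def[of U'] h_def[symmetric] vnorm_orthonormal_cols[OF U' h] .
  qed
  have "vnorm (proj U w - proj U' w) \<le> vnorm (proj_compl U' (proj U w)) + vnorm (proj U' (proj_compl U w))"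
    unfolding eq by (rule vnorm_minus_le) (use P in simp)
  then show ?thesis using 1 2 by (simp add: distrib_right)
qed

lemma ex_spectral_multiplier:
  fixes z :: "nat \<Rightarrow> real vec"
  assumes z: "\<And>i. i < n \<Longrightarrow> z i \<in> carrier_vec n"
    and on: "\<And>i j. i < n \<Longrightarrow> j < n \<Longrightarrow> z i \<bullet> z j = (if i = j then 1 else 0)"
  shows "\<exists>R\<in>carrier_mat n n. transpose_mat R = R \<and> (\<forall>k<n. \<forall>y\<in>carrier_vec n. z k \<bullet> (R *\<^sub>v y) = c k * (z k \<bullet> y))"
proof -
  define R where "R = mat n n (\<lambda>(i,j). \<Sum>l<n. c l * (z l $ i * z l $ j))"
  have R: "R \<in> carrier_mat n n" by (simp add: R_def)
  have symm: "transpose_mat R = R" by (rule eq_matI) (auto simp: R_def mult.commute)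
  have "z k \<bullet> (R *\<^sub>v y) = c k * (z k \<bullet> y)" if k: "k < n" and y: "y \<in> carrier_vec n" for k y
  proof -
    have Ry: "(R *\<^sub>v y) $ i = (\<Sum>l<n. c l * (z l \<bullet> y) * z l $ i)" if i: "i < n" for i
    proof -
      have "(R *\<^sub>v y) $ i = (\<Sum>j=0..<n. (\<Sum>l<n. c l * (z l $ i * z l $ j)) * y $ j)"
        using i y by (simp add: R_def scalar_prod_def)
      also have "\<dots> = (\<Sum>l<n. \<Sum>j=0..<n. c l * (z l $ i * z l $ j) * y $ j)"
        unfolding sum_distrib_right by (rule sum.swap)
      also have "\<dots> = (\<Sum>l<n. c l * (z l \<bullet> y) * z l $ i)"
        using y by (intro sum.cong refl) (simp add: scalar_prod_def sum_distrib_left sum_distrib_right ac_simps)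
      finally show ?thesis .
    qed
    have "z k \<bullet> (R *\<^sub>v y) = (\<Sum>i=0..<n. z k $ i * (\<Sum>l<n. c l * (z l \<bullet> y) * z l $ i))"
      unfolding scalar_prod_def[of "z k"] using R Ry by (simp del: index_mult_mat_vec)
    also have "\<dots> = (\<Sum>l<n. \<Sum>i=0..<n. z k $ i * (c l * (z l \<bullet> y) * z l $ i))"
      unfolding sum_distrib_left by (rule sum.swap)
    also have "\<dots> = (\<Sum>l<n. if l = k then c k * (z k \<bullet> y) else 0)"
    proof (intro sum.cong refl)
      fix l assume "l \<in> {..<n}"
      then have l: "l < n" by simp
      have "(\<Sum>i=0..<n. z k $ i * (c l * (z l \<bullet> y) * z l $ i)) = c l * (z l \<bullet> y) * (\<Sum>i=0..<n. z k $ i * z l $ i)"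
        by (simp add: sum_distrib_left ac_simps)
      also have "(\<Sum>i=0..<n. z k $ i * z l $ i) = z k \<bullet> z l" using z[OF l] by (simp add: scalar_prod_def)
      finally show "(\<Sum>i=0..<n. z k $ i * (c l * (z l \<bullet> y) * z l $ i)) = (if l = k then c k * (z k \<bullet> y) else 0)"
        using on[OF k l] by auto
    qed
    also have "\<dots> = c k * (z k \<bullet> y)" using k by simp
    finally show ?thesis .
  qed
  then show ?thesis using R symm by blast
qed

lemma near_isometry_polar_factor:
  fixes M :: "real mat"
  assumes M: "M \<in> carrier_mat r r" and s: "0 \<le> s" "s < 1"
    and iso: "\<And>y. y \<in> carrier_vec r \<Longrightarrow> (1 - s\<^sup>2) * (vnorm y)\<^sup>2 \<le> (vnorm (transpose_mat M *\<^sub>v y))\<^sup>2"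
      "\<And>y. y \<in> carrier_vec r \<Longrightarrow> vnorm (transpose_mat M *\<^sub>v y) \<le> vnorm y"
  shows "\<exists>Q\<in>orth_group r. \<forall>y\<in>carrier_vec r. vnorm (transpose_mat M *\<^sub>v y - transpose_mat Q *\<^sub>v y) \<le> s\<^sup>2 * vnorm y"
proof -
  let ?G = "M * transpose_mat M"
  have G: "?G \<in> carrier_mat r r" "transpose_mat ?G = ?G" using M by (simp_all add: transpose_mult[of _ r r _ r])
  obtain z d where "left_svd r r M z d" using ex_left_svd[OF M] by blast
  note zd = left_svdD(1-3)[OF this]
  have pv: "u \<bullet> v = (\<Sum>j<r. (z j \<bullet> u) * (z j \<bullet> v))" if "u \<in> carrier_vec r" "v \<in> carrier_vec r" for u v
    by (rule parseval) (use zd(1,2) that in auto)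
  have zG: "z k \<bullet> (?G *\<^sub>v y) = d k * (z k \<bullet> y)" if k: "k < r" and y: "y \<in> carrier_vec r" for k y
    using transpose_vec_mult_scalar[OF G(1) y zd(1)[OF k]] G(2) zd(3)[OF k]
      smult_scalar_prod_distrib[OF zd(1)[OF k] y] by simp
  have d: "1 - s\<^sup>2 \<le> d k" "d k \<le> 1" if k: "k < r" for k
  proof -
    have "(vnorm (z k))\<^sup>2 = 1" using zd(2)[OF k k] by (simp add: vnorm_power2)
    then have n1: "vnorm (z k) = 1" by (simp add: power2_eq_1_iff) (metis vnorm_nonneg neg_0_le_iff_le not_one_le_zero)
    have dk: "d k = (vnorm (transpose_mat M *\<^sub>v z k))\<^sup>2"
      using zG[OF k zd(1)[OF k]] zd(2)[OF k k] gram_quadratic_form[OF M zd(1)[OF k]] by simp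
    show "1 - s\<^sup>2 \<le> d k" using iso(1)[OF zd(1)[OF k]] unfolding dk n1 by simp
    show "d k \<le> 1" using iso(2)[OF zd(1)[OF k]] unfolding dk n1 by (simp add: power_le_one)
  qed
  have s2: "0 < 1 - s\<^sup>2" using s by (simp add: abs_square_less_1)
  have d0: "0 < d k" if "k < r" for k using d(1)[OF that] s2 by linarith
  obtain R where R: "R \<in> carrier_mat r r" "transpose_mat R = R"
      "\<forall>k<r. \<forall>y\<in>carrier_vec r. z k \<bullet> (R *\<^sub>v y) = 1 / sqrt (d k) * (z k \<bullet> y)"
    using ex_spectral_multiplier[of r z "\<lambda>k. 1 / sqrt (d k)"] zd(1,2) by blast
  define Q where "Q = R * M"
  have Q: "Q \<in> carrier_mat r r" using R M by (simp add: Q_def)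
  have QT: "transpose_mat Q *\<^sub>v y = transpose_mat M *\<^sub>v (R *\<^sub>v y)" if y: "y \<in> carrier_vec r" for y
  proof -
    have "transpose_mat Q = transpose_mat M * R" unfolding Q_def transpose_mult[OF R(1) M] R(2) ..
    then show ?thesis using assoc_mult_mat_vec[of "transpose_mat M" r r R r y] M R y by simp
  qed
  have Gdot: "(transpose_mat M *\<^sub>v u) \<bullet> (transpose_mat M *\<^sub>v v) = (\<Sum>k<r. (z k \<bullet> u) * (d k * (z k \<bullet> v)))"
    if u: "u \<in> carrier_vec r" and v: "v \<in> carrier_vec r" for u v
  proof -
    have Mv: "transpose_mat M *\<^sub>v v \<in> carrier_vec r" using M v by simp
    have "(transpose_mat M *\<^sub>v u) \<bullet> (transpose_mat M *\<^sub>v v) = u \<bullet> (M *\<^sub>v (transpose_mat M *\<^sub>v v))"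
      by (rule transpose_vec_mult_scalar[OF M Mv u])
    also have "M *\<^sub>v (transpose_mat M *\<^sub>v v) = ?G *\<^sub>v v"
      by (rule assoc_mult_mat_vec[symmetric, OF M _ v]) (use M in simp)
    also have "u \<bullet> (?G *\<^sub>v v) = (\<Sum>k<r. (z k \<bullet> u) * (z k \<bullet> (?G *\<^sub>v v)))"
      by (rule pv[OF u]) (use G v in simp)
    also have "\<dots> = (\<Sum>k<r. (z k \<bullet> u) * (d k * (z k \<bullet> v)))" using zG[OF _ v] by simp
    finally show ?thesis .
  qed
  have Ry: "R *\<^sub>v y \<in> carrier_vec r" if "y \<in> carrier_vec r" for y using R that by simp
  have QQ: "(transpose_mat Q *\<^sub>v u) \<bullet> (transpose_mat Q *\<^sub>v v) = u \<bullet> v"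
    if u: "u \<in> carrier_vec r" and v: "v \<in> carrier_vec r" for u v
    unfolding QT[OF u] QT[OF v] Gdot[OF Ry[OF u] Ry[OF v]] pv[OF u v]
  proof (intro sum.cong refl)
    fix k assume "k \<in> {..<r}"
    then have k: "k < r" by simp
    have "1 / sqrt (d k) * d k * (1 / sqrt (d k)) = 1" using d0[OF k] by (simp add: field_simps)
    moreover have "z k \<bullet> (R *\<^sub>v u) * (d k * (z k \<bullet> (R *\<^sub>v v))) = (1 / sqrt (d k) * d k * (1 / sqrt (d k))) * ((z k \<bullet> u) * (z k \<bullet> v))"
      using R(3) k u v by simp
    ultimately show "z k \<bullet> (R *\<^sub>v u) * (d k * (z k \<bullet> (R *\<^sub>v v))) = (z k \<bullet> u) * (z k \<bullet> v)" by simp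
  qed
  have "Q * transpose_mat Q = 1\<^sub>m r"
  proof (rule eq_matI)
    fix i j assume "i < dim_row (1\<^sub>m r)" "j < dim_col (1\<^sub>m r)"
    then have ij: "i < r" "j < r" by auto
    have row: "transpose_mat Q *\<^sub>v unit_vec r i = row Q i" if "i < r" for i
      using that Q by (intro eq_vecI) auto
    have "(Q * transpose_mat Q) $$ (i,j) = row Q i \<bullet> row Q j" using ij Q by simp
    also have "\<dots> = unit_vec r i \<bullet> unit_vec r j"
      using QQ[of "unit_vec r i" "unit_vec r j"] row[OF ij(1)] row[OF ij(2)] by simp
    also have "\<dots> = 1\<^sub>m r $$ (i,j)" using ij by simp
    finally show "(Q * transpose_mat Q) $$ (i,j) = 1\<^sub>m r $$ (i,j)" .
  qed (use Q in auto)
  then have "transpose_mat Q * Q = 1\<^sub>m r"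
    by (rule mat_mult_left_right_inverse[rotated -1]) (use Q in auto)
  then have QO: "Q \<in> orth_group r" using Q by (simp add: orth_group_def orthonormal_cols_def)
  have "vnorm (transpose_mat M *\<^sub>v y - transpose_mat Q *\<^sub>v y) \<le> s\<^sup>2 * vnorm y" if y: "y \<in> carrier_vec r" for y
  proof -
    define h where "h = y - R *\<^sub>v y"
    have h: "h \<in> carrier_vec r" using y Ry[OF y] by (simp add: h_def)
    have MQ: "transpose_mat M *\<^sub>v y - transpose_mat Q *\<^sub>v y = transpose_mat M *\<^sub>v h"
      unfolding QT[OF y] h_def by (rule mult_minus_distrib_mat_vec[symmetric, OF _ y Ry[OF y]]) (use M in simp)
    have zh: "z k \<bullet> h = (1 - 1 / sqrt (d k)) * (z k \<bullet> y)" if k: "k < r" for k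
      using scalar_prod_minus_distrib[OF zd(1)[OF k] y Ry[OF y]] R(3) k y by (simp add: h_def left_diff_distrib)
    have "(vnorm (transpose_mat M *\<^sub>v h))\<^sup>2 = (\<Sum>k<r. (z k \<bullet> h) * (d k * (z k \<bullet> h)))"
      unfolding vnorm_power2 by (rule Gdot[OF h h])
    also have "\<dots> \<le> (\<Sum>k<r. (s\<^sup>2)\<^sup>2 * ((z k \<bullet> y) * (z k \<bullet> y)))"
    proof (rule sum_mono)
      fix k assume "k \<in> {..<r}"
      then have k: "k < r" by simp
      define q where "q = sqrt (d k)"
      have q: "0 < q" "q \<le> 1" "d k = q\<^sup>2" "q\<^sup>2 \<ge> 1 - s\<^sup>2" using d[OF k] d0[OF k] by (auto simp: q_def)
      have "q * q \<le> q * 1" using q by (intro mult_left_mono) auto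
      then have "0 \<le> 1 - q" "1 - q \<le> s\<^sup>2" using q(2,4) unfolding power2_eq_square[of q] by linarith+
      then have qq: "(1 - q)\<^sup>2 \<le> (s\<^sup>2)\<^sup>2" by (intro power_mono)
      have "(z k \<bullet> h) * (d k * (z k \<bullet> h)) = ((1 - 1 / q) * q)\<^sup>2 * ((z k \<bullet> y) * (z k \<bullet> y))"
        unfolding zh[OF k] unfolding q_def[symmetric] unfolding q(3) by (simp add: power2_eq_square mult.commute mult.left_commute)
      also have "(1 - 1 / q) * q = - (1 - q)" using q by (simp add: field_simps)
      also have "(- (1 - q))\<^sup>2 = (1 - q)\<^sup>2" by (rule power2_minus)
      finally show "(z k \<bullet> h) * (d k * (z k \<bullet> h)) \<le> (s\<^sup>2)\<^sup>2 * ((z k \<bullet> y) * (z k \<bullet> y))"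
        using mult_right_mono[OF qq, of "(z k \<bullet> y) * (z k \<bullet> y)"] by simp
    qed
    also have "\<dots> = (s\<^sup>2 * vnorm y)\<^sup>2"
      unfolding sum_distrib_left[symmetric] pv[OF y y, symmetric] by (simp add: power_mult_distrib vnorm_power2)
    finally have "vnorm (transpose_mat M *\<^sub>v h) \<le> s\<^sup>2 * vnorm y" by (rule power2_le_imp_le) simp
    then show ?thesis unfolding MQ .
  qed
  then show ?thesis using QO by blast
qed

lemma norm_2inf_le_iff:
  "norm_2inf M \<le> c \<longleftrightarrow> 0 \<le> c \<and> (\<forall>i<dim_row M. vnorm (row M i) \<le> c)"
proof -
  have row: "vnorm (row M i) = sqrt (\<Sum>j<dim_col M. (M $$ (i,j))\<^sup>2)" if "i < dim_row M" for i
    using that by (simp add: vnorm_eq_L2_set L2_set_def lessThan_atLeast0)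
  have "norm_2inf M \<le> c \<longleftrightarrow> (\<forall>x\<in>insert 0 {sqrt (\<Sum>j<dim_col M. (M $$ (i,j))\<^sup>2) | i. i < dim_row M}. x \<le> c)"
    unfolding norm_2inf_def by (rule Max_le_iff) auto
  then show ?thesis using row by auto
qed

lemma vnorm_row_le_norm_2inf: "i < dim_row M \<Longrightarrow> vnorm (row M i) \<le> norm_2inf M"
  and norm_2inf_nonneg: "0 \<le> norm_2inf M"
  using norm_2inf_le_iff[of M "norm_2inf M"] by auto

lemma procrustes_two_inf_le:
  assumes U: "orthonormal_cols n r U" and U': "orthonormal_cols n r U'" and s: "0 \<le> s" "s < 1"
    and a: "\<And>z. z \<in> carrier_vec r \<Longrightarrow> vnorm (proj_compl U' (U *\<^sub>v z)) \<le> s * vnorm z"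
    and b: "0 \<le> b" "\<And>i. i < n \<Longrightarrow> vnorm (transpose_mat U' *\<^sub>v proj_compl U (unit_vec n i)) \<le> b"
  shows "(INF Q\<in>orth_group r. norm_2inf (U' - U * Q)) \<le> norm_2inf U * s\<^sup>2 + b"
proof -
  note Uc = orthonormal_colsD(1,2)[OF U] and Uc' = orthonormal_colsD(1,2)[OF U']
  define M where "M = transpose_mat U * U'"
  have M: "M \<in> carrier_mat r r" using Uc Uc' by (simp add: M_def)
  have MT: "transpose_mat M *\<^sub>v y = transpose_mat U' *\<^sub>v (U *\<^sub>v y)" if y: "y \<in> carrier_vec r" for y
  proof -
    have "transpose_mat M = transpose_mat U' * U" unfolding M_def using Uc Uc' by (simp add: transpose_mult[of _ r n _ r])
    then show ?thesis using assoc_mult_mat_vec[OF Uc'(2) Uc(1) y] by simp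
  qed
  have "\<exists>Q\<in>orth_group r. \<forall>y\<in>carrier_vec r. vnorm (transpose_mat M *\<^sub>v y - transpose_mat Q *\<^sub>v y) \<le> s\<^sup>2 * vnorm y"
  proof (rule near_isometry_polar_factor[OF M s])
    fix y :: "real vec" assume y: "y \<in> carrier_vec r"
    have Uy: "U *\<^sub>v y \<in> carrier_vec n" using Uc y by simp
    have p: "(vnorm y)\<^sup>2 = (vnorm (transpose_mat M *\<^sub>v y))\<^sup>2 + (vnorm (proj_compl U' (U *\<^sub>v y)))\<^sup>2"
      using proj_pythagoras[OF U' Uy] unfolding MT[OF y] vnorm_orthonormal_cols[OF U y] .
    have "(vnorm (proj_compl U' (U *\<^sub>v y)))\<^sup>2 \<le> (s * vnorm y)\<^sup>2" by (rule power_mono[OF a[OF y] vnorm_nonneg])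
    then show "(1 - s\<^sup>2) * (vnorm y)\<^sup>2 \<le> (vnorm (transpose_mat M *\<^sub>v y))\<^sup>2"
      using p by (simp add: power_mult_distrib left_diff_distrib)
    show "vnorm (transpose_mat M *\<^sub>v y) \<le> vnorm y"
      by (rule power2_le_imp_le) (simp_all add: p)
  qed
  then obtain Q where Q: "Q \<in> orth_group r"
    "\<forall>y\<in>carrier_vec r. vnorm (transpose_mat M *\<^sub>v y - transpose_mat Q *\<^sub>v y) \<le> s\<^sup>2 * vnorm y" by blast
  have Qc: "Q \<in> carrier_mat r r" using Q(1) by (simp add: orth_group_def orthonormal_cols_def)
  have "norm_2inf (U' - U * Q) \<le> norm_2inf U * s\<^sup>2 + b"
    unfolding norm_2inf_le_iff
  proof (intro conjI allI impI)
    show "0 \<le> norm_2inf U * s\<^sup>2 + b" using norm_2inf_nonneg[of U] b(1) by simp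
  next
    fix i assume "i < dim_row (U' - U * Q)"
    then have i: "i < n" using Uc Qc by simp
    define u where "u = transpose_mat U *\<^sub>v unit_vec n i"
    define w where "w = proj_compl U (unit_vec n i)"
    have e: "unit_vec n i \<in> carrier_vec n" by simp
    have u: "u \<in> carrier_vec r" unfolding u_def by (rule proj_carrier(3)[OF U e])
    have w: "w \<in> carrier_vec n" unfolding w_def by (rule proj_carrier(2)[OF U e])
    have urow: "u = row U i" unfolding u_def using Uc i by (intro eq_vecI) auto
    have "transpose_mat U' *\<^sub>v unit_vec n i = transpose_mat U' *\<^sub>v (U *\<^sub>v u + w)"
      using proj_plus_compl[OF U e] by (simp only: u_def w_def proj_def)
    also have "\<dots> = transpose_mat U' *\<^sub>v (U *\<^sub>v u) + transpose_mat U' *\<^sub>v w"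
      by (rule mult_add_distrib_mat_vec[OF Uc'(2) _ w]) (use Uc u in simp)
    finally have 1: "transpose_mat U' *\<^sub>v unit_vec n i = transpose_mat M *\<^sub>v u + transpose_mat U' *\<^sub>v w"
      unfolding MT[OF u] .
    have r1: "transpose_mat U' *\<^sub>v unit_vec n i = row U' i" using Uc' i by (intro eq_vecI) auto
    have r2: "row (U * Q) i = transpose_mat Q *\<^sub>v u"
      unfolding urow using Uc Qc i by (intro eq_vecI) (auto simp: comm_scalar_prod[of "row U i" r])
    have Uw: "transpose_mat U' *\<^sub>v w \<in> carrier_vec r" by (rule proj_carrier(3)[OF U' w])
    have c1: "transpose_mat M *\<^sub>v u \<in> carrier_vec r" "transpose_mat Q *\<^sub>v u \<in> carrier_vec r" using M Qc u by auto
    have vec_arith: "(a + c) - b = (a - b) + c"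
      if "a \<in> carrier_vec r" "b \<in> carrier_vec r" "c \<in> carrier_vec r" for a b c :: "real vec"
      using that by (intro eq_vecI) auto
    have "row (U' - U * Q) i = row U' i - row (U * Q) i" using Uc Uc' Qc i by (intro eq_vecI) auto
    also have "\<dots> = (transpose_mat M *\<^sub>v u - transpose_mat Q *\<^sub>v u) + transpose_mat U' *\<^sub>v w"
      unfolding r1[symmetric] r2 1 by (rule vec_arith[OF c1 Uw])
    finally have row: "row (U' - U * Q) i = (transpose_mat M *\<^sub>v u - transpose_mat Q *\<^sub>v u) + transpose_mat U' *\<^sub>v w" .
    have "vnorm (row (U' - U * Q) i) \<le> vnorm (transpose_mat M *\<^sub>v u - transpose_mat Q *\<^sub>v u) + vnorm (transpose_mat U' *\<^sub>v w)"
      unfolding row by (rule vnorm_add_le) (simp only: carrier_vecD[OF minus_carrier_vec[OF c1]] carrier_vecD[OF Uw])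
    moreover have "vnorm (transpose_mat M *\<^sub>v u - transpose_mat Q *\<^sub>v u) \<le> s\<^sup>2 * vnorm u" using Q(2) u by blast
    moreover have "s\<^sup>2 * vnorm u \<le> s\<^sup>2 * norm_2inf U"
      unfolding urow using i Uc by (intro mult_left_mono vnorm_row_le_norm_2inf) auto
    moreover have "vnorm (transpose_mat U' *\<^sub>v w) \<le> b" unfolding w_def by (rule b(2)[OF i])
    ultimately show "vnorm (row (U' - U * Q) i) \<le> norm_2inf U * s\<^sup>2 + b" by (simp add: mult.commute)
  qed
  moreover have "(INF Q\<in>orth_group r. norm_2inf (U' - U * Q)) \<le> norm_2inf (U' - U * Q)"
  proof (rule cINF_lower[OF _ Q(1)])
    show "bdd_below ((\<lambda>Q. norm_2inf (U' - U * Q)) ` orth_group r)"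
      by (rule bdd_belowI2[of _ 0]) (rule norm_2inf_nonneg)
  qed
  ultimately show ?thesis by linarith
qed

lemma proj_complement_norm_bound:
  assumes U: "orthonormal_cols n r U" and U': "orthonormal_cols n r U'" and s: "0 \<le> s" "s < 1"
    and b: "\<And>z. z \<in> carrier_vec r \<Longrightarrow> vnorm (proj_compl U (U' *\<^sub>v z)) \<le> s * vnorm z"
    and w: "w \<in> carrier_vec n"
  shows "(1 - s\<^sup>2) * (vnorm (transpose_mat U' *\<^sub>v w))\<^sup>2 \<le> (vnorm (transpose_mat U *\<^sub>v proj U' w))\<^sup>2"
proof -
  define h where "h = transpose_mat U' *\<^sub>v w"
  have h: "h \<in> carrier_vec r" unfolding h_def by (rule proj_carrier(3)[OF U' w])
  have Uh: "U' *\<^sub>v h \<in> carrier_vec n" using orthonormal_colsD(1)[OF U'] h by simp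
  have "(vnorm h)\<^sup>2 = (vnorm (transpose_mat U *\<^sub>v (U' *\<^sub>v h)))\<^sup>2 + (vnorm (proj_compl U (U' *\<^sub>v h)))\<^sup>2"
    using proj_pythagoras[OF U Uh] unfolding vnorm_orthonormal_cols[OF U' h] .
  moreover have "(vnorm (proj_compl U (U' *\<^sub>v h)))\<^sup>2 \<le> (s * vnorm h)\<^sup>2" by (rule power_mono[OF b[OF h] vnorm_nonneg])
  ultimately show ?thesis unfolding proj_def h_def[symmetric] by (simp add: power_mult_distrib left_diff_distrib)
qed

subsection \<open>Reflections fixing the matrix\<close>

definition householder :: "nat \<Rightarrow> real mat \<Rightarrow> real mat" where
  "householder n U = 1\<^sub>m n - 2 \<cdot>\<^sub>m (U * transpose_mat U)"

lemma mat_eq_of_mult_vec: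
  fixes A B :: "real mat"
  assumes A: "A \<in> carrier_mat n m" and B: "B \<in> carrier_mat n m"
    and eq: "\<And>y. y \<in> carrier_vec m \<Longrightarrow> A *\<^sub>v y = B *\<^sub>v y"
  shows "A = B"
proof (rule mat_eq_colsI[OF A B])
  fix j assume j: "j < m"
  have "C *\<^sub>v unit_vec m j = col C j" if "C \<in> carrier_mat n m" for C :: "real mat"
    using that j by (intro eq_vecI) auto
  then show "col A j = col B j" using eq[of "unit_vec m j"] A B by simp
qed

context
  fixes n r :: nat and U :: "real mat"
  assumes U: "orthonormal_cols n r U"
begin

lemma householder_carrier: "householder n U \<in> carrier_mat n n"
  unfolding householder_def by (rule minus_carrier_mat) (use orthonormal_colsD(1)[OF U] in simp)

lemma householder_transpose: "transpose_mat (householder n U) = householder n U"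
proof (rule eq_matI)
  fix i j assume "i < dim_row (householder n U)" "j < dim_col (householder n U)"
  then have ij: "i < n" "j < n" using householder_carrier by auto
  have "row U j \<bullet> row U i = row U i \<bullet> row U j"
    by (rule comm_scalar_prod[of _ r]) (use orthonormal_colsD(1)[OF U] ij in auto)
  then show "transpose_mat (householder n U) $$ (i,j) = householder n U $$ (i,j)"
    using ij orthonormal_colsD(1)[OF U] by (simp add: householder_def)
qed (use householder_carrier in auto)

lemma householder_mult_vec:
  assumes x: "x \<in> carrier_vec n"
  shows "householder n U *\<^sub>v x = x - 2 \<cdot>\<^sub>v proj U x"
proof -
  have UU: "U * transpose_mat U \<in> carrier_mat n n" using orthonormal_colsD(1)[OF U] by simp
  have "householder n U *\<^sub>v x = 1\<^sub>m n *\<^sub>v x - (2 \<cdot>\<^sub>m (U * transpose_mat U)) *\<^sub>v x"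
    unfolding householder_def by (rule minus_mult_distrib_mat_vec[of _ n n]) (use UU x in auto)
  also have "(2 \<cdot>\<^sub>m (U * transpose_mat U)) *\<^sub>v x = 2 \<cdot>\<^sub>v ((U * transpose_mat U) *\<^sub>v x)"
  proof -
    have "(2 \<cdot>\<^sub>m X) *\<^sub>v x = 2 \<cdot>\<^sub>v (X *\<^sub>v x)" if "X \<in> carrier_mat n n" for X :: "real mat"
      using that x by (intro eq_vecI) (auto simp: scalar_prod_def sum_distrib_left mult.assoc)
    then show ?thesis using UU .
  qed
  also have "(U * transpose_mat U) *\<^sub>v x = proj U x"
    unfolding proj_def by (rule assoc_mult_mat_vec[OF orthonormal_colsD(1,2)[OF U] x])
  finally show ?thesis using x by simp
qed

lemma transpose_mult_householder:
  assumes x: "x \<in> carrier_vec n"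
  shows "transpose_mat U *\<^sub>v (householder n U *\<^sub>v x) = - (transpose_mat U *\<^sub>v x)"
proof -
  note c = proj_carrier[OF U x]
  have p2: "2 \<cdot>\<^sub>v proj U x \<in> carrier_vec n" using c by simp
  have 1: "transpose_mat U *\<^sub>v proj U x = transpose_mat U *\<^sub>v x"
    unfolding proj_def by (rule orthonormal_cols_transpose_mult[OF U c(3)])
  have "transpose_mat U *\<^sub>v (householder n U *\<^sub>v x) = transpose_mat U *\<^sub>v x - 2 \<cdot>\<^sub>v (transpose_mat U *\<^sub>v x)"
    unfolding householder_mult_vec[OF x] mult_minus_distrib_mat_vec[OF orthonormal_colsD(2)[OF U] x p2]
      mult_mat_vec[OF orthonormal_colsD(2)[OF U] c(1)] 1 ..
  moreover have "y - 2 \<cdot>\<^sub>v y = - y" for y :: "real vec" by (intro eq_vecI) auto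
  ultimately show ?thesis by simp
qed

lemma householder_involution_vec:
  assumes x: "x \<in> carrier_vec n"
  shows "householder n U *\<^sub>v (householder n U *\<^sub>v x) = x"
proof -
  note c = proj_carrier[OF U x]
  have h: "householder n U *\<^sub>v x \<in> carrier_vec n" using householder_carrier x by simp
  have "proj U (householder n U *\<^sub>v x) = U *\<^sub>v (- (transpose_mat U *\<^sub>v x))"
    unfolding proj_def transpose_mult_householder[OF x] ..
  also have "\<dots> = - proj U x"
  proof -
    have m: "- y = (-1) \<cdot>\<^sub>v y" for y :: "real vec" by (intro eq_vecI) auto
    show ?thesis unfolding proj_def m by (rule mult_mat_vec[OF orthonormal_colsD(1)[OF U] c(3)])
  qed
  finally have 1: "householder n U *\<^sub>v (householder n U *\<^sub>v x) = (x - 2 \<cdot>\<^sub>v proj U x) - 2 \<cdot>\<^sub>v (- proj U x)"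
    unfolding householder_mult_vec[OF h] by (simp only: householder_mult_vec[OF x])
  have "(a - 2 \<cdot>\<^sub>v b) - 2 \<cdot>\<^sub>v (- b) = a" if "a \<in> carrier_vec n" "b \<in> carrier_vec n" for a b :: "real vec"
    using that by (intro eq_vecI) auto
  then show ?thesis unfolding 1 using x c(1) by blast
qed

lemma householder_involution: "householder n U * householder n U = 1\<^sub>m n"
proof (rule mat_eq_of_mult_vec)
  fix y :: "real vec" assume y: "y \<in> carrier_vec n"
  show "(householder n U * householder n U) *\<^sub>v y = 1\<^sub>m n *\<^sub>v y"
    unfolding assoc_mult_mat_vec[OF householder_carrier householder_carrier y] householder_involution_vec[OF y]
    using y by simp
qed (use householder_carrier in auto)

lemma orthonormal_cols_householder: "orthonormal_cols n n (householder n U)"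
  unfolding orthonormal_cols_def householder_transpose using householder_carrier householder_involution by simp

lemma householder_fixes_complement:
  assumes "x \<in> carrier_vec n" "transpose_mat U *\<^sub>v x = 0\<^sub>v r"
  shows "householder n U *\<^sub>v x = x"
proof -
  have "proj U x = 0\<^sub>v n" unfolding proj_def assms(2) using orthonormal_colsD(1)[OF U] by (intro eq_vecI) auto
  then show ?thesis unfolding householder_mult_vec[OF assms(1)] using assms(1) by (intro eq_vecI) auto
qed

end

lemma householder_conjugate_fixes:
  fixes A :: "real mat"
  assumes U: "orthonormal_cols n r U" and V: "orthonormal_cols m r V" and A: "A \<in> carrier_mat n m"
    and AV: "A * V = U * mat r r (\<lambda>(i,j). if i = j then s i else 0)"
    and AU: "transpose_mat A * U = V * mat r r (\<lambda>(i,j). if i = j then s i else 0)"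
  shows "householder n U * A * householder m V = A"
proof (rule mat_eq_of_mult_vec)
  note H = householder_carrier[OF U] householder_carrier[OF V]
  fix y :: "real vec" assume y: "y \<in> carrier_vec m"
  have Hy: "householder m V *\<^sub>v y \<in> carrier_vec m" using H y by simp
  have Ay: "A *\<^sub>v y \<in> carrier_vec n" using A y by simp
  have p: "proj V y \<in> carrier_vec m" by (rule proj_carrier(1)[OF V y])
  have p2: "2 \<cdot>\<^sub>v proj V y \<in> carrier_vec m" using p by simp
  have "A *\<^sub>v (householder m V *\<^sub>v y) = A *\<^sub>v y - 2 \<cdot>\<^sub>v (A *\<^sub>v proj V y)"
    unfolding householder_mult_vec[OF V y] mult_minus_distrib_mat_vec[OF A y p2] mult_mat_vec[OF A p] ..
  also have "\<dots> = householder n U *\<^sub>v (A *\<^sub>v y)"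
    unfolding householder_mult_vec[OF U Ay] proj_intertwine[OF U V A AV AU y] ..
  finally have 1: "A *\<^sub>v (householder m V *\<^sub>v y) = householder n U *\<^sub>v (A *\<^sub>v y)" .
  have "(householder n U * A * householder m V) *\<^sub>v y = householder n U *\<^sub>v (A *\<^sub>v (householder m V *\<^sub>v y))"
    unfolding assoc_mult_mat_vec[OF mult_carrier_mat[OF H(1) A] H(2) y] assoc_mult_mat_vec[OF H(1) A Hy] ..
  then show "(householder n U * A * householder m V) *\<^sub>v y = A *\<^sub>v y"
    unfolding 1 householder_involution_vec[OF U Ay] .
qed (use householder_carrier[OF U] householder_carrier[OF V] A in auto)

lemma sing_val_orthogonal_invariant:
  fixes B :: "real mat"
  assumes B: "B \<in> carrier_mat n m" and H: "H \<in> carrier_mat n n" "transpose_mat H = H" "H * H = 1\<^sub>m n"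
    and K: "K \<in> carrier_mat m m" "transpose_mat K = K" "K * K = 1\<^sub>m m"
  shows "sing_val (H * B * K) = sing_val B"
proof -
  have HB: "H * B \<in> carrier_mat n m" and BT: "transpose_mat B \<in> carrier_mat m n" using H B by auto
  have T: "transpose_mat (H * B * K) = K * (transpose_mat B * H)"
    by (simp only: transpose_mult[OF HB K(1)] transpose_mult[OF H(1) B] H(2) K(2))
  have BH: "transpose_mat B * H \<in> carrier_mat m n" using BT H by simp
  have "H * B * K * (K * (transpose_mat B * H)) = H * B * (K * (K * (transpose_mat B * H)))"
    by (rule assoc_mult_mat[OF HB K(1) mult_carrier_mat[OF K(1) BH]])
  also have "K * (K * (transpose_mat B * H)) = transpose_mat B * H"
    by (simp only: assoc_mult_mat[OF K(1,1) BH, symmetric] K(3) left_mult_one_mat[OF BH])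
  also have "H * B * (transpose_mat B * H) = H * (B * transpose_mat B) * H"
    using assoc_mult_mat[OF HB BT H(1)] assoc_mult_mat[OF H(1) B BT] by simp
  finally have G: "H * B * K * transpose_mat (H * B * K) = H * (B * transpose_mat B) * H" unfolding T .
  have "similar_mat_wit (H * (B * transpose_mat B) * H) (B * transpose_mat B) H H"
    using H B by (auto simp: similar_mat_wit_def Let_def)
  then have "char_poly (H * (B * transpose_mat B) * H) = char_poly (B * transpose_mat B)"
    by (intro char_poly_similar) (auto simp: similar_mat_def)
  moreover have "dim_row (H * B * K) = dim_row B" "dim_col (H * B * K) = dim_col B" using H B K by auto
  ultimately have "sing_vals (H * B * K) = sing_vals B" unfolding sing_vals_def G by simp
  then show ?thesis by (intro ext) (simp add: sing_val_def)
qed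

lemma leading_left_sing_vecs_orthogonal:
  fixes B :: "real mat"
  assumes B: "B \<in> carrier_mat n m" and H: "H \<in> carrier_mat n n" "transpose_mat H = H" "H * H = 1\<^sub>m n"
    and K: "K \<in> carrier_mat m m" "transpose_mat K = K" "K * K = 1\<^sub>m m"
    and W: "leading_left_sing_vecs B r W"
  shows "leading_left_sing_vecs (H * B * K) r (H * W)"
proof -
  let ?S = "mat r r (\<lambda>(i,j). if i = j then sing_val B (i + 1) else 0)"
  obtain V where V: "orthonormal_cols m r V" and BV: "B * V = W * ?S" and BW: "transpose_mat B * W = V * ?S"
    using W B unfolding leading_left_sing_vecs_def by auto
  have Wo: "orthonormal_cols n r W" using W B unfolding leading_left_sing_vecs_def by auto
  note Wc = orthonormal_colsD[OF Wo] and Vc = orthonormal_colsD[OF V]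
  have on: "orthonormal_cols k r (L * X)" if L: "L \<in> carrier_mat k k" "transpose_mat L = L" "L * L = 1\<^sub>m k"
    and X: "orthonormal_cols k r X" for k L X
  proof -
    note Xc = orthonormal_colsD[OF X]
    have LX: "L * X \<in> carrier_mat k r" using L Xc by simp
    have "transpose_mat (L * X) * (L * X) = transpose_mat X * (L * (L * X))"
      unfolding transpose_mult[OF L(1) Xc(1)] L(2) by (rule assoc_mult_mat[OF Xc(2) L(1) LX])
    also have "L * (L * X) = X" by (simp only: assoc_mult_mat[OF L(1,1) Xc(1), symmetric] L(3) left_mult_one_mat[OF Xc(1)])
    finally show ?thesis using LX Xc(3) by (simp add: orthonormal_cols_def)
  qed
  have HB: "H * B \<in> carrier_mat n m" and KV: "K * V \<in> carrier_mat m r" and HW: "H * W \<in> carrier_mat n r"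
    and BT: "transpose_mat B \<in> carrier_mat m n" using H K B Vc Wc by auto
  have S: "?S \<in> carrier_mat r r" by simp
  have KKV: "K * (K * V) = V" by (simp only: assoc_mult_mat[OF K(1,1) Vc(1), symmetric] K(3) left_mult_one_mat[OF Vc(1)])
  have HHW: "H * (H * W) = W" by (simp only: assoc_mult_mat[OF H(1,1) Wc(1), symmetric] H(3) left_mult_one_mat[OF Wc(1)])
  have 1: "H * B * K * (K * V) = H * W * ?S"
    by (simp only: assoc_mult_mat[OF HB K(1) KV] KKV assoc_mult_mat[OF H(1) B Vc(1)] BV assoc_mult_mat[OF H(1) Wc(1) S])
  have "transpose_mat (H * B * K) = K * (transpose_mat B * H)"
    by (simp only: transpose_mult[OF HB K(1)] transpose_mult[OF H(1) B] H(2) K(2))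
  moreover have "K * (transpose_mat B * H) * (H * W) = K * V * ?S"
  proof -
    have "K * (transpose_mat B * H) * (H * W) = K * ((transpose_mat B * H) * (H * W))"
      by (rule assoc_mult_mat[OF K(1) mult_carrier_mat[OF BT H(1)] HW])
    then show ?thesis
      by (simp only: assoc_mult_mat[OF BT H(1) HW] HHW BW assoc_mult_mat[OF K(1) Vc(1) S])
  qed
  ultimately have 2: "transpose_mat (H * B * K) * (H * W) = K * V * ?S" by simp
  have d: "dim_row (H * B * K) = n" "dim_col (H * B * K) = m" using H K by auto
  show ?thesis
    unfolding leading_left_sing_vecs_def d sing_val_orthogonal_invariant[OF B H K]
    using on[OF H Wo] on[OF K V] 1 2 by blast
qed

definition left_family :: "real mat \<Rightarrow> nat \<times> nat \<Rightarrow> nat \<times> nat \<Rightarrow> real" where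
  "left_family U = (\<lambda>(k, j0) (i, j). if j = j0 then U $$ (i, k) else 0)"

definition right_family :: "real mat \<Rightarrow> nat \<times> nat \<Rightarrow> nat \<times> nat \<Rightarrow> real" where
  "right_family V = (\<lambda>(i0, k) (i, j). if i = i0 then V $$ (j, k) else 0)"

lemma orthonormal_cols_sum:
  assumes U: "orthonormal_cols n r U" and k: "k < r" "l < r"
  shows "(\<Sum>i=0..<n. U $$ (i,k) * U $$ (i,l)) = (if k = l then 1 else 0)"
proof -
  have "(\<Sum>i=0..<n. U $$ (i,k) * U $$ (i,l)) = (transpose_mat U * U) $$ (k,l)"
    using orthonormal_colsD(1)[OF U] k by (simp add: scalar_prod_def)
  then show ?thesis unfolding orthonormal_colsD(3)[OF U] using k by simp
qed

lemma left_family_orthonormal: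
  assumes U: "orthonormal_cols n r U" and p: "p \<in> {0..<r} \<times> {0..<m}" "q \<in> {0..<r} \<times> {0..<m}"
  shows "(\<Sum>x\<in>{0..<n} \<times> {0..<m}. left_family U p x * left_family U q x) = (if p = q then 1 else 0)"
proof -
  obtain k j0 l j1 where pq: "p = (k, j0)" "q = (l, j1)" by (cases p; cases q) auto
  have "(\<Sum>x\<in>{0..<n} \<times> {0..<m}. left_family U p x * left_family U q x) =
      (\<Sum>i=0..<n. \<Sum>j=0..<m. if j = j0 then (if j0 = j1 then U $$ (i,k) * U $$ (i,l) else 0) else 0)"
    unfolding sum.cartesian_product' by (intro sum.cong refl) (auto simp: left_family_def pq)
  also have "\<dots> = (\<Sum>i=0..<n. if j0 = j1 then U $$ (i,k) * U $$ (i,l) else 0)" using p pq by simp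
  also have "\<dots> = (if p = q then 1 else 0)"
    using orthonormal_cols_sum[OF U, of k l] p pq by (cases "j0 = j1") auto
  finally show ?thesis .
qed

lemma right_family_orthonormal:
  assumes V: "orthonormal_cols m r V" and p: "p \<in> {0..<n} \<times> {0..<r}" "q \<in> {0..<n} \<times> {0..<r}"
  shows "(\<Sum>x\<in>{0..<n} \<times> {0..<m}. right_family V p x * right_family V q x) = (if p = q then 1 else 0)"
proof -
  obtain k i0 l i1 where pq: "p = (i0, k)" "q = (i1, l)" by (cases p; cases q) auto
  have "(\<Sum>x\<in>{0..<n} \<times> {0..<m}. right_family V p x * right_family V q x) =
      (\<Sum>i=0..<n. \<Sum>j=0..<m. right_family V p (i,j) * right_family V q (i,j))"
    unfolding sum.cartesian_product' ..
  also have "\<dots> = (\<Sum>i=0..<n. if i = i0 then (if i0 = i1 then (\<Sum>j=0..<m. V $$ (j,k) * V $$ (j,l)) else 0) else 0)"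
    by (intro sum.cong refl) (auto simp: right_family_def pq)
  also have "\<dots> = (if i0 = i1 then (\<Sum>j=0..<m. V $$ (j,k) * V $$ (j,l)) else 0)" using p pq by simp
  also have "\<dots> = (if p = q then 1 else 0)" using orthonormal_cols_sum[OF V, of k l] p pq by (cases "i0 = i1") auto
  finally show ?thesis .
qed

lemma proj_index:
  assumes U: "orthonormal_cols n r U" and x: "x \<in> carrier_vec n" and i: "i < n"
  shows "proj U x $ i = (\<Sum>k=0..<r. (\<Sum>i'=0..<n. U $$ (i',k) * x $ i') * U $$ (i,k))"
proof -
  note c = orthonormal_colsD(1)[OF U]
  have "(transpose_mat U *\<^sub>v x) $ k = (\<Sum>i'=0..<n. U $$ (i',k) * x $ i')" if "k < r" for k
    using that c x by (simp add: scalar_prod_def)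
  moreover have "proj U x $ i = (\<Sum>k=0..<r. U $$ (i,k) * (transpose_mat U *\<^sub>v x) $ k)"
    unfolding proj_def using c x i by (simp add: scalar_prod_def)
  ultimately show ?thesis by (simp add: mult.commute)
qed

lemma noise_mat_left_reflections:
  assumes U: "orthonormal_cols n r U"
  shows "noise_mat n m (reflections ({0..<n} \<times> {0..<m}) ({0..<r} \<times> {0..<m}) (left_family U) f) =
    householder n U * noise_mat n m f"
proof (rule eq_matI)
  note H = householder_carrier[OF U]
  have N: "noise_mat n m f \<in> carrier_mat n m" by (simp add: noise_mat_def)
  fix i j assume "i < dim_row (householder n U * noise_mat n m f)" "j < dim_col (householder n U * noise_mat n m f)"
  then have i: "i < n" and j: "j < m" using H N by auto
  define F where "F p = (\<Sum>x\<in>{0..<n} \<times> {0..<m}. left_family U p x * f x)" for p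
  have Fk: "F (k,j0) = (\<Sum>i'=0..<n. U $$ (i',k) * f (i',j0))" if "j0 < m" for k j0
  proof -
    have "F (k,j0) = (\<Sum>i'=0..<n. \<Sum>j'=0..<m. if j' = j0 then U $$ (i',k) * f (i',j0) else 0)"
      unfolding F_def sum.cartesian_product' by (intro sum.cong refl) (auto simp: left_family_def)
    then show ?thesis using that by simp
  qed
  have "(\<Sum>p\<in>{0..<r} \<times> {0..<m}. F p * left_family U p (i,j)) =
      (\<Sum>k=0..<r. \<Sum>j0=0..<m. if j0 = j then F (k,j) * U $$ (i,k) else 0)"
    unfolding sum.cartesian_product' by (intro sum.cong refl) (auto simp: left_family_def)
  also have "\<dots> = (\<Sum>k=0..<r. (\<Sum>i'=0..<n. U $$ (i',k) * f (i',j)) * U $$ (i,k))" using j by (simp add: Fk)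
  also have "\<dots> = proj U (col (noise_mat n m f) j) $ i"
    using i j N by (subst proj_index[OF U]) (auto simp: noise_mat_def)
  finally have "noise_mat n m (reflections ({0..<n} \<times> {0..<m}) ({0..<r} \<times> {0..<m}) (left_family U) f) $$ (i,j) =
      f (i,j) - 2 * proj U (col (noise_mat n m f) j) $ i"
    using i j by (simp add: noise_mat_def reflections_def F_def)
  moreover have "(householder n U * noise_mat n m f) $$ (i,j) = (householder n U *\<^sub>v col (noise_mat n m f) j) $ i"
    using i j H N by simp
  moreover have c: "col (noise_mat n m f) j \<in> carrier_vec n" using N j by auto
  moreover have "(col (noise_mat n m f) j - 2 \<cdot>\<^sub>v proj U (col (noise_mat n m f) j)) $ i = f (i,j) - 2 * proj U (col (noise_mat n m f) j) $ i"
    using i j proj_carrier(1)[OF U c] by (simp add: noise_mat_def)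
  ultimately show "noise_mat n m (reflections ({0..<n} \<times> {0..<m}) ({0..<r} \<times> {0..<m}) (left_family U) f) $$ (i,j) =
      (householder n U * noise_mat n m f) $$ (i,j)" by (simp only: householder_mult_vec[OF U c])
qed (use householder_carrier[OF U] in \<open>auto simp: noise_mat_def\<close>)

lemma noise_mat_right_reflections:
  assumes V: "orthonormal_cols m r V"
  shows "noise_mat n m (reflections ({0..<n} \<times> {0..<m}) ({0..<n} \<times> {0..<r}) (right_family V) f) =
    noise_mat n m f * householder m V"
proof (rule eq_matI)
  note H = householder_carrier[OF V]
  have N: "noise_mat n m f \<in> carrier_mat n m" by (simp add: noise_mat_def)
  fix i j assume "i < dim_row (noise_mat n m f * householder m V)" "j < dim_col (noise_mat n m f * householder m V)"
  then have i: "i < n" and j: "j < m" using H N by auto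
  define F where "F p = (\<Sum>x\<in>{0..<n} \<times> {0..<m}. right_family V p x * f x)" for p
  have Fk: "F (i0,k) = (\<Sum>j'=0..<m. V $$ (j',k) * f (i0,j'))" if "i0 < n" for k i0
  proof -
    have "F (i0,k) = (\<Sum>i'=0..<n. \<Sum>j'=0..<m. right_family V (i0,k) (i',j') * f (i',j'))"
      unfolding F_def sum.cartesian_product' ..
    also have "\<dots> = (\<Sum>i'=0..<n. if i' = i0 then (\<Sum>j'=0..<m. V $$ (j',k) * f (i0,j')) else 0)"
      by (intro sum.cong refl) (auto simp: right_family_def)
    finally show ?thesis using that by simp
  qed
  have "(\<Sum>p\<in>{0..<n} \<times> {0..<r}. F p * right_family V p (i,j)) =
      (\<Sum>i0=0..<n. \<Sum>k=0..<r. F (i0,k) * right_family V (i0,k) (i,j))"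
    unfolding sum.cartesian_product' ..
  also have "\<dots> = (\<Sum>i0=0..<n. if i0 = i then (\<Sum>k=0..<r. F (i,k) * V $$ (j,k)) else 0)"
    by (intro sum.cong refl) (auto simp: right_family_def)
  also have "\<dots> = (\<Sum>k=0..<r. (\<Sum>j'=0..<m. V $$ (j',k) * f (i,j')) * V $$ (j,k))" using i by (simp add: Fk)
  also have "\<dots> = proj V (row (noise_mat n m f) i) $ j"
    using i j N by (subst proj_index[OF V]) (auto simp: noise_mat_def)
  finally have "noise_mat n m (reflections ({0..<n} \<times> {0..<m}) ({0..<n} \<times> {0..<r}) (right_family V) f) $$ (i,j) =
      f (i,j) - 2 * proj V (row (noise_mat n m f) i) $ j"
    using i j by (simp add: noise_mat_def reflections_def F_def)
  moreover have c: "row (noise_mat n m f) i \<in> carrier_vec m" using N i by auto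
  moreover have "(noise_mat n m f * householder m V) $$ (i,j) = (householder m V *\<^sub>v row (noise_mat n m f) i) $ j"
  proof -
    have "col (householder m V) j = row (householder m V) j"
      using householder_transpose[OF V] H j by (metis carrier_matD(1) row_transpose transpose_carrier_mat carrier_matD(2))
    then show ?thesis using i j H N comm_scalar_prod[OF c, of "col (householder m V) j"] by simp
  qed
  moreover have "(row (noise_mat n m f) i - 2 \<cdot>\<^sub>v proj V (row (noise_mat n m f) i)) $ j = f (i,j) - 2 * proj V (row (noise_mat n m f) i) $ j"
    using i j proj_carrier(1)[OF V c] by (simp add: noise_mat_def)
  ultimately show "noise_mat n m (reflections ({0..<n} \<times> {0..<m}) ({0..<n} \<times> {0..<r}) (right_family V) f) $$ (i,j) =
      (noise_mat n m f * householder m V) $$ (i,j)" by (simp only: householder_mult_vec[OF V c])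
qed (use householder_carrier[OF V] in \<open>auto simp: noise_mat_def\<close>)

subsection \<open>Concentration of the rows\<close>

lemma vnorm_minus_commute: "dim_vec x = dim_vec y \<Longrightarrow> vnorm (x - y) = vnorm (y - x)"
  by (simp add: vnorm_eq_L2_set L2_set_def power2_commute)

lemma transpose_difference_bound:
  fixes A B :: "real mat"
  assumes A: "A \<in> carrier_mat n m" and B: "B \<in> carrier_mat n m" and e: "0 \<le> e"
    and AB: "\<And>y. y \<in> carrier_vec m \<Longrightarrow> vnorm (A *\<^sub>v y - B *\<^sub>v y) \<le> e * vnorm y"
    and x: "x \<in> carrier_vec n"
  shows "vnorm (transpose_mat A *\<^sub>v x - transpose_mat B *\<^sub>v x) \<le> e * vnorm x"
proof (rule vnorm_le_of_square)
  define a b where "a = transpose_mat A *\<^sub>v x" and "b = transpose_mat B *\<^sub>v x"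
  define h where "h = a - b"
  have ab: "a \<in> carrier_vec m" "b \<in> carrier_vec m" using A B x by (auto simp: a_def b_def)
  have h: "h \<in> carrier_vec m" using ab by (simp add: h_def)
  have Ah: "A *\<^sub>v h \<in> carrier_vec n" "B *\<^sub>v h \<in> carrier_vec n" using A B h by auto
  have "h \<bullet> h = a \<bullet> h - b \<bullet> h"
    by (subst (1) h_def) (rule minus_scalar_prod_distrib[OF ab h])
  also have "a \<bullet> h = x \<bullet> (A *\<^sub>v h)" unfolding a_def by (rule transpose_vec_mult_scalar[OF A h x])
  also have "b \<bullet> h = x \<bullet> (B *\<^sub>v h)" unfolding b_def by (rule transpose_vec_mult_scalar[OF B h x])
  finally have hh: "h \<bullet> h = x \<bullet> (A *\<^sub>v h - B *\<^sub>v h)" using scalar_prod_minus_distrib[OF x Ah] by simp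
  have "x \<bullet> (A *\<^sub>v h - B *\<^sub>v h) \<le> vnorm x * vnorm (A *\<^sub>v h - B *\<^sub>v h)"
    using scalar_prod_abs_le[of x "A *\<^sub>v h - B *\<^sub>v h"] carrier_vecD[OF minus_carrier_vec[OF Ah]] x by simp
  also have "\<dots> \<le> vnorm x * (e * vnorm h)" by (intro mult_left_mono AB[OF h] vnorm_nonneg)
  finally show "(transpose_mat A *\<^sub>v x - transpose_mat B *\<^sub>v x) \<bullet> (transpose_mat A *\<^sub>v x - transpose_mat B *\<^sub>v x)
      \<le> e * vnorm x * vnorm (transpose_mat A *\<^sub>v x - transpose_mat B *\<^sub>v x)"
    unfolding a_def[symmetric] b_def[symmetric] h_def[symmetric] hh by (simp add: mult.commute mult.left_commute)
qed (use e in simp)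

lemma leading_left_sing_vecs_near:
  assumes A: "A \<in> carrier_mat n m" and B: "B \<in> carrier_mat n m" "B' \<in> carrier_mat n m" and r: "1 \<le> r" "r < min n m"
    and U: "leading_left_sing_vecs B r U" and U': "leading_left_sing_vecs B' r U'"
    and e: "0 \<le> e" "0 \<le> e'" "e + e' < sing_val A r - sing_val A (r + 1)" "2 * e' < sing_val A r - sing_val A (r + 1)"
    and AB: "\<And>y. y \<in> carrier_vec m \<Longrightarrow> vnorm (A *\<^sub>v y - B *\<^sub>v y) \<le> e * vnorm y"
    and AB': "\<And>y. y \<in> carrier_vec m \<Longrightarrow> vnorm (A *\<^sub>v y - B' *\<^sub>v y) \<le> e' * vnorm y"
    and d: "0 \<le> d" "\<And>y. y \<in> carrier_vec m \<Longrightarrow> vnorm (B *\<^sub>v y - B' *\<^sub>v y) \<le> d * vnorm y"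
    and z: "z \<in> carrier_vec r"
  shows "vnorm (proj_compl U' (U *\<^sub>v z)) \<le> 2 * d / (sing_val A r - sing_val A (r + 1) - e - e') * vnorm z"
proof -
  have r1: "r - 1 < min n m" "r - 1 + 1 = r" using r by auto
  have up: "sing_val A r \<le> sing_val C r + c" "sing_val C (r + 1) \<le> sing_val A (r + 1) + c"
    if C: "C \<in> carrier_mat n m" and c: "0 \<le> c"
      and AC: "\<And>y. y \<in> carrier_vec m \<Longrightarrow> vnorm (A *\<^sub>v y - C *\<^sub>v y) \<le> c * vnorm y" for C c
  proof -
    have t: "vnorm (transpose_mat A *\<^sub>v x - transpose_mat C *\<^sub>v x) \<le> c * vnorm x" if "x \<in> carrier_vec n" for x
      by (rule transpose_difference_bound[OF A C c _ that]) (rule AC)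
    then have t': "vnorm (transpose_mat C *\<^sub>v x - transpose_mat A *\<^sub>v x) \<le> c * vnorm x" if "x \<in> carrier_vec n" for x
      using that vnorm_minus_commute[of "transpose_mat C *\<^sub>v x" "transpose_mat A *\<^sub>v x"] A C by simp
    have "sing_val A (r - 1 + 1) \<le> sing_val C (r - 1 + 1) + c"
      by (rule sing_val_perturbation[OF A C r1(1)]) (rule t)
    then show "sing_val A r \<le> sing_val C r + c" unfolding r1(2) .
    show "sing_val C (r + 1) \<le> sing_val A (r + 1) + c"
      by (rule sing_val_perturbation[OF C A r(2)]) (rule t')
  qed
  have b: "sing_val A r \<le> sing_val B r + e" by (rule up(1)[OF B(1) e(1)]) (rule AB)
  have b': "sing_val A r \<le> sing_val B' r + e'" "sing_val B' (r + 1) \<le> sing_val A (r + 1) + e'"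
    by (rule up[OF B(2) e(2)], rule AB', assumption)+
  have g: "sing_val B' (r + 1) < sing_val B r" "sing_val B' (r + 1) < sing_val B' r" using b b' e by linarith+
  have dT: "vnorm (transpose_mat B *\<^sub>v x - transpose_mat B' *\<^sub>v x) \<le> d * vnorm x" if "x \<in> carrier_vec n" for x
    by (rule transpose_difference_bound[OF B d(1) _ that]) (rule d(2))
  have "vnorm (proj_compl U' (U *\<^sub>v z)) \<le> 2 * d / (sing_val B r - sing_val B' (r + 1)) * vnorm z"
    by (rule leading_left_sing_vecs_perturbation[OF B r U U' g d(1) _ _ z]) (erule d(2), erule dT)
  also have "\<dots> \<le> 2 * d / (sing_val A r - sing_val A (r + 1) - e - e') * vnorm z"
    using b b' e d(1) by (intro mult_right_mono divide_left_mono mult_pos_pos) auto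
  finally show ?thesis .
qed

lemma noise_mat_carrier: "noise_mat n m f \<in> carrier_mat n m"
  by (simp add: noise_mat_def)

lemma noise_mat_mult_vec_index:
  "y \<in> carrier_vec m \<Longrightarrow> i < n \<Longrightarrow> (noise_mat n m f *\<^sub>v y) $ i = (\<Sum>j=0..<m. f (i,j) * y $ j)"
  by (simp add: noise_mat_def scalar_prod_def)

lemma vnorm_noise_mat_mult_vec:
  assumes "y \<in> carrier_vec m"
  shows "(vnorm (noise_mat n m f *\<^sub>v y))\<^sup>2 = (\<Sum>i=0..<n. (\<Sum>j=0..<m. f (i,j) * y $ j)\<^sup>2)"
proof -
  have d: "dim_vec (noise_mat n m f *\<^sub>v y) = n" by (simp add: noise_mat_def)
  have "(vnorm (noise_mat n m f *\<^sub>v y))\<^sup>2 = (\<Sum>i=0..<n. ((noise_mat n m f *\<^sub>v y) $ i)\<^sup>2)"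
    unfolding vnorm_eq_L2_set d by (rule L2_set_square_sum)
  also have "\<dots> = (\<Sum>i=0..<n. (\<Sum>j=0..<m. f (i,j) * y $ j)\<^sup>2)"
    by (intro sum.cong refl) (simp only: noise_mat_mult_vec_index[OF assms] atLeastLessThan_iff)
  finally show ?thesis .
qed

lemma noise_mat_mult_vec_le_frobenius:
  assumes y: "y \<in> carrier_vec m"
  shows "vnorm (noise_mat n m f *\<^sub>v y) \<le> L2_set f ({0..<n} \<times> {0..<m}) * vnorm y"
proof (rule power2_le_imp_le)
  have yy: "(vnorm y)\<^sup>2 = (\<Sum>j=0..<m. (y $ j)\<^sup>2)" using y by (simp add: vnorm_eq_L2_set L2_set_square_sum)
  have "(\<Sum>i=0..<n. (\<Sum>j=0..<m. f (i,j) * y $ j)\<^sup>2) \<le> (\<Sum>i=0..<n. (\<Sum>j=0..<m. (f (i,j))\<^sup>2) * (\<Sum>j=0..<m. (y $ j)\<^sup>2))"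
    by (intro sum_mono Cauchy_Schwarz_ineq_sum)
  then show "(vnorm (noise_mat n m f *\<^sub>v y))\<^sup>2 \<le> (L2_set f ({0..<n} \<times> {0..<m}) * vnorm y)\<^sup>2"
    unfolding vnorm_noise_mat_mult_vec[OF y] power_mult_distrib yy L2_set_square_sum
    by (simp add: sum_distrib_right[symmetric] sum.cartesian_product')
qed (simp add: L2_set_nonneg)

lemma noise_mat_mult_vec_le:
  assumes c: "0 \<le> c" and f: "\<And>a. (\<Sum>j=0..<m. (a j)\<^sup>2) = 1 \<Longrightarrow> (\<Sum>i=0..<n. (\<Sum>j=0..<m. f (i,j) * a j)\<^sup>2) \<le> c\<^sup>2"
    and y: "y \<in> carrier_vec m"
  shows "vnorm (noise_mat n m f *\<^sub>v y) \<le> c * vnorm y"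
proof (rule power2_le_imp_le)
  show "(vnorm (noise_mat n m f *\<^sub>v y))\<^sup>2 \<le> (c * vnorm y)\<^sup>2"
  proof (cases "vnorm y = 0")
    case True
    then have "y = 0\<^sub>v m" using vnorm_eq_0_iff[OF y] by simp
    then show ?thesis unfolding vnorm_noise_mat_mult_vec[OF y] by simp
  next
    case False
    then have pos: "0 < vnorm y" using vnorm_nonneg[of y] by linarith
    define a where "a j = y $ j / vnorm y" for j
    have yy: "(vnorm y)\<^sup>2 = (\<Sum>j=0..<m. (y $ j)\<^sup>2)" using y by (simp add: vnorm_eq_L2_set L2_set_square_sum)
    have a1: "(\<Sum>j=0..<m. (a j)\<^sup>2) = 1"
      using pos by (simp add: a_def power_divide sum_divide_distrib[symmetric] yy[symmetric])
    have "(\<Sum>j=0..<m. f (i,j) * a j) = (\<Sum>j=0..<m. f (i,j) * y $ j) / vnorm y" for i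
      by (simp add: a_def sum_divide_distrib)
    then have "(\<Sum>i=0..<n. (\<Sum>j=0..<m. f (i,j) * y $ j)\<^sup>2) / (vnorm y)\<^sup>2 \<le> c\<^sup>2"
      using f[OF a1] by (simp only: power_divide sum_divide_distrib[symmetric])
    then show ?thesis unfolding vnorm_noise_mat_mult_vec[OF y] power_mult_distrib using pos by (simp add: pos_divide_le_eq)
  qed
qed (use c in simp)

lemma add_noise_mult_vec:
  assumes A: "A \<in> carrier_mat n m" and y: "y \<in> carrier_vec m"
  shows "vnorm (A *\<^sub>v y - (A + noise_mat n m f) *\<^sub>v y) = vnorm (noise_mat n m f *\<^sub>v y)"
    and "vnorm ((A + noise_mat n m f) *\<^sub>v y - (A + noise_mat n m g) *\<^sub>v y) = vnorm (noise_mat n m (\<lambda>p. f p - g p) *\<^sub>v y)"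
proof -
  have c: "A *\<^sub>v y \<in> carrier_vec n" "noise_mat n m h *\<^sub>v y \<in> carrier_vec n" for h
    using A y noise_mat_carrier[of n m h] by auto
  have add: "(A + noise_mat n m h) *\<^sub>v y = A *\<^sub>v y + noise_mat n m h *\<^sub>v y" for h
    by (rule add_mult_distrib_mat_vec[OF A noise_mat_carrier y])
  have arith: "a - (a + u) = - u" "(a + u) - (a + v) = u - v"
    if "a \<in> carrier_vec n" "u \<in> carrier_vec n" "v \<in> carrier_vec n" for a u v :: "real vec"
    using that by (auto intro!: eq_vecI)
  have "noise_mat n m f - noise_mat n m g = noise_mat n m (\<lambda>p. f p - g p)"
    by (rule eq_matI) (auto simp: noise_mat_def)
  then have sub: "noise_mat n m f *\<^sub>v y - noise_mat n m g *\<^sub>v y = noise_mat n m (\<lambda>p. f p - g p) *\<^sub>v y"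
    using minus_mult_distrib_mat_vec[OF noise_mat_carrier[of n m f] noise_mat_carrier[of n m g] y] by simp
  show "vnorm (A *\<^sub>v y - (A + noise_mat n m f) *\<^sub>v y) = vnorm (noise_mat n m f *\<^sub>v y)"
    unfolding add arith(1)[OF c(1) c(2) c(2)] by (rule vnorm_uminus)
  show "vnorm ((A + noise_mat n m f) *\<^sub>v y - (A + noise_mat n m g) *\<^sub>v y) = vnorm (noise_mat n m (\<lambda>p. f p - g p) *\<^sub>v y)"
    unfolding add arith(2)[OF c(1) c(2) c(2)] sub ..
qed

lemma noise_mat_inject:
  assumes "f \<in> extensional ({0..<n} \<times> {0..<m})" "g \<in> extensional ({0..<n} \<times> {0..<m})"
    and eq: "noise_mat n m f = noise_mat n m g"
  shows "f = g"
proof (rule extensionalityI[OF assms(1,2)])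
  fix p assume "p \<in> {0..<n} \<times> {0..<m}"
  then obtain i j where p: "p = (i,j)" "i < n" "j < m" by auto
  then show "f p = g p" using arg_cong[OF eq, of "\<lambda>M. M $$ (i,j)"] by (simp add: noise_mat_def)
qed

lemma row_concentration:
  fixes A :: "real mat"
  assumes A: "A \<in> carrier_mat n m" and r: "1 \<le> r" "r < min n m" and \<sigma>: "0 < \<sigma>"
    and U: "leading_left_sing_vecs A r U"
    and \<gamma>: "\<gamma> = sing_val A r - sing_val A (r + 1)" "0 < \<gamma>" and e: "0 \<le> e" "7 * e \<le> 2 * \<gamma>"
    and w: "w \<in> carrier_vec n" "transpose_mat U *\<^sub>v w = 0\<^sub>v r" "vnorm w \<le> 1"
  shows "\<exists>\<Phi>\<in>borel_measurable (PiM ({0..<n} \<times> {0..<m}) (\<lambda>_. borel)).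
    (\<integral>\<^sup>+f. \<Phi> f \<partial>PiM ({0..<n} \<times> {0..<m}) (\<lambda>_. gauss \<sigma>)) \<le> ennreal (sqrt 2 ^ r) \<and>
    (\<forall>f\<in>extensional ({0..<n} \<times> {0..<m}). \<forall>W.
       (\<forall>y\<in>carrier_vec m. vnorm (noise_mat n m f *\<^sub>v y) \<le> e * vnorm y) \<longrightarrow>
       leading_left_sing_vecs (A + noise_mat n m f) r W \<longrightarrow>
       ennreal (exp ((vnorm (transpose_mat U *\<^sub>v proj W w))\<^sup>2 / (4 * \<sigma>\<^sup>2 * (28 / (3 * \<gamma>))\<^sup>2))) \<le> \<Phi> f)"
proof -
  let ?I = "{0..<n} \<times> {0..<m}"
  let ?lead = "\<lambda>f W. leading_left_sing_vecs (A + noise_mat n m f) r W"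
  let ?L = "28 / (3 * \<gamma>)"
  obtain V where V: "orthonormal_cols m r V"
    "A * V = U * mat r r (\<lambda>(i,j). if i = j then sing_val A (i + 1) else 0)"
    "transpose_mat A * U = V * mat r r (\<lambda>(i,j). if i = j then sing_val A (i + 1) else 0)"
    using U A unfolding leading_left_sing_vecs_def by auto
  have Uo: "orthonormal_cols n r U" using U A by (auto simp: leading_left_sing_vecs_def)
  have AN: "A + noise_mat n m f \<in> carrier_mat n m" for f using A noise_mat_carrier[of n m f] by simp
  have Wo: "orthonormal_cols n r W" if "?lead f W" for f W
    using that AN[of f] by (auto simp: leading_left_sing_vecs_def)
  define S where "S = {f \<in> extensional ?I. (\<forall>y\<in>carrier_vec m. vnorm (noise_mat n m f *\<^sub>v y) \<le> e * vnorm y) \<and> (\<exists>W. ?lead f W)}"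
  have compl: "vnorm (proj_compl W' (W *\<^sub>v z)) \<le> 14 * d / (3 * \<gamma>) * vnorm z"
    if f: "f \<in> S" "?lead f W" and g: "g \<in> S" "?lead g W'" and d: "0 \<le> d" "L2_set (\<lambda>p. f p - g p) ?I \<le> d"
      and z: "z \<in> carrier_vec r" for f g W W' d z
  proof -
    have "vnorm (proj_compl W' (W *\<^sub>v z)) \<le> 2 * d / (sing_val A r - sing_val A (r + 1) - e - e) * vnorm z"
    proof (rule leading_left_sing_vecs_near[OF A AN AN r f(2) g(2) e(1) e(1) _ _ _ _ d(1) _ z])
      fix y :: "real vec" assume y: "y \<in> carrier_vec m"
      show "vnorm (A *\<^sub>v y - (A + noise_mat n m f) *\<^sub>v y) \<le> e * vnorm y"
        unfolding add_noise_mult_vec(1)[OF A y] using f(1) y by (simp add: S_def)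
      show "vnorm (A *\<^sub>v y - (A + noise_mat n m g) *\<^sub>v y) \<le> e * vnorm y"
        unfolding add_noise_mult_vec(1)[OF A y] using g(1) y by (simp add: S_def)
      have "vnorm (noise_mat n m (\<lambda>p. f p - g p) *\<^sub>v y) \<le> L2_set (\<lambda>p. f p - g p) ?I * vnorm y"
        by (rule noise_mat_mult_vec_le_frobenius[OF y])
      also have "\<dots> \<le> d * vnorm y" using d(2) by (intro mult_right_mono) auto
      finally show "vnorm ((A + noise_mat n m f) *\<^sub>v y - (A + noise_mat n m g) *\<^sub>v y) \<le> d * vnorm y"
        unfolding add_noise_mult_vec(2)[OF A y] .
    qed (use e \<gamma> in linarith)+
    also have "\<dots> \<le> 14 * d / (3 * \<gamma>) * vnorm z"
    proof (rule mult_right_mono[OF _ vnorm_nonneg])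
      have "2 * d / (\<gamma> - e - e) \<le> 2 * d / (3 / 7 * \<gamma>)"
        using e \<gamma>(2) d(1) by (intro divide_left_mono mult_pos_pos) auto
      also have "\<dots> = 14 * d / (3 * \<gamma>)" by simp
      finally show "2 * d / (sing_val A r - sing_val A (r + 1) - e - e) \<le> 14 * d / (3 * \<gamma>)" unfolding \<gamma>(1) .
    qed
    finally show ?thesis .
  qed
  have proj_diff: "vnorm (proj W w - proj W' w) \<le> ?L * d"
    if f: "f \<in> S" "?lead f W" and g: "g \<in> S" "?lead g W'" and d: "0 \<le> d" "L2_set (\<lambda>p. f p - g p) ?I \<le> d" for f g W W' d
  proof -
    have d': "L2_set (\<lambda>p. g p - f p) ?I \<le> d" using d(2) by (simp only: L2_set_diff_commute[of g f])
    have nn: "0 \<le> 14 * d / (3 * \<gamma>)" using d(1) \<gamma>(2) by simp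
    have "vnorm (proj W w - proj W' w) \<le> (14 * d / (3 * \<gamma>) + 14 * d / (3 * \<gamma>)) * vnorm w"
      by (rule proj_difference_le[OF Wo[OF f(2)] Wo[OF g(2)] _ nn _ nn w(1)])
        (erule compl[OF f g d], erule compl[OF g f d(1) d'])
    also have "\<dots> \<le> (14 * d / (3 * \<gamma>) + 14 * d / (3 * \<gamma>)) * 1" using w(3) nn by (intro mult_left_mono) auto
    finally show ?thesis by (simp add: field_simps)
  qed
  have proj_unique: "proj W w = proj W' w" if f: "f \<in> S" "?lead f W" "?lead f W'" for f W W'
  proof -
    have "vnorm (proj W w - proj W' w) \<le> ?L * 0" by (rule proj_diff[OF f(1,2) f(1,3)]) (simp_all add: L2_set_def)
    then have "vnorm (proj W w - proj W' w) = 0" using vnorm_nonneg[of "proj W w - proj W' w"] by simp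
    moreover have c: "proj W w \<in> carrier_vec n" "proj W' w \<in> carrier_vec n"
      using proj_carrier(1)[OF Wo[OF f(2)] w(1)] proj_carrier(1)[OF Wo[OF f(3)] w(1)] .
    ultimately have "proj W w - proj W' w = 0\<^sub>v n" using vnorm_eq_0_iff[of _ n] by simp
    then have "(proj W w - proj W' w) $ i = 0" if "i < n" for i using that by simp
    then show ?thesis using c by (intro eq_vecI) auto
  qed
  define P where "P f = (SOME W. ?lead f W)" for f
  have P: "?lead f (P f)" if "f \<in> S" for f
    using that someI_ex[of "?lead f"] by (auto simp: S_def P_def)
  define g where "g f k = (transpose_mat U *\<^sub>v proj (P f) w) $ k" for f k
  have gc: "transpose_mat U *\<^sub>v proj W w \<in> carrier_vec r" if "?lead f W" for f W
    by (rule proj_carrier(3)[OF Uo proj_carrier(1)[OF Wo[OF that] w(1)]])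
  let ?HU = "householder n U" and ?HV = "householder m V"
  let ?K1 = "{0..<r} \<times> {0..<m}" and ?K2 = "{0..<n} \<times> {0..<r}"
  let ?T1 = "reflections ?I ?K1 (left_family U)" and ?T2 = "reflections ?I ?K2 (right_family V)"
  define T where "T f = ?T1 (?T2 f)" for f
  note HU = householder_carrier[OF Uo] householder_transpose[OF Uo] householder_involution[OF Uo]
  note HV = householder_carrier[OF V(1)] householder_transpose[OF V(1)] householder_involution[OF V(1)]
  have N: "noise_mat n m f \<in> carrier_mat n m" for f by (rule noise_mat_carrier)
  have NT: "noise_mat n m (T f) = ?HU * noise_mat n m f * ?HV" for f
    unfolding T_def noise_mat_left_reflections[OF Uo] noise_mat_right_reflections[OF V(1)]
    by (rule assoc_mult_mat[OF HU(1) N HV(1), symmetric])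
  have Text: "T f \<in> extensional ?I" for f unfolding T_def reflections_def by simp
  have Tm: "T \<in> PiM ?I (\<lambda>_. borel) \<rightarrow>\<^sub>M PiM ?I (\<lambda>_. borel :: real measure)"
    unfolding T_def[abs_def] by (rule measurable_compose[OF measurable_reflections measurable_reflections])
  have fin: "finite ?I" "finite ?K1" "finite ?K2" by simp_all
  have Tg: "(\<integral>\<^sup>+x. h (T x) \<partial>PiM ?I (\<lambda>_. gauss \<sigma>)) = (\<integral>\<^sup>+x. h x \<partial>PiM ?I (\<lambda>_. gauss \<sigma>))"
    if h: "h \<in> borel_measurable (PiM ?I (\<lambda>_. borel))" for h :: "(nat \<times> nat \<Rightarrow> real) \<Rightarrow> ennreal"
  proof -
    have "(\<integral>\<^sup>+x. h (?T1 (?T2 x)) \<partial>PiM ?I (\<lambda>_. gauss \<sigma>)) = (\<integral>\<^sup>+x. h (?T1 x) \<partial>PiM ?I (\<lambda>_. gauss \<sigma>))"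
      using nn_integral_PiM_gauss_reflections[OF \<sigma> fin(1,3) _ measurable_compose[OF measurable_reflections h], of "right_family V"]
        right_family_orthonormal[OF V(1)] by blast
    moreover have "(\<integral>\<^sup>+x. h (?T1 x) \<partial>PiM ?I (\<lambda>_. gauss \<sigma>)) = (\<integral>\<^sup>+x. h x \<partial>PiM ?I (\<lambda>_. gauss \<sigma>))"
      using nn_integral_PiM_gauss_reflections[OF \<sigma> fin(1,2) _ h, of "left_family U"]
        left_family_orthonormal[OF Uo] by blast
    ultimately show ?thesis by (simp only: T_def)
  qed
  have TT: "T (T f) = f" if "f \<in> extensional ?I" for f
  proof (rule noise_mat_inject[OF Text that])
    have HN: "?HU * noise_mat n m f \<in> carrier_mat n m" using HU(1) N by simp
    have "?HU * (?HU * noise_mat n m f * ?HV) * ?HV = ?HU * (?HU * noise_mat n m f) * ?HV * ?HV"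
      by (simp only: assoc_mult_mat[OF HU(1) HN HV(1)])
    also have "\<dots> = ?HU * (?HU * noise_mat n m f)"
      by (simp only: assoc_mult_mat[OF mult_carrier_mat[OF HU(1) HN] HV(1,1)] HV(3) right_mult_one_mat[OF mult_carrier_mat[OF HU(1) HN]])
    also have "\<dots> = noise_mat n m f"
      by (simp only: assoc_mult_mat[OF HU(1,1) N, symmetric] HU(3) left_mult_one_mat[OF N])
    finally show "noise_mat n m (T (T f)) = noise_mat n m f" unfolding NT .
  qed
  have Tiso: "L2_set (\<lambda>i. T x i - T y i) ?I = L2_set (\<lambda>i. x i - y i) ?I" for x y
  proof -
    have "L2_set (\<lambda>i. ?T1 (?T2 x) i - ?T1 (?T2 y) i) ?I = L2_set (\<lambda>i. ?T2 x i - ?T2 y i) ?I"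
      by (rule L2_set_reflections[OF fin(2)]) (rule left_family_orthonormal[OF Uo])
    also have "\<dots> = L2_set (\<lambda>i. x i - y i) ?I"
      by (rule L2_set_reflections[OF fin(3)]) (rule right_family_orthonormal[OF V(1)])
    finally show ?thesis unfolding T_def .
  qed
  have leadT: "?lead (T f) (?HU * W)" if W: "?lead f W" for f W
  proof -
    have "A + noise_mat n m (T f) = ?HU * A * ?HV + ?HU * noise_mat n m f * ?HV"
      unfolding NT householder_conjugate_fixes[OF Uo V(1) A V(2,3)] ..
    also have "\<dots> = (?HU * A + ?HU * noise_mat n m f) * ?HV"
      by (rule add_mult_distrib_mat[symmetric]) (use HU HV A N in auto)
    also have "?HU * A + ?HU * noise_mat n m f = ?HU * (A + noise_mat n m f)"
      by (rule mult_add_distrib_mat[OF HU(1) A N, symmetric])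
    finally have eq: "A + noise_mat n m (T f) = ?HU * (A + noise_mat n m f) * ?HV" .
    show ?thesis unfolding eq by (rule leading_left_sing_vecs_orthogonal[OF AN HU HV W])
  qed
  have TS: "T f \<in> S" if f: "f \<in> S" for f
  proof -
    have "vnorm (noise_mat n m (T f) *\<^sub>v y) \<le> e * vnorm y" if y: "y \<in> carrier_vec m" for y
    proof -
      have Hy: "?HV *\<^sub>v y \<in> carrier_vec m" using HV y by simp
      have NHy: "noise_mat n m f *\<^sub>v (?HV *\<^sub>v y) \<in> carrier_vec n" using N[of f] Hy by auto
      have "noise_mat n m (T f) *\<^sub>v y = ?HU *\<^sub>v (noise_mat n m f *\<^sub>v (?HV *\<^sub>v y))"
        unfolding NT by (simp only: assoc_mult_mat_vec[OF mult_carrier_mat[OF HU(1) N] HV(1) y] assoc_mult_mat_vec[OF HU(1) N Hy])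
      then have "vnorm (noise_mat n m (T f) *\<^sub>v y) = vnorm (noise_mat n m f *\<^sub>v (?HV *\<^sub>v y))"
        by (simp only: vnorm_orthonormal_cols[OF orthonormal_cols_householder[OF Uo] NHy])
      also have "\<dots> \<le> e * vnorm (?HV *\<^sub>v y)" using f Hy by (simp add: S_def)
      also have "vnorm (?HV *\<^sub>v y) = vnorm y" by (rule vnorm_orthonormal_cols[OF orthonormal_cols_householder[OF V(1)] y])
      finally show ?thesis .
    qed
    then show ?thesis using leadT[OF P[OF f]] Text by (auto simp: S_def)
  qed
  have odd: "g (T f) k = - g f k" if f: "f \<in> S" and k: "k \<in> {0..<r}" for f k
  proof -
    let ?W = "P f"
    note Wc = orthonormal_colsD(1,2)[OF Wo[OF P[OF f]]]
    have "proj (P (T f)) w = proj (?HU * ?W) w" by (rule proj_unique[OF TS[OF f] P[OF TS[OF f]] leadT[OF P[OF f]]])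
    also have "\<dots> = ?HU *\<^sub>v proj ?W w"
    proof -
      have "transpose_mat (?HU * ?W) *\<^sub>v w = transpose_mat ?W *\<^sub>v (?HU *\<^sub>v w)"
        unfolding transpose_mult[OF HU(1) Wc(1)] HU(2) by (rule assoc_mult_mat_vec[OF Wc(2) HU(1) w(1)])
      then have 1: "transpose_mat (?HU * ?W) *\<^sub>v w = transpose_mat ?W *\<^sub>v w"
        by (simp only: householder_fixes_complement[OF Uo w(1,2)])
      show ?thesis unfolding proj_def 1
        by (rule assoc_mult_mat_vec[OF HU(1) Wc(1) proj_carrier(3)[OF Wo[OF P[OF f]] w(1)]])
    qed
    finally have "transpose_mat U *\<^sub>v proj (P (T f)) w = - (transpose_mat U *\<^sub>v proj ?W w)"
      by (simp only: transpose_mult_householder[OF Uo proj_carrier(1)[OF Wo[OF P[OF f]] w(1)]])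
    moreover have "(- v) $ k = - v $ k" if "v \<in> carrier_vec r" for v :: "real vec" using that k by simp
    ultimately show ?thesis using gc[OF P[OF f]] unfolding g_def by simp
  qed
  have lip: "L2_set (\<lambda>k. g f k - g f' k) {0..<r} \<le> ?L * L2_set (\<lambda>i. f i - f' i) ?I" if f: "f \<in> S" "f' \<in> S" for f f'
  proof -
    have c: "proj (P f) w \<in> carrier_vec n" "proj (P f') w \<in> carrier_vec n"
      using proj_carrier(1)[OF Wo[OF P] w(1)] f by auto
    have cU: "transpose_mat U *\<^sub>v proj (P f) w \<in> carrier_vec r" "transpose_mat U *\<^sub>v proj (P f') w \<in> carrier_vec r"
      using gc[OF P] f by auto
    have "L2_set (\<lambda>k. g f k - g f' k) {0..<r} = vnorm (transpose_mat U *\<^sub>v proj (P f) w - transpose_mat U *\<^sub>v proj (P f') w)"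
    proof -
      have "v $ k - v' $ k = (v - v') $ k" if "v' \<in> carrier_vec r" "k \<in> {0..<r}" for v v' :: "real vec" and k using that by simp
      then show ?thesis unfolding vnorm_eq_L2_set carrier_vecD[OF minus_carrier_vec[OF cU]] g_def
        using cU(2) by (intro L2_set_cong refl)
    qed
    also have "\<dots> = vnorm (transpose_mat U *\<^sub>v (proj (P f) w - proj (P f') w))"
      by (simp only: mult_minus_distrib_mat_vec[OF orthonormal_colsD(2)[OF Uo] c])
    also have "\<dots> \<le> vnorm (proj (P f) w - proj (P f') w)"
      by (rule proj_norm_le(1)[OF Uo minus_carrier_vec[OF c]])
    also have "\<dots> \<le> ?L * L2_set (\<lambda>i. f i - f' i) ?I"
      by (rule proj_diff[OF f(1) P[OF f(1)] f(2) P[OF f(2)] L2_set_nonneg order_refl])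
    finally show ?thesis .
  qed
  have L0: "0 < ?L" using \<gamma>(2) by simp
  have Sext: "S \<subseteq> extensional ?I" by (auto simp: S_def)
  show ?thesis
  proof (rule odd_lipschitz_vector_concentration[where I = ?I and J = "{0..<r}" and L = ?L and T = T and S = S and g = g and \<sigma> = \<sigma>])
    fix \<Phi> :: "(nat \<times> nat \<Rightarrow> real) \<Rightarrow> ennreal"
    assume 1: "\<Phi> \<in> borel_measurable (PiM ?I (\<lambda>_. borel))"
      and 2: "(\<integral>\<^sup>+x. \<Phi> x \<partial>PiM ?I (\<lambda>_. gauss \<sigma>)) \<le> ennreal (sqrt 2 ^ card {0..<r})"
      and 3: "\<And>x. x \<in> S \<Longrightarrow> ennreal (exp ((\<Sum>k\<in>{0..<r}. (g x k)\<^sup>2) / (4 * \<sigma>\<^sup>2 * ?L\<^sup>2))) \<le> \<Phi> x"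
    have "ennreal (exp ((vnorm (transpose_mat U *\<^sub>v proj W w))\<^sup>2 / (4 * \<sigma>\<^sup>2 * ?L\<^sup>2))) \<le> \<Phi> f"
      if f: "f \<in> extensional ?I" "\<forall>y\<in>carrier_vec m. vnorm (noise_mat n m f *\<^sub>v y) \<le> e * vnorm y" "?lead f W" for f W
    proof -
      have fS: "f \<in> S" using f by (auto simp: S_def)
      have "(\<Sum>k\<in>{0..<r}. (g f k)\<^sup>2) = (vnorm (transpose_mat U *\<^sub>v proj (P f) w))\<^sup>2"
        unfolding vnorm_eq_L2_set L2_set_square_sum carrier_vecD[OF gc[OF P[OF fS]]] g_def ..
      also have "proj (P f) w = proj W w" by (rule proj_unique[OF fS P[OF fS] f(3)])
      finally show ?thesis using 3[OF fS] by simp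
    qed
    then show ?thesis using 1 2 by (intro bexI[of _ \<Phi>]) simp_all
  next
    fix h :: "(nat \<times> nat \<Rightarrow> real) \<Rightarrow> ennreal" assume "h \<in> borel_measurable (PiM ?I (\<lambda>_. borel))"
    then show "(\<integral>\<^sup>+x. h (T x) \<partial>PiM ?I (\<lambda>_. gauss \<sigma>)) = (\<integral>\<^sup>+x. h x \<partial>PiM ?I (\<lambda>_. gauss \<sigma>))" by (rule Tg)
  next
    fix x :: "nat \<times> nat \<Rightarrow> real" assume "x \<in> extensional ?I"
    then show "T (T x) = x" by (rule TT)
  next
    fix x :: "nat \<times> nat \<Rightarrow> real" and y
    show "L2_set (\<lambda>i. T x i - T y i) ?I = L2_set (\<lambda>i. x i - y i) ?I" by (rule Tiso)
  next
    fix x :: "nat \<times> nat \<Rightarrow> real" and k assume "x \<in> S" "k \<in> {0..<r}"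
    then show "g (T x) k = - g x k" by (rule odd)
  next
    fix x :: "nat \<times> nat \<Rightarrow> real" and y assume "x \<in> S" "y \<in> S"
    then show "L2_set (\<lambda>k. g x k - g y k) {0..<r} \<le> ?L * L2_set (\<lambda>i. x i - y i) ?I" by (rule lip)
  next
    fix x :: "nat \<times> nat \<Rightarrow> real" assume "x \<in> S"
    then show "T x \<in> S" by (rule TS)
  next
    show "T \<in> PiM ?I (\<lambda>_. borel) \<rightarrow>\<^sub>M PiM ?I (\<lambda>_. borel)" by (rule Tm)
    show "S \<subseteq> extensional ?I" by (rule Sext)
  qed (rule \<sigma> fin(1) L0 finite_atLeastLessThan)+
qed

lemma proj_compl_eq_of_leading:
  fixes A :: "real mat"
  assumes A: "A \<in> carrier_mat n m" and r: "1 \<le> r" "r < min n m" and gap: "sing_val A (r + 1) < sing_val A r"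
    and U: "leading_left_sing_vecs A r U" and U': "leading_left_sing_vecs A r U'" and x: "x \<in> carrier_vec n"
  shows "proj_compl U x = proj_compl U' x"
proof -
  have near: "vnorm (proj_compl W' (W *\<^sub>v z)) \<le> 0 * vnorm z"
    if W: "leading_left_sing_vecs A r W" "leading_left_sing_vecs A r W'" and z: "z \<in> carrier_vec r" for W W' z
  proof -
    have "vnorm (proj_compl W' (W *\<^sub>v z)) \<le> 2 * 0 / (sing_val A r - sing_val A (r + 1) - 0 - 0) * vnorm z"
      by (rule leading_left_sing_vecs_near[OF A A A r W order_refl order_refl _ _ _ _ order_refl _ z])
        (use gap in \<open>simp_all add: vnorm_diff_self\<close>)
    then show ?thesis by simp
  qed
  have o: "orthonormal_cols n r U" "orthonormal_cols n r U'"
    using U U' A by (auto simp: leading_left_sing_vecs_def)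
  have "vnorm (proj U x - proj U' x) \<le> (0 + 0) * vnorm x"
    by (rule proj_difference_le[OF o _ order_refl _ order_refl x]) (erule near[OF U U'], erule near[OF U' U])
  then have "vnorm (proj U x - proj U' x) = 0" using vnorm_nonneg[of "proj U x - proj U' x"] by simp
  then have "proj U x - proj U' x = 0\<^sub>v n"
    using vnorm_eq_0_iff[OF minus_carrier_vec[OF proj_carrier(1)[OF o(1) x] proj_carrier(1)[OF o(2) x]]] by simp
  then have "(proj U x - proj U' x) $ i = 0" if "i < n" for i using that by simp
  then have "proj U x = proj U' x"
    using proj_carrier(1)[OF o(1) x] proj_carrier(1)[OF o(2) x] by (intro eq_vecI) auto
  then show ?thesis by (simp add: proj_compl_def)
qed

lemma exp_neg_half_le: "0 < x \<Longrightarrow> exp (- (x / 2)) \<le> 8 / (x::real)\<^sup>2"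
proof -
  assume x: "0 < x"
  have "1 + x / 2 + (x / 2)\<^sup>2 / 2 \<le> exp (x / 2)" by (rule exp_lower_Taylor_quadratic) (use x in simp)
  then have "x\<^sup>2 / 8 \<le> exp (x / 2)" using x by (simp add: power_divide)
  then have "inverse (exp (x / 2)) \<le> inverse (x\<^sup>2 / 8)" using x by (intro le_imp_inverse_le) auto
  then show ?thesis by (simp only: exp_minus inverse_divide)
qed

lemma noise_event:
  fixes A :: "real mat"
  assumes A: "A \<in> carrier_mat n m" and r: "1 \<le> r" "r < min n m" and \<sigma>: "0 < \<sigma>"
    and U: "leading_left_sing_vecs A r U"
    and \<gamma>: "\<gamma> = sing_val A r - sing_val A (r + 1)" "21 * \<sigma> * sqrt (real (max n m)) < \<gamma>"
  obtains E where "E \<in> sets (gauss_noise n m \<sigma>)" "measure (gauss_noise n m \<sigma>) E \<ge> 1 - 9 / (real n)\<^sup>2"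
    "\<And>f y. f \<in> E \<Longrightarrow> y \<in> carrier_vec m \<Longrightarrow>
      vnorm (noise_mat n m f *\<^sub>v y) \<le> 6 * \<sigma> * sqrt (real (max n m)) * vnorm y"
    "\<And>f W i. f \<in> E \<Longrightarrow> leading_left_sing_vecs (A + noise_mat n m f) r W \<Longrightarrow> i < n \<Longrightarrow>
      (vnorm (transpose_mat U *\<^sub>v proj W (proj_compl U (unit_vec n i))))\<^sup>2
        \<le> 4 * \<sigma>\<^sup>2 * (28 / (3 * \<gamma>))\<^sup>2 * (real r * (ln 2 / 2) + 3 * ln (real n))"
proof -
  let ?I = "{0..<n} \<times> {0..<m}"
  let ?M = "PiM ?I (\<lambda>_. gauss \<sigma>)"
  let ?N = "max n m"
  define e where "e = 6 * \<sigma> * sqrt (real ?N)"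
  define w where "w i = proj_compl U (unit_vec n i)" for i
  have n: "2 \<le> n" "0 < m" "2 \<le> ?N" using r by auto
  interpret M: prob_space ?M using \<sigma> by (rule prob_space_PiM_gauss)
  have Uo: "orthonormal_cols n r U" using U A by (auto simp: leading_left_sing_vecs_def)
  have e0: "0 \<le> e" "7 * e \<le> 2 * \<gamma>" using \<sigma> \<gamma>(2) by (simp_all add: e_def)
  have \<gamma>0: "0 < \<gamma>" using \<gamma>(2) \<sigma> n by (smt (verit) mult_nonneg_nonneg real_sqrt_ge_zero of_nat_0_le_iff)
  have w: "w i \<in> carrier_vec n" "transpose_mat U *\<^sub>v w i = 0\<^sub>v r" "vnorm (w i) \<le> 1" if "i < n" for i
  proof -
    have u: "unit_vec n i \<in> carrier_vec n" by simp
    show "w i \<in> carrier_vec n" unfolding w_def by (rule proj_carrier(2)[OF Uo u])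
    show "transpose_mat U *\<^sub>v w i = 0\<^sub>v r" unfolding w_def by (rule transpose_mult_proj_compl[OF Uo u])
    have "vnorm (unit_vec n i) = 1" using that
      by (simp add: vnorm_eq_L2_set L2_set_def unit_vec_def if_distrib[of "\<lambda>x. x\<^sup>2"] cong: if_cong)
    then show "vnorm (w i) \<le> 1" using proj_norm_le(2)[OF Uo u] by (simp add: w_def)
  qed
  have "\<exists>\<Phi>\<in>borel_measurable (PiM ?I (\<lambda>_. borel)). (\<integral>\<^sup>+f. \<Phi> f \<partial>?M) \<le> ennreal (sqrt 2 ^ r) \<and>
    (\<forall>f\<in>extensional ?I. \<forall>W. (\<forall>y\<in>carrier_vec m. vnorm (noise_mat n m f *\<^sub>v y) \<le> e * vnorm y) \<longrightarrow>
       leading_left_sing_vecs (A + noise_mat n m f) r W \<longrightarrow>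
       ennreal (exp ((vnorm (transpose_mat U *\<^sub>v proj W (w i)))\<^sup>2 / (4 * \<sigma>\<^sup>2 * (28 / (3 * \<gamma>))\<^sup>2))) \<le> \<Phi> f)"
    if "i < n" for i
    by (rule row_concentration[OF A r \<sigma> U \<gamma>(1) \<gamma>0 e0 w[OF that]])
  then obtain \<Phi> where \<Phi>: "\<And>i. i < n \<Longrightarrow> \<Phi> i \<in> borel_measurable (PiM ?I (\<lambda>_. borel))"
    "\<And>i. i < n \<Longrightarrow> (\<integral>\<^sup>+f. \<Phi> i f \<partial>?M) \<le> ennreal (sqrt 2 ^ r)"
    "\<And>i f W. i < n \<Longrightarrow> f \<in> extensional ?I \<Longrightarrow> \<forall>y\<in>carrier_vec m. vnorm (noise_mat n m f *\<^sub>v y) \<le> e * vnorm y \<Longrightarrow>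
       leading_left_sing_vecs (A + noise_mat n m f) r W \<Longrightarrow>
       ennreal (exp ((vnorm (transpose_mat U *\<^sub>v proj W (w i)))\<^sup>2 / (4 * \<sigma>\<^sup>2 * (28 / (3 * \<gamma>))\<^sup>2))) \<le> \<Phi> i f"
    unfolding Bex_def by metis
  have sets: "sets ?M = sets (PiM ?I (\<lambda>_. borel :: real measure))" by (rule sets_PiM_gauss)
  have \<Phi>m: "\<Phi> i \<in> borel_measurable ?M" if "i < n" for i
    unfolding measurable_cong_sets[OF sets refl] by (rule \<Phi>(1)[OF that])
  define B where "B i = {f \<in> space ?M. ennreal (sqrt 2 ^ r * real n ^ 3) \<le> \<Phi> i f}" for i
  have Bm: "B i \<in> sets ?M" if "i < n" for i unfolding B_def using \<Phi>m[OF that] by measurable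
  have Bp: "measure ?M (B i) \<le> 1 / real n ^ 3" if "i < n" for i
    unfolding B_def by (rule M.prob_ge_le_inverse[OF \<Phi>m[OF that] \<Phi>(2)[OF that]]) (use n in simp_all)
  obtain E0 where E0: "E0 \<in> sets ?M" "measure ?M E0 \<ge> 1 - exp (- (real ?N / 2))"
    "\<And>f a. f \<in> E0 \<Longrightarrow> (\<Sum>j=0..<m. (a j)\<^sup>2) = 1 \<Longrightarrow>
      (\<Sum>i=0..<n. (\<Sum>j=0..<m. f (i,j) * a j)\<^sup>2) \<le> 36 * \<sigma>\<^sup>2 * real ?N"
    by (rule gauss_operator_norm[OF \<sigma> max.cobounded1 max.cobounded2 n(3,2)]) blast
  define E where "E = E0 - (\<Union>i\<in>{..<n}. B i)"
  have Um: "(\<Union>i\<in>{..<n}. B i) \<in> sets ?M" using Bm by auto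
  have Em: "E \<in> sets ?M" unfolding E_def using E0(1) Um by (rule sets.Diff)
  have "measure ?M (\<Union>i\<in>{..<n}. B i) \<le> (\<Sum>i\<in>{..<n}. measure ?M (B i))"
    using Bm by (intro M.finite_measure_subadditive_finite) auto
  also have "\<dots> \<le> (\<Sum>i\<in>{..<n}. 1 / real n ^ 3)" using Bp by (intro sum_mono) simp
  also have "\<dots> = 1 / (real n)\<^sup>2" using n by (simp add: power2_eq_square power3_eq_cube)
  finally have U1: "measure ?M (\<Union>i\<in>{..<n}. B i) \<le> 1 / (real n)\<^sup>2" .
  have "exp (- (real ?N / 2)) \<le> exp (- (real n / 2))" by simp
  also have "\<dots> \<le> 8 / (real n)\<^sup>2" using n by (intro exp_neg_half_le) simp
  finally have E1: "exp (- (real ?N / 2)) \<le> 8 / (real n)\<^sup>2" .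
  have "E0 \<subseteq> E \<union> (\<Union>i\<in>{..<n}. B i)" by (auto simp: E_def)
  then have "measure ?M E0 \<le> measure ?M (E \<union> (\<Union>i\<in>{..<n}. B i))"
    using Em Um by (intro M.finite_measure_mono) auto
  also have "\<dots> \<le> measure ?M E + measure ?M (\<Union>i\<in>{..<n}. B i)"
    by (rule measure_Un_le[OF Em Um])
  finally have E2: "1 - (8 / (real n)\<^sup>2 + 1 / (real n)\<^sup>2) \<le> measure ?M E" using E0(2) U1 E1 by linarith
  have op: "vnorm (noise_mat n m f *\<^sub>v y) \<le> e * vnorm y" if f: "f \<in> E" and y: "y \<in> carrier_vec m" for f y
  proof (rule noise_mat_mult_vec_le[OF e0(1) _ y])
    fix a :: "nat \<Rightarrow> real" assume "(\<Sum>j=0..<m. (a j)\<^sup>2) = 1"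
    then have "(\<Sum>i=0..<n. (\<Sum>j=0..<m. f (i,j) * a j)\<^sup>2) \<le> 36 * \<sigma>\<^sup>2 * real ?N"
      using f by (intro E0(3)) (auto simp: E_def)
    also have "\<dots> = e\<^sup>2" by (simp add: e_def power_mult_distrib)
    finally show "(\<Sum>i=0..<n. (\<Sum>j=0..<m. f (i,j) * a j)\<^sup>2) \<le> e\<^sup>2" .
  qed
  show thesis
  proof (rule that[of E])
    show "E \<in> sets (gauss_noise n m \<sigma>)" unfolding gauss_noise_def by (rule Em)
    show "measure (gauss_noise n m \<sigma>) E \<ge> 1 - 9 / (real n)\<^sup>2"
      unfolding gauss_noise_def using E2 by (simp add: add_divide_distrib[symmetric])
  next
    fix f and y :: "real vec" assume "f \<in> E" "y \<in> carrier_vec m"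
    then show "vnorm (noise_mat n m f *\<^sub>v y) \<le> 6 * \<sigma> * sqrt (real ?N) * vnorm y" unfolding e_def[symmetric] by (rule op)
  next
    fix f W i assume f: "f \<in> E" and W: "leading_left_sing_vecs (A + noise_mat n m f) r W" and i: "i < n"
    let ?v = "(vnorm (transpose_mat U *\<^sub>v proj W (w i)))\<^sup>2" and ?D = "4 * \<sigma>\<^sup>2 * (28 / (3 * \<gamma>))\<^sup>2"
    have fM: "f \<in> space ?M" using f sets.sets_into_space[OF Em] by blast
    then have fe: "f \<in> extensional ?I" by (simp add: space_PiM PiE_def)
    have fb: "\<forall>y\<in>carrier_vec m. vnorm (noise_mat n m f *\<^sub>v y) \<le> e * vnorm y" using op[OF f] by blast
    have "f \<notin> B i" using f i by (auto simp: E_def)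
    then have "\<Phi> i f < ennreal (sqrt 2 ^ r * real n ^ 3)" using fM by (simp add: B_def not_le)
    with \<Phi>(3)[OF i fe fb W] have "ennreal (exp (?v / ?D)) < ennreal (sqrt 2 ^ r * real n ^ 3)" by (rule le_less_trans)
    then have lt: "exp (?v / ?D) < sqrt 2 ^ r * real n ^ 3" by (simp add: ennreal_less_iff)
    have "?v / ?D \<le> ln (sqrt 2 ^ r * real n ^ 3)" using lt n by (subst ln_ge_iff) auto
    also have "\<dots> = real r * (ln 2 / 2) + 3 * ln (real n)" using n by (simp add: ln_mult ln_realpow ln_sqrt)
    finally have "?v / ?D \<le> real r * (ln 2 / 2) + 3 * ln (real n)" .
    moreover have "0 < ?D" using \<sigma> \<gamma>0 by simp
    ultimately show "(vnorm (transpose_mat U *\<^sub>v proj W (proj_compl U (unit_vec n i))))\<^sup>2 \<le> ?D * (real r * (ln 2 / 2) + 3 * ln (real n))"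
      unfolding w_def[symmetric] by (simp only: pos_divide_le_eq mult.commute)
  qed
qed

lemma row_bound:
  fixes U U' :: "real mat"
  assumes U: "orthonormal_cols n r U" and U': "orthonormal_cols n r U'" and s: "0 \<le> s" "s \<le> 4 / 5"
    and near: "\<And>z. z \<in> carrier_vec r \<Longrightarrow> vnorm (proj_compl U (U' *\<^sub>v z)) \<le> s * vnorm z"
    and w: "w \<in> carrier_vec n" and \<sigma>: "0 < \<sigma>" "0 < \<gamma>" and n: "1 \<le> n"
    and b: "(vnorm (transpose_mat U *\<^sub>v proj U' w))\<^sup>2
        \<le> 4 * \<sigma>\<^sup>2 * (28 / (3 * \<gamma>))\<^sup>2 * (real r * (ln 2 / 2) + 3 * ln (real n))"
  shows "vnorm (transpose_mat U' *\<^sub>v w) \<le> 63 * \<sigma> * (sqrt (real r) + sqrt (ln (real n))) / \<gamma>"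
proof (rule power2_le_imp_le)
  let ?R = "sqrt (real r) + sqrt (ln (real n))" and ?h = "(vnorm (transpose_mat U' *\<^sub>v w))\<^sup>2"
  have ln0: "0 \<le> ln (real n)" using n by simp
  have s2: "s\<^sup>2 \<le> 16 / 25" using power_mono[OF s(2,1), of 2] by (simp add: power_divide)
  have R2: "real r + ln (real n) \<le> ?R\<^sup>2" using ln0 by (simp add: power2_sum)
  have "9 / 25 * ?h \<le> (1 - s\<^sup>2) * ?h" using s2 by (intro mult_right_mono) auto
  also have "\<dots> \<le> 4 * \<sigma>\<^sup>2 * (28 / (3 * \<gamma>))\<^sup>2 * (real r * (ln 2 / 2) + 3 * ln (real n))"
    using proj_complement_norm_bound[OF U U' s(1) _ near w] s(2) b by linarith
  also have "\<dots> \<le> 4 * \<sigma>\<^sup>2 * (28 / (3 * \<gamma>))\<^sup>2 * (4 * ?R\<^sup>2)"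
  proof (intro mult_left_mono)
    have "real r * (ln 2 / 2) \<le> real r * 1" using ln2_le_25_over_36 by (intro mult_left_mono) auto
    then show "real r * (ln 2 / 2) + 3 * ln (real n) \<le> 4 * ?R\<^sup>2" using R2 ln0 by linarith
  qed simp
  also have "\<dots> = 12544 / 9 * (\<sigma>\<^sup>2 * ?R\<^sup>2 / \<gamma>\<^sup>2)" by (simp add: power_divide power_mult_distrib)
  finally have 1: "?h \<le> 25 / 9 * (12544 / 9) * (\<sigma>\<^sup>2 * ?R\<^sup>2 / \<gamma>\<^sup>2)" by linarith
  have "25 / 9 * (12544 / 9) * (\<sigma>\<^sup>2 * ?R\<^sup>2 / \<gamma>\<^sup>2) \<le> 3969 * (\<sigma>\<^sup>2 * ?R\<^sup>2 / \<gamma>\<^sup>2)" by (intro mult_right_mono) auto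
  with 1 show "?h \<le> (63 * \<sigma> * ?R / \<gamma>)\<^sup>2" by (simp add: power_divide power_mult_distrib)
qed (use \<sigma> n in simp)

lemma proj_compl_leading_perturbed:
  fixes A :: "real mat"
  assumes A: "A \<in> carrier_mat n m" and r: "1 \<le> r" "r < min n m"
    and e: "0 \<le> e" "7 * e \<le> 2 * (sing_val A r - sing_val A (r + 1))" "0 < sing_val A r - sing_val A (r + 1)"
    and U: "leading_left_sing_vecs A r U" and W: "leading_left_sing_vecs (A + noise_mat n m f) r W"
    and f: "\<And>y. y \<in> carrier_vec m \<Longrightarrow> vnorm (noise_mat n m f *\<^sub>v y) \<le> e * vnorm y"
    and z: "z \<in> carrier_vec r"
  shows "vnorm (proj_compl W (U *\<^sub>v z)) \<le> 14 * e / (5 * (sing_val A r - sing_val A (r + 1))) * vnorm z"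
    and "vnorm (proj_compl U (W *\<^sub>v z)) \<le> 14 * e / (5 * (sing_val A r - sing_val A (r + 1))) * vnorm z"
proof -
  let ?\<gamma> = "sing_val A r - sing_val A (r + 1)"
  have AN: "A + noise_mat n m f \<in> carrier_mat n m" using A noise_mat_carrier[of n m f] by simp
  have d: "vnorm (A *\<^sub>v y - (A + noise_mat n m f) *\<^sub>v y) \<le> e * vnorm y" if "y \<in> carrier_vec m" for y
    unfolding add_noise_mult_vec(1)[OF A that] by (rule f[OF that])
  have d': "vnorm ((A + noise_mat n m f) *\<^sub>v y - A *\<^sub>v y) \<le> e * vnorm y" if "y \<in> carrier_vec m" for y
    using d[OF that] vnorm_minus_commute[of "A *\<^sub>v y" "(A + noise_mat n m f) *\<^sub>v y"] A AN by (simp add: noise_mat_def)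
  have z0: "vnorm (A *\<^sub>v y - A *\<^sub>v y) \<le> 0 * vnorm y" for y by (simp add: vnorm_diff_self)
  have lt: "0 + e < ?\<gamma>" "e + 0 < ?\<gamma>" "2 * e < ?\<gamma>" "2 * 0 < ?\<gamma>" using e by simp_all
  have le: "2 * e / (?\<gamma> - e) * vnorm z \<le> 14 * e / (5 * ?\<gamma>) * vnorm z"
  proof (rule mult_right_mono[OF _ vnorm_nonneg])
    have "2 * e / (?\<gamma> - e) \<le> 2 * e / (5 / 7 * ?\<gamma>)" using e by (intro divide_left_mono mult_pos_pos) auto
    also have "\<dots> = 14 * e / (5 * ?\<gamma>)" by simp
    finally show "2 * e / (?\<gamma> - e) \<le> 14 * e / (5 * ?\<gamma>)" .
  qed
  have "vnorm (proj_compl W (U *\<^sub>v z)) \<le> 2 * e / (?\<gamma> - 0 - e) * vnorm z"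
    by (rule leading_left_sing_vecs_near[OF A A AN r U W order_refl e(1) lt(1,3) _ _ e(1) _ z])
      (rule z0, erule d, erule d)
  then show "vnorm (proj_compl W (U *\<^sub>v z)) \<le> 14 * e / (5 * ?\<gamma>) * vnorm z" using le by simp
  have "vnorm (proj_compl U (W *\<^sub>v z)) \<le> 2 * e / (?\<gamma> - e - 0) * vnorm z"
    by (rule leading_left_sing_vecs_near[OF A AN A r W U e(1) order_refl lt(2,4) _ _ e(1) _ z])
      (erule d, rule z0, erule d')
  then show "vnorm (proj_compl U (W *\<^sub>v z)) \<le> 14 * e / (5 * ?\<gamma>) * vnorm z" using le by simp
qed

lemma two_inf_bound:
  fixes A :: "real mat"
  assumes A: "A \<in> carrier_mat n m" and r: "1 \<le> r" "r < min n m" and \<sigma>: "0 < \<sigma>"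
    and gap: "21 * \<sigma> * sqrt (real (max n m)) < sing_val A r - sing_val A (r + 1)"
  obtains E where "E \<in> sets (gauss_noise n m \<sigma>)" "measure (gauss_noise n m \<sigma>) E \<ge> 1 - 9 / (real n)\<^sup>2"
    "\<And>f U W. f \<in> E \<Longrightarrow> leading_left_sing_vecs A r U \<Longrightarrow> leading_left_sing_vecs (A + noise_mat n m f) r W \<Longrightarrow>
      (INF Q\<in>orth_group r. norm_2inf (W - U * Q))
        \<le> 283 * norm_2inf U * (\<sigma>\<^sup>2 * real (max n m)) / (sing_val A r - sing_val A (r + 1))\<^sup>2
          + 63 * \<sigma> * (sqrt (real r) + sqrt (ln (real n))) / (sing_val A r - sing_val A (r + 1))"
proof (cases "\<exists>U. leading_left_sing_vecs A r U")
  case False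
  interpret prob_space "gauss_noise n m \<sigma>" unfolding gauss_noise_def using \<sigma> by (rule prob_space_PiM_gauss)
  show ?thesis by (rule that[of "space (gauss_noise n m \<sigma>)"]) (use False in \<open>auto simp: prob_space\<close>)
next
  case True
  then obtain U0 where U0: "leading_left_sing_vecs A r U0" ..
  define \<gamma> where "\<gamma> = sing_val A r - sing_val A (r + 1)"
  define e where "e = 6 * \<sigma> * sqrt (real (max n m))"
  define s where "s = 14 * e / (5 * \<gamma>)"
  have e0: "0 \<le> e" "7 * e \<le> 2 * \<gamma>" using \<sigma> gap by (simp_all add: e_def \<gamma>_def)
  have \<gamma>0: "0 < \<gamma>" using e0 gap \<sigma> by (smt (verit) \<gamma>_def mult_nonneg_nonneg real_sqrt_ge_zero of_nat_0_le_iff)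
  have s: "0 \<le> s" "s \<le> 4 / 5" using e0 \<gamma>0 by (simp_all add: s_def pos_divide_le_eq)
  have n: "1 \<le> n" using r by simp
  obtain E where E: "E \<in> sets (gauss_noise n m \<sigma>)" "measure (gauss_noise n m \<sigma>) E \<ge> 1 - 9 / (real n)\<^sup>2"
    "\<And>f y. f \<in> E \<Longrightarrow> y \<in> carrier_vec m \<Longrightarrow> vnorm (noise_mat n m f *\<^sub>v y) \<le> e * vnorm y"
    "\<And>f W i. f \<in> E \<Longrightarrow> leading_left_sing_vecs (A + noise_mat n m f) r W \<Longrightarrow> i < n \<Longrightarrow>
      (vnorm (transpose_mat U0 *\<^sub>v proj W (proj_compl U0 (unit_vec n i))))\<^sup>2
        \<le> 4 * \<sigma>\<^sup>2 * (28 / (3 * \<gamma>))\<^sup>2 * (real r * (ln 2 / 2) + 3 * ln (real n))"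
    unfolding e_def by (rule noise_event[OF A r \<sigma> U0 \<gamma>_def gap[folded \<gamma>_def]]) blast
  show ?thesis
  proof (rule that[OF E(1,2)])
    fix f U W assume f: "f \<in> E" and U: "leading_left_sing_vecs A r U" and W: "leading_left_sing_vecs (A + noise_mat n m f) r W"
    have AN: "A + noise_mat n m f \<in> carrier_mat n m" using A noise_mat_carrier[of n m f] by simp
    have o: "orthonormal_cols n r U" "orthonormal_cols n r U0" "orthonormal_cols n r W"
      using U U0 W A AN by (auto simp: leading_left_sing_vecs_def)
    let ?b = "63 * \<sigma> * (sqrt (real r) + sqrt (ln (real n))) / \<gamma>"
    have "(INF Q\<in>orth_group r. norm_2inf (W - U * Q)) \<le> norm_2inf U * s\<^sup>2 + ?b"
    proof (rule procrustes_two_inf_le[OF o(1,3) s(1)])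
      show "s < 1" using s by simp
      show "0 \<le> ?b" using \<sigma> \<gamma>0 n by simp
    next
      fix z :: "real vec" assume z: "z \<in> carrier_vec r"
      show "vnorm (proj_compl W (U *\<^sub>v z)) \<le> s * vnorm z" unfolding s_def \<gamma>_def
        by (rule proj_compl_leading_perturbed(1)[OF A r e0[unfolded \<gamma>_def] \<gamma>0[unfolded \<gamma>_def] U W _ z]) (erule E(3)[OF f])
    next
      fix i assume i: "i < n"
      have u: "unit_vec n i \<in> carrier_vec n" by simp
      have eq: "proj_compl U (unit_vec n i) = proj_compl U0 (unit_vec n i)"
        by (rule proj_compl_eq_of_leading[OF A r _ U U0 u]) (use \<gamma>0 in \<open>simp add: \<gamma>_def\<close>)
      show "vnorm (transpose_mat W *\<^sub>v proj_compl U (unit_vec n i)) \<le> ?b" unfolding eq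
      proof (rule row_bound[OF o(2,3) s _ proj_carrier(2)[OF o(2) u] \<sigma> \<gamma>0 n E(4)[OF f W i]])
        fix z :: "real vec" assume z: "z \<in> carrier_vec r"
        show "vnorm (proj_compl U0 (W *\<^sub>v z)) \<le> s * vnorm z" unfolding s_def \<gamma>_def
          by (rule proj_compl_leading_perturbed(2)[OF A r e0[unfolded \<gamma>_def] \<gamma>0[unfolded \<gamma>_def] U0 W _ z]) (erule E(3)[OF f])
      qed
    qed
    also have "norm_2inf U * s\<^sup>2 \<le> norm_2inf U * (283 * (\<sigma>\<^sup>2 * real (max n m)) / \<gamma>\<^sup>2)"
    proof (intro mult_left_mono norm_2inf_nonneg)
      have "s\<^sup>2 = 7056 / 25 * (\<sigma>\<^sup>2 * real (max n m) / \<gamma>\<^sup>2)"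
        by (simp add: s_def e_def power_divide power_mult_distrib)
      also have "\<dots> \<le> 283 * (\<sigma>\<^sup>2 * real (max n m) / \<gamma>\<^sup>2)" by (intro mult_right_mono) auto
      finally show "s\<^sup>2 \<le> 283 * (\<sigma>\<^sup>2 * real (max n m)) / \<gamma>\<^sup>2" by simp
    qed
    finally show "(INF Q\<in>orth_group r. norm_2inf (W - U * Q))
        \<le> 283 * norm_2inf U * (\<sigma>\<^sup>2 * real (max n m)) / (sing_val A r - sing_val A (r + 1))\<^sup>2
          + 63 * \<sigma> * (sqrt (real r) + sqrt (ln (real n))) / (sing_val A r - sing_val A (r + 1))"
      unfolding \<gamma>_def[symmetric] by (simp add: mult_ac)
  qed
qed

theorem theorem3p7:
  shows "\<exists>c c1 c2 :: real. \<forall>(n::nat) (m::nat) (r::nat) (A::real mat) (\<sigma>::real).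
    A \<in> carrier_mat n m \<and> 1 \<le> r \<and> r < min n m \<and> \<sigma> > 0 \<and>
    21 * \<sigma> * sqrt (real (max n m)) < sing_val A r - sing_val A (r + 1) \<longrightarrow>
    (\<exists>E \<in> sets (gauss_noise n m \<sigma>).
       measure (gauss_noise n m \<sigma>) E \<ge> 1 - c / (real n)\<^sup>2 \<and>
       (\<forall>f \<in> E. \<forall>U1 U1t.
          leading_left_sing_vecs A r U1 \<and>
          leading_left_sing_vecs (A + noise_mat n m f) r U1t \<longrightarrow>
          (INF Q \<in> orth_group r. norm_2inf (U1t - U1 * Q))
            \<le> c1 * norm_2inf U1 * (\<sigma>\<^sup>2 * real (max n m)) / (sing_val A r - sing_val A (r + 1))\<^sup>2
              + c2 * \<sigma> * (if vec_space.rank n A = r then sqrt (real r) + sqrt (ln (real n))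
                            else real r + sqrt (real r * ln (real n)))
                / (sing_val A r - sing_val A (r + 1))))"
proof (rule exI[of _ 9], rule exI[of _ 283], rule exI[of _ 63], intro allI impI, elim conjE)
  fix n m r :: nat and A :: "real mat" and \<sigma> :: real
  assume A: "A \<in> carrier_mat n m" and r: "1 \<le> r" "r < min n m" and \<sigma>: "0 < \<sigma>"
    and gap: "21 * \<sigma> * sqrt (real (max n m)) < sing_val A r - sing_val A (r + 1)"
  let ?\<gamma> = "sing_val A r - sing_val A (r + 1)"
  let ?R = "if vec_space.rank n A = r then sqrt (real r) + sqrt (ln (real n)) else real r + sqrt (real r * ln (real n))"
  obtain E where E: "E \<in> sets (gauss_noise n m \<sigma>)" "measure (gauss_noise n m \<sigma>) E \<ge> 1 - 9 / (real n)\<^sup>2"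
    "\<And>f U W. f \<in> E \<Longrightarrow> leading_left_sing_vecs A r U \<Longrightarrow> leading_left_sing_vecs (A + noise_mat n m f) r W \<Longrightarrow>
      (INF Q\<in>orth_group r. norm_2inf (W - U * Q))
        \<le> 283 * norm_2inf U * (\<sigma>\<^sup>2 * real (max n m)) / ?\<gamma>\<^sup>2 + 63 * \<sigma> * (sqrt (real r) + sqrt (ln (real n))) / ?\<gamma>"
    by (rule two_inf_bound[OF A r \<sigma> gap]) blast
  have "0 \<le> 21 * \<sigma> * sqrt (real (max n m))" using \<sigma> by simp
  then have \<gamma>: "0 < ?\<gamma>" using gap by linarith
  have "real r \<le> (real r)\<^sup>2" using r by (simp add: power2_eq_square)
  then have a: "sqrt (real r) \<le> real r" by (rule real_le_lsqrt[rotated -1]) simp_all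
  have b: "sqrt (1 * ln (real n)) \<le> sqrt (real r * ln (real n))"
    using r by (intro real_sqrt_le_mono mult_right_mono) auto
  have R: "sqrt (real r) + sqrt (ln (real n)) \<le> ?R" using add_mono[OF a b] by simp
  have R': "63 * \<sigma> * (sqrt (real r) + sqrt (ln (real n))) / ?\<gamma> \<le> 63 * \<sigma> * ?R / ?\<gamma>"
    using \<sigma> \<gamma> by (intro divide_right_mono mult_left_mono R) auto
  show "\<exists>E \<in> sets (gauss_noise n m \<sigma>). measure (gauss_noise n m \<sigma>) E \<ge> 1 - 9 / (real n)\<^sup>2 \<and>
       (\<forall>f \<in> E. \<forall>U1 U1t. leading_left_sing_vecs A r U1 \<and> leading_left_sing_vecs (A + noise_mat n m f) r U1t \<longrightarrow>
          (INF Q \<in> orth_group r. norm_2inf (U1t - U1 * Q))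
            \<le> 283 * norm_2inf U1 * (\<sigma>\<^sup>2 * real (max n m)) / ?\<gamma>\<^sup>2 + 63 * \<sigma> * ?R / ?\<gamma>)"
  proof (intro bexI[OF _ E(1)] conjI E(2) ballI allI impI)
    fix f U W assume "f \<in> E" "leading_left_sing_vecs A r U \<and> leading_left_sing_vecs (A + noise_mat n m f) r W"
    then have "(INF Q\<in>orth_group r. norm_2inf (W - U * Q))
        \<le> 283 * norm_2inf U * (\<sigma>\<^sup>2 * real (max n m)) / ?\<gamma>\<^sup>2 + 63 * \<sigma> * (sqrt (real r) + sqrt (ln (real n))) / ?\<gamma>"
      by (intro E(3)) auto
    then show "(INF Q\<in>orth_group r. norm_2inf (W - U * Q)) \<le> 283 * norm_2inf U * (\<sigma>\<^sup>2 * real (max n m)) / ?\<gamma>\<^sup>2 + 63 * \<sigma> * ?R / ?\<gamma>"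
      using R' by (rule order_trans[OF _ add_left_mono])
  qed
qed

end
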